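(* Let $\Omega$ be a bounded domain in $\mathbb{R}^N$. Then the eigenvalue problem $$L_\Delta u=\lambda u \ \text{ in } \Omega,\qquad u=0 \ \text{ in } \mathbb{R}^N\setminus\Omega$$ (understood in the weak sense) admits a sequence of eigenvalues $$\lambda_1^L(\Omega)<\lambda_2^L(\Omega)\le \cdots\le \lambda_k^L(\Omega)\le \lambda_{k+1}^L(\Omega)\le \cdots$$ and corresponding eigenfunctions $\xi_k\in\mathbb{H}(\Omega)$, $k \in \mathbb{N}$, such that the following holds: (i) $\lambda_{k}^L(\Omega)=\min \{\mathcal{E}_L(u,u) : u\in \mathbb{H}_k(\Omega),\ \|u\|_{L^2(\Omega)}=1\}$, where $\mathbb{H}_1(\Omega):= \mathbb{H}(\Omega)$ and $\mathbb{H}_k(\Omega):=\{u\in\mathbb{H}(\Omega) : \int_{\Omega} u \xi_i \,dx =0 \text{ for } i=1,\dots, k-1\}$ for $k>1$. (ii) $\{\xi_k : k \in \mathbb{N}\}$ is an orthonormal basis of $L^2(\Omega)$. (iii) $\xi_1$ is strictly positive in $\Omega$. Moreover, $\lambda_1^L(\Omega)$ is simple, i.e., if $u \in \mathbb{H}(\Omega)$ satisfies the eigenvalue problem in the weak sense with $\lambda = \lambda_1^L(\Omega)$, then $u=t\xi_1$ for some $t\in\mathbb{R}$. (iv) $\lim_{k \to \infty} \lambda_k^L(\Omega)=+\infty$.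
   Context: $N\ge1$; $c_N= \pi^{-N/2}\Gamma(N/2)$, $\rho_N=2 \log 2 + \psi(\frac{N}{2}) -\gamma$, with $\psi=\Gamma'/\Gamma$ and $\gamma=-\Gamma'(1)$. Functions are identified if they agree a.e. (pointwise inequalities are understood a.e.), and $L^2(\Omega)$ is identified with the functions in $L^2(\mathbb{R}^N)$ vanishing on $\mathbb{R}^N\setminus\Omega$. $\mathbb{H}(\Omega)$ is the space of measurable $u:\mathbb{R}^N\to\mathbb{R}$ with $u\equiv0$ on $\mathbb{R}^N\setminus\Omega$ and $\iint_{|x-y|\le1}\frac{(u(x)-u(y))^2}{|x-y|^N}\,dx\,dy<\infty$; it is a Hilbert space (contained in $L^2(\Omega)$) with inner product $$\mathcal{E}(u,w)=\frac{c_N}{2}\iint_{x,y\in\mathbb{R}^N,\,|x-y|\le1}\frac{(u(x)-u(y))(w(x)-w(y))}{|x-y|^N}\,dx\,dy.$$ The quadratic form associated with the logarithmic Laplacian $L_\Delta$ is $$\mathcal{E}_L(u,w)=\mathcal{E}(u,w)-c_N\iint_{x,y\in\mathbb{R}^N,\,|x-y|\ge1}\frac{u(x)w(y)}{|x-y|^N}\,dx\,dy+\rho_N\int_{\mathbb{R}^N}uw\,dx .$$ A function $u\in\mathbb{H}(\Omega)$ solves the eigenvalue problem in the weak sense if $\mathcal{E}_L(u,\phi)=\lambda\int_\Omega u\phi\,dx$ for all $\phi\in\mathbb{H}(\Omega)$; a nonzero such $u$ is called an eigenfunction corresponding to the eigenvalue $\lambda$. *)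

theory Defs
  imports "HOL-Analysis.Analysis"
begin

text \<open>
  The Euclidean space \<open>\<real>\<^sup>N\<close> is a type \<open>'a :: euclidean_space\<close> with \<open>N = DIM('a)\<close>.
  Function spaces are sets of honest functions; since functions are identified when they agree
  almost everywhere, "vanishes outside \<open>\<Omega>\<close>", "nonzero", equality and pointwise inequalities are
  all taken almost everywhere.  Measurability is Lebesgue measurability.  Double integrals are taken
  with respect to Lebesgue measure on \<open>'a \<times> 'a\<close>, i.e. the completion of the product measure, so
  that they make sense for Lebesgue measurable functions.  On the (null) diagonal \<open>x = y\<close> the
  kernel has the junk value 0.
\<close>

definition log_const :: "nat \<Rightarrow> real" where
  "log_const N = pi powr (- (real N / 2)) * Gamma (real N / 2)"

definition log_rho :: "nat \<Rightarrow> real" where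
  "log_rho N = 2 * ln 2 + Digamma (real N / 2) - euler_mascheroni"

definition log_space :: "'a::euclidean_space set \<Rightarrow> ('a \<Rightarrow> real) set" where
  "log_space \<Omega> = {u \<in> borel_measurable lebesgue.
     (AE x in lebesgue. x \<notin> \<Omega> \<longrightarrow> u x = 0) \<and>
     set_integrable lebesgue {(x, y). norm (x - y) \<le> 1}
       (\<lambda>(x, y). (u x - u y)\<^sup>2 / norm (x - y) ^ DIM('a))}"

definition log_inner :: "('a::euclidean_space \<Rightarrow> real) \<Rightarrow> ('a \<Rightarrow> real) \<Rightarrow> real" where
  "log_inner u w = log_const DIM('a) / 2 *
     (LINT (x, y):{(x, y). norm (x - y) \<le> 1}|lebesgue.
        (u x - u y) * (w x - w y) / norm (x - y) ^ DIM('a))"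

definition log_form :: "('a::euclidean_space \<Rightarrow> real) \<Rightarrow> ('a \<Rightarrow> real) \<Rightarrow> real" where
  "log_form u w = log_inner u w
     - log_const DIM('a) *
         (LINT (x, y):{(x, y). norm (x - y) \<ge> 1}|lebesgue. u x * w y / norm (x - y) ^ DIM('a))
     + log_rho DIM('a) * (LINT x|lebesgue. u x * w x)"

definition L2_space :: "'a::euclidean_space set \<Rightarrow> ('a \<Rightarrow> real) set" where
  "L2_space \<Omega> = {u \<in> borel_measurable lebesgue.
     (AE x in lebesgue. x \<notin> \<Omega> \<longrightarrow> u x = 0) \<and> integrable lebesgue (\<lambda>x. (u x)\<^sup>2)}"

definition L2_inner :: "'a::euclidean_space set \<Rightarrow> ('a \<Rightarrow> real) \<Rightarrow> ('a \<Rightarrow> real) \<Rightarrow> real" where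
  "L2_inner \<Omega> u w = (LINT x:\<Omega>|lebesgue. u x * w x)"

definition L2_norm :: "'a::euclidean_space set \<Rightarrow> ('a \<Rightarrow> real) \<Rightarrow> real" where
  "L2_norm \<Omega> u = sqrt (L2_inner \<Omega> u u)"

definition weak_solution :: "'a::euclidean_space set \<Rightarrow> real \<Rightarrow> ('a \<Rightarrow> real) \<Rightarrow> bool" where
  "weak_solution \<Omega> \<mu> u \<longleftrightarrow>
     u \<in> log_space \<Omega> \<and> (\<forall>\<phi>\<in>log_space \<Omega>. log_form u \<phi> = \<mu> * L2_inner \<Omega> u \<phi>)"

definition eigenfunction :: "'a::euclidean_space set \<Rightarrow> real \<Rightarrow> ('a \<Rightarrow> real) \<Rightarrow> bool" where
  "eigenfunction \<Omega> \<mu> u \<longleftrightarrow> weak_solution \<Omega> \<mu> u \<and> \<not> (AE x in lebesgue. u x = 0)"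

text \<open>Sequences are indexed by \<open>k \<ge> 1\<close>; their values at 0 are irrelevant.\<close>

definition constrained_space ::
  "'a::euclidean_space set \<Rightarrow> (nat \<Rightarrow> 'a \<Rightarrow> real) \<Rightarrow> nat \<Rightarrow> ('a \<Rightarrow> real) set" where
  "constrained_space \<Omega> \<xi> k = {u \<in> log_space \<Omega>. \<forall>i\<in>{1..<k}. L2_inner \<Omega> u (\<xi> i) = 0}"

definition orthonormal_basis_L2 ::
  "'a::euclidean_space set \<Rightarrow> (nat \<Rightarrow> 'a \<Rightarrow> real) \<Rightarrow> bool" where
  "orthonormal_basis_L2 \<Omega> \<xi> \<longleftrightarrow>
     (\<forall>k\<ge>1. \<xi> k \<in> L2_space \<Omega>) \<and>
     (\<forall>j\<ge>1. \<forall>k\<ge>1. L2_inner \<Omega> (\<xi> j) (\<xi> k) = (if j = k then 1 else 0)) \<and>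
     (\<forall>f\<in>L2_space \<Omega>.
        (\<lambda>n. L2_norm \<Omega> (\<lambda>x. f x - (\<Sum>k=1..n. L2_inner \<Omega> f (\<xi> k) * \<xi> k x))) \<longlonglongrightarrow> 0)"

definition is_minimum :: "real \<Rightarrow> real set \<Rightarrow> bool" where
  "is_minimum m S \<longleftrightarrow> m \<in> S \<and> (\<forall>s\<in>S. m \<le> s)"

end

theory Submission
  imports Defs "HOL-Complex_Analysis.Great_Picard" "HOL-Library.Function_Algebras"
    "HOL-Library.Diagonal_Subsequence"
begin

text \<open>
  The form is the sum of the local energy and an \<open>L\<^sup>2\<close>-bounded symmetric form, so after adding a
  multiple of the \<open>L\<^sup>2\<close> inner product it is coercive.  The energy space embeds compactly into
  \<open>L\<^sup>2\<close>: the singular kernel dominates continuous kernels of arbitrarily large mass, and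
  convolution with such a kernel is compact by the Arzela-Ascoli theorem.  Hence a minimising
  sequence for the Rayleigh quotient has an \<open>L\<^sup>2\<close>-Cauchy subsequence, which is Cauchy in energy by
  the parallelogram identity, and the eigenvalues arise by successive minimisation on orthogonal
  complements.  Taking absolute values does not increase the form, so there is a nonnegative first
  eigenfunction \<open>v\<close>; testing its equation with the positive parts of \<open>f - n v\<close>, where \<open>f > 0\<close>
  in \<open>\<Omega>\<close>, shows that \<open>v\<close> cannot vanish on a set of positive measure, because \<open>|x - y|\<^sup>-\<^sup>N\<close>
  couples every pair of points.  Applied to the positive part of a first eigenfunction orthogonal
  to \<open>v\<close>, this gives simplicity.
\<close>

section \<open>Minimisation of coercive forms\<close>

text \<open>The exponent of the kernel is critical. When the variable is halved, |z|^-N gains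
  exactly the factor that the volume loses, so the kernel narrowly fails to be integrable at 0; this
  divergence is what produces compactness. With an additional factor |z|^2 the same scaling gives a
  contracting recursion, which places Lipschitz functions in the energy space and so yields its
  density and infinite dimension.

  Functions that agree almost everywhere are not merged into classes. Hence the \<open>L^2\<close>
  form is only semidefinite, and definiteness is replaced by statements about null vectors. Forms
  are bilinear on carrier sets only, because integrals are additive only where they converge. The
  analysis is carried out for Borel functions vanishing everywhere outside \<Omega> and for the
  product Borel measure, where Fubini's theorem is at hand; Lebesgue measurable functions are
  replaced by such representatives at the very end.

  Completeness of both spaces comes from one almost everywhere convergent subsequence together with
  Fatou's lemma.\<close>

locale sym_form_on =
  fixes S :: "'v::real_vector set" and B :: "'v \<Rightarrow> 'v \<Rightarrow> real"
  assumes subspace: "subspace S"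
    and add_left: "u \<in> S \<Longrightarrow> v \<in> S \<Longrightarrow> w \<in> S \<Longrightarrow> B (u + v) w = B u w + B v w"
    and scale_left: "u \<in> S \<Longrightarrow> w \<in> S \<Longrightarrow> B (c *\<^sub>R u) w = c * B u w"
    and sym: "u \<in> S \<Longrightarrow> w \<in> S \<Longrightarrow> B u w = B w u"
begin

lemma mem_simps [simp, intro]:
  shows "0 \<in> S" "u \<in> S \<Longrightarrow> v \<in> S \<Longrightarrow> u + v \<in> S" "u \<in> S \<Longrightarrow> v \<in> S \<Longrightarrow> u - v \<in> S"
    "u \<in> S \<Longrightarrow> c *\<^sub>R u \<in> S"
  using subspace by (auto simp: subspace_0 subspace_add subspace_diff subspace_scale)

lemma mem_sum [simp, intro]: "(\<And>i. i \<in> A \<Longrightarrow> f i \<in> S) \<Longrightarrow> sum f A \<in> S"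
  using subspace by (rule subspace_sum)

lemma add_right: "u \<in> S \<Longrightarrow> v \<in> S \<Longrightarrow> w \<in> S \<Longrightarrow> B w (u + v) = B w u + B w v"
  using add_left[of u v w] sym[of w "u + v"] sym[of w u] sym[of w v] by simp

lemma scale_right: "u \<in> S \<Longrightarrow> w \<in> S \<Longrightarrow> B w (c *\<^sub>R u) = c * B w u"
  using scale_left[of u w c] sym[of w "c *\<^sub>R u"] sym[of w u] by simp

lemma diff_left: "u \<in> S \<Longrightarrow> v \<in> S \<Longrightarrow> w \<in> S \<Longrightarrow> B (u - v) w = B u w - B v w"
  using add_left[of "u - v" v w] by simp

lemma diff_right: "u \<in> S \<Longrightarrow> v \<in> S \<Longrightarrow> w \<in> S \<Longrightarrow> B w (u - v) = B w u - B w v"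
  using add_right[of "u - v" v w] by simp

lemma zero_left: "w \<in> S \<Longrightarrow> B 0 w = 0"
  using scale_left[of 0 w 0] by simp

lemma sum_left:
  "(\<And>i. i \<in> A \<Longrightarrow> f i \<in> S) \<Longrightarrow> w \<in> S \<Longrightarrow> B (sum f A) w = (\<Sum>i\<in>A. B (f i) w)"
  by (induction A rule: infinite_finite_induct) (simp_all add: zero_left add_left)

lemma square_add: "u \<in> S \<Longrightarrow> v \<in> S \<Longrightarrow> B (u + v) (u + v) = B u u + 2 * B u v + B v v"
  by (simp add: add_left add_right sym[of v u])

lemma square_diff: "u \<in> S \<Longrightarrow> v \<in> S \<Longrightarrow> B (u - v) (u - v) = B u u - 2 * B u v + B v v"
  by (simp add: diff_left diff_right sym[of v u])

lemma square_scale: "u \<in> S \<Longrightarrow> B (c *\<^sub>R u) (c *\<^sub>R u) = c\<^sup>2 * B u u"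
  by (simp add: scale_left scale_right power2_eq_square)

lemma square_diff_commute: "u \<in> S \<Longrightarrow> v \<in> S \<Longrightarrow> B (u - v) (u - v) = B (v - u) (v - u)"
  by (simp add: square_diff sym[of v u])

lemma lincomb_left:
  assumes e: "\<And>i. i \<in> A \<Longrightarrow> e i \<in> S" and w: "w \<in> S"
  shows "B (\<Sum>i\<in>A. a i *\<^sub>R e i) w = (\<Sum>i\<in>A. a i * B (e i) w)"
proof -
  have m: "a i *\<^sub>R e i \<in> S" if "i \<in> A" for i using mem_simps(4)[OF e[OF that]] .
  have "(\<Sum>i\<in>A. B (a i *\<^sub>R e i) w) = (\<Sum>i\<in>A. a i * B (e i) w)"
    by (rule sum.cong[OF refl], rule scale_left[OF e w])
  then show ?thesis using sum_left[of A "\<lambda>i. a i *\<^sub>R e i" w, OF m w] by simp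
qed

lemma lincomb_right:
  assumes e: "\<And>i. i \<in> A \<Longrightarrow> e i \<in> S" and w: "w \<in> S"
  shows "B w (\<Sum>i\<in>A. a i *\<^sub>R e i) = (\<Sum>i\<in>A. a i * B w (e i))"
proof -
  have m: "(\<Sum>i\<in>A. a i *\<^sub>R e i) \<in> S" using mem_sum[of A "\<lambda>i. a i *\<^sub>R e i"] mem_simps(4) e by blast
  have "B (\<Sum>i\<in>A. a i *\<^sub>R e i) w = (\<Sum>i\<in>A. a i * B (e i) w)"
    by (rule lincomb_left) (use e w in auto)
  also have "\<dots> = (\<Sum>i\<in>A. a i * B w (e i))"
    by (rule sum.cong[OF refl]) (simp add: sym[OF e w])
  finally show ?thesis using sym[OF m w] by simp
qed

lemma mem_lincomb:
  assumes "\<And>i. i \<in> A \<Longrightarrow> e i \<in> S"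
  shows "(\<Sum>i\<in>A. a i *\<^sub>R e i) \<in> S"
  by (rule mem_sum, rule mem_simps(4), rule assms)

lemma residual_orthogonal:
  assumes fin: "finite A" and e: "\<And>i. i \<in> A \<Longrightarrow> e i \<in> S"
    and on: "\<And>i j. i \<in> A \<Longrightarrow> j \<in> A \<Longrightarrow> B (e i) (e j) = (if i = j then 1 else 0)"
    and f: "f \<in> S" and j: "j \<in> A"
  shows "B (f - (\<Sum>i\<in>A. B f (e i) *\<^sub>R e i)) (e j) = 0"
proof -
  have "(\<Sum>i\<in>A. B f (e i) * B (e i) (e j)) = (\<Sum>i\<in>A. if i = j then B f (e i) else 0)"
    using j by (intro sum.cong refl) (simp add: on)
  also have "\<dots> = B f (e j)" using fin j by simp
  finally have "(\<Sum>i\<in>A. B f (e i) * B (e i) (e j)) = B f (e j)" .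
  moreover have "(\<Sum>i\<in>A. B f (e i) * B (e i) (e j)) = B (\<Sum>i\<in>A. B f (e i) *\<^sub>R e i) (e j)"
    by (rule lincomb_left[symmetric]) (use e j in auto)
  moreover have "(\<Sum>i\<in>A. B f (e i) *\<^sub>R e i) \<in> S" by (rule mem_lincomb) (use e in auto)
  ultimately show ?thesis
    using diff_left[OF f _ e[OF j]] by simp
qed

text \<open>The squares \<open>c i\<close> are left free because the expansion serves two forms: the
  \<open>L^2\<close> form, for which the vectors are orthonormal, and the shifted energy, for which
  the same eigenvectors are orthogonal with squares \<open>eig i + C\<close>.\<close>

lemma square_residual:
  assumes fin: "finite A" and e: "\<And>i. i \<in> A \<Longrightarrow> e i \<in> S"
    and orth: "\<And>i j. i \<in> A \<Longrightarrow> j \<in> A \<Longrightarrow> B (e i) (e j) = (if i = j then c i else 0)"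
    and f: "f \<in> S"
  shows "B (f - (\<Sum>i\<in>A. a i *\<^sub>R e i)) (f - (\<Sum>i\<in>A. a i *\<^sub>R e i))
    = B f f - 2 * (\<Sum>i\<in>A. a i * B f (e i)) + (\<Sum>i\<in>A. (a i)\<^sup>2 * c i)"
proof -
  let ?s = "\<Sum>i\<in>A. a i *\<^sub>R e i"
  have s: "?s \<in> S" using e by auto
  have right: "B w ?s = (\<Sum>i\<in>A. a i * B w (e i))" if "w \<in> S" for w
    by (rule lincomb_right) (use e that in auto)
  have "B ?s ?s = (\<Sum>i\<in>A. a i * B (e i) ?s)"
    unfolding right[OF s] using e s by (intro sum.cong refl) (simp add: sym)
  also have "\<dots> = (\<Sum>i\<in>A. a i * (\<Sum>j\<in>A. a j * B (e i) (e j)))"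
    using e by (intro sum.cong refl) (simp add: right)
  also have "\<dots> = (\<Sum>i\<in>A. \<Sum>j\<in>A. a i * (a j * B (e i) (e j)))"
    by (simp only: sum_distrib_left)
  also have "\<dots> = (\<Sum>i\<in>A. \<Sum>j\<in>A. if i = j then (a i)\<^sup>2 * c i else 0)"
    by (intro sum.cong refl) (auto simp: orth power2_eq_square)
  also have "\<dots> = (\<Sum>i\<in>A. (a i)\<^sup>2 * c i)"
    using fin by simp
  finally have ss: "B ?s ?s = (\<Sum>i\<in>A. (a i)\<^sup>2 * c i)" .
  show ?thesis
    unfolding square_diff[OF f s] right[OF f] ss ..
qed

end

section \<open>Positive semidefinite forms\<close>

locale psd_form_on = sym_form_on +
  assumes nonneg: "u \<in> S \<Longrightarrow> 0 \<le> B u u"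
begin

lemma Cauchy_Schwarz:
  assumes u: "u \<in> S" and v: "v \<in> S"
  shows "(B u v)\<^sup>2 \<le> B u u * B v v"
proof (cases "B v v = 0")
  case True
  have *: "0 \<le> B u u - 2 * t * B u v" for t
  proof -
    have "0 \<le> B (u - t *\<^sub>R v) (u - t *\<^sub>R v)" using u v by (intro nonneg mem_simps)
    also have "\<dots> = B u u - 2 * (t * B u v) + t\<^sup>2 * B v v"
      using u v by (subst square_diff) (auto simp: scale_right scale_left power2_eq_square)
    finally show ?thesis using True by simp
  qed
  have "B u v = 0"
  proof (rule ccontr)
    assume "B u v \<noteq> 0"
    \<comment> \<open>At this value of \<open>t\<close> the quantity
      \<open>B u u - 2 * t * B u v\<close> equals -1.\<close>
    then show False using *[of "(B u u + 1) / (2 * B u v)"] by simp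
  qed
  then show ?thesis by (simp add: True)
next
  case False
  then have pos: "B v v > 0" using nonneg[OF v] by simp
  have "0 \<le> B (u - (B u v / B v v) *\<^sub>R v) (u - (B u v / B v v) *\<^sub>R v)"
    using u v by (intro nonneg) auto
  also have "\<dots> = B u u - (B u v)\<^sup>2 / B v v"
    using u v pos by (simp add: square_diff scale_right scale_left power2_eq_square)
  finally show ?thesis using pos by (simp add: field_simps)
qed

lemma orthogonal_of_null: "u \<in> S \<Longrightarrow> v \<in> S \<Longrightarrow> B u u = 0 \<Longrightarrow> B u v = 0"
  using Cauchy_Schwarz[of u v] by simp

lemma square_diff_le: "u \<in> S \<Longrightarrow> v \<in> S \<Longrightarrow> B (u - v) (u - v) \<le> 2 * B u u + 2 * B v v"
  using nonneg[of "u + v"] by (simp add: square_add square_diff)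

lemma Bessel:
  assumes fin: "finite A" and e: "\<And>i. i \<in> A \<Longrightarrow> e i \<in> S"
    and on: "\<And>i j. i \<in> A \<Longrightarrow> j \<in> A \<Longrightarrow> B (e i) (e j) = (if i = j then 1 else 0)"
    and f: "f \<in> S"
  shows "(\<Sum>i\<in>A. (B f (e i))\<^sup>2) \<le> B f f"
proof -
  have "(\<Sum>i\<in>A. B f (e i) *\<^sub>R e i) \<in> S" using e by (intro mem_sum mem_simps)
  then have "0 \<le> B (f - (\<Sum>i\<in>A. B f (e i) *\<^sub>R e i)) (f - (\<Sum>i\<in>A. B f (e i) *\<^sub>R e i))"
    using f by (intro nonneg mem_simps)
  also have "\<dots> = B f f - (\<Sum>i\<in>A. (B f (e i))\<^sup>2)"
    unfolding square_residual[OF fin e on f, simplified] by (simp add: power2_eq_square)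
  finally show ?thesis by simp
qed

end

text \<open>In the application \<open>L\<close> is \<open>L^2\<close>, \<open>H\<close> the energy
  space, \<open>I\<close> the \<open>L^2\<close> form and \<open>Q\<close> the form of the operator.
  \<open>Q\<close> may be indefinite; \<open>C\<close> is a shift that makes it dominate
  \<open>I\<close>. Compactness is phrased through Cauchy subsequences, so that no limit has to be
  named, and density through the orthogonal complement of \<open>H\<close>, which may contain only
  null vectors.\<close>

locale spectral_problem = I: psd_form_on L I + Q: sym_form_on H Q
  for L H :: "'v::real_vector set" and I Q :: "'v \<Rightarrow> 'v \<Rightarrow> real" +
  fixes C :: real
  assumes H_subset: "H \<subseteq> L"
    and coercive: "u \<in> H \<Longrightarrow> I u u \<le> Q u u + C * I u u"
    and compact: "\<And>(u :: nat \<Rightarrow> 'v) M. (\<And>n. u n \<in> H) \<Longrightarrow> (\<And>n. Q (u n) (u n) + C * I (u n) (u n) \<le> M)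
      \<Longrightarrow> \<exists>r. strict_mono (r :: nat \<Rightarrow> nat) \<and>
        (\<forall>e>0. \<exists>N. \<forall>m\<ge>N. \<forall>n\<ge>N. I (u (r m) - u (r n)) (u (r m) - u (r n)) < e)"
    and complete_H: "\<And>u :: nat \<Rightarrow> 'v. (\<And>n. u n \<in> H) \<Longrightarrow>
      (\<forall>e>0. \<exists>N. \<forall>m\<ge>N. \<forall>n\<ge>N. Q (u m - u n) (u m - u n) + C * I (u m - u n) (u m - u n) < e) \<Longrightarrow>
      \<exists>v\<in>H. (\<lambda>n. Q (u n - v) (u n - v) + C * I (u n - v) (u n - v)) \<longlonglongrightarrow> 0"
    and complete_L: "\<And>u :: nat \<Rightarrow> 'v. (\<And>n. u n \<in> L) \<Longrightarrow>
      (\<forall>e>0. \<exists>N. \<forall>m\<ge>N. \<forall>n\<ge>N. I (u m - u n) (u m - u n) < e) \<Longrightarrow>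
      \<exists>v\<in>L. (\<lambda>n. I (u n - v) (u n - v)) \<longlonglongrightarrow> 0"
    and dense: "r \<in> L \<Longrightarrow> (\<And>\<phi>. \<phi> \<in> H \<Longrightarrow> I r \<phi> = 0) \<Longrightarrow> I r r = 0"
    and infinite_dim: "\<exists>e. (\<forall>i<n::nat. e i \<in> H) \<and>
      (\<forall>i<n. \<forall>j<n. I (e i) (e j) = (if i = j then 1 else 0))"
begin

definition shifted :: "'v \<Rightarrow> 'v \<Rightarrow> real" where "shifted u v = Q u v + C * I u v"

lemma H_L [simp, intro]: "u \<in> H \<Longrightarrow> u \<in> L"
  using H_subset by auto

lemma I_le_shifted: "u \<in> H \<Longrightarrow> I u u \<le> shifted u u"
  using coercive by (simp add: shifted_def)

sublocale shifted: psd_form_on H shifted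
proof
  show "0 \<le> shifted u u" if "u \<in> H" for u
    using I_le_shifted[OF that] I.nonneg[of u] that by auto
  show "shifted u w = shifted w u" if "u \<in> H" "w \<in> H" for u w
    using Q.sym[of u w] I.sym[of u w] that by (auto simp: shifted_def)
qed (auto simp: shifted_def Q.add_left Q.scale_left I.add_left I.scale_left algebra_simps Q.subspace)

definition minimizer :: "'v set \<Rightarrow> 'v \<Rightarrow> bool" where
  "minimizer W v \<longleftrightarrow> v \<in> W \<and> I v v = 1 \<and> (\<forall>w\<in>W. I w w = 1 \<longrightarrow> Q v v \<le> Q w w)"

text \<open>Normalising \<open>w\<close> fails only for a null vector, and there coercivity gives
  \<open>0 \<le> Q w w\<close>. Freed from the constraint, minimality says that
  \<open>Q - Q v v * I\<close> is semidefinite on \<open>W\<close>.\<close>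

lemma minimizer_homogeneous:
  assumes "minimizer W v" "subspace W" "W \<subseteq> H" "w \<in> W"
  shows "Q v v * I w w \<le> Q w w"
proof (cases "I w w = 0")
  case True
  then show ?thesis using coercive[of w] assms by auto
next
  case False
  then have pos: "I w w > 0" using I.nonneg[of w] assms by force
  define w' where "w' = (1 / sqrt (I w w)) *\<^sub>R w"
  have "w' \<in> W" unfolding w'_def using assms by (intro subspace_scale)
  moreover have "I w' w' = 1" "Q w' w' = Q w w / I w w"
    using pos assms by (auto simp: w'_def I.square_scale Q.square_scale power_divide subset_iff)
  ultimately have "Q v v \<le> Q w w / I w w" using assms by (auto simp: minimizer_def)
  then show ?thesis using pos by (simp add: field_simps)
qed

text \<open>No variation is differentiated: the semidefinite form \<open>Q - Q v v * I\<close> has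
  \<open>v\<close> as a null vector, so Cauchy-Schwarz makes \<open>v\<close> orthogonal to all of
  \<open>W\<close>.\<close>

lemma Euler_Lagrange:
  assumes v: "minimizer W v" and W: "subspace W" "W \<subseteq> H" and \<phi>: "\<phi> \<in> W"
  shows "Q v \<phi> = Q v v * I v \<phi>"
proof -
  interpret D: psd_form_on W "\<lambda>x y. Q x y - Q v v * I x y"
  proof
    show "0 \<le> Q u u - Q v v * I u u" if "u \<in> W" for u
      using minimizer_homogeneous[OF v W that] by simp
  qed (use W in \<open>auto simp: Q.add_left Q.scale_left I.add_left I.scale_left algebra_simps subset_iff
       intro: Q.sym I.sym\<close>, metis H_L I.sym Q.sym)
  show ?thesis
    using D.orthogonal_of_null[of v \<phi>] v \<phi> by (simp add: minimizer_def)
qed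

text \<open>Closedness of \<open>W\<close> is required under \<open>I\<close>-convergence to an
  element of \<open>H\<close>, a condition that orthogonality constraints meet by
  Cauchy-Schwarz.\<close>

lemma minimizer_exists:
  assumes W: "subspace W" "W \<subseteq> H"
    and closed: "\<And>u v. (\<And>n::nat. u n \<in> W) \<Longrightarrow> v \<in> H \<Longrightarrow> (\<lambda>n. I (u n - v) (u n - v)) \<longlonglongrightarrow> 0 \<Longrightarrow> v \<in> W"
    and ne: "w0 \<in> W" "I w0 w0 = 1"
  shows "\<exists>v. minimizer W v"
proof -
  define V where "V = {Q w w |w. w \<in> W \<and> I w w = 1}"
  define m where "m = Inf V"
  have WH: "w \<in> H" if "w \<in> W" for w using W that by auto
  \<comment> \<open>For a unit vector, coercivity reads \<open>1 \<le> Q w w + C\<close>.\<close>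
  have bdd: "bdd_below V"
    by (rule bdd_belowI[of _ "1 - C"]) (use coercive WH in \<open>force simp: V_def\<close>)
  have Vne: "V \<noteq> {}" using ne by (auto simp: V_def)
  have m_le: "m \<le> Q w w" if "w \<in> W" "I w w = 1" for w
    unfolding m_def using that bdd by (intro cInf_lower) (auto simp: V_def)
  have m_hom: "m * I w w \<le> Q w w" if w: "w \<in> W" for w
  proof (cases "I w w = 0")
    case True
    then show ?thesis using coercive[of w] WH w by auto
  next
    case False
    then have pos: "I w w > 0" using I.nonneg[of w] WH w by force
    have "m \<le> Q ((1 / sqrt (I w w)) *\<^sub>R w) ((1 / sqrt (I w w)) *\<^sub>R w)"
      using pos w W WH by (intro m_le subspace_scale) (auto simp: I.square_scale power_divide)
    also have "\<dots> = Q w w / I w w"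
      using pos w WH by (simp add: Q.square_scale power_divide)
    finally show ?thesis using pos by (simp add: field_simps)
  qed
  have "\<exists>w. w \<in> W \<and> I w w = 1 \<and> Q w w < m + 1 / Suc n" for n :: nat
  proof -
    have "m < m + 1 / Suc n" by simp
    then obtain x where "x \<in> V" "x < m + 1 / Suc n"
      unfolding m_def using cInf_lessD[OF Vne] by blast
    then show ?thesis by (auto simp: V_def)
  qed
  then obtain u where u: "\<And>n. u n \<in> W" "\<And>n. I (u n) (u n) = 1" "\<And>n. Q (u n) (u n) < m + 1 / Suc n"
    by metis
  have uH: "u n \<in> H" for n using u WH by auto
  have "Q (u n) (u n) + C * I (u n) (u n) \<le> m + 1 + C" for n
  proof -
    have "1 / real (Suc n) \<le> 1" by simp
    moreover have "C * I (u n) (u n) = C" by (simp add: u)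
    ultimately show ?thesis using u(3)[of n] by linarith
  qed
  then have bnd: "\<And>n. Q (u n) (u n) + C * I (u n) (u n) \<le> m + 1 + C" .
  from compact[of u, OF uH bnd] obtain r :: "nat \<Rightarrow> nat" where r: "strict_mono r"
    and rC: "\<forall>e>0. \<exists>N. \<forall>m\<ge>N. \<forall>n\<ge>N. I (u (r m) - u (r n)) (u (r m) - u (r n)) < e"
    by blast
  define s where "s = u \<circ> r"
  have s: "s n \<in> W" "s n \<in> H" "s n \<in> L" "I (s n) (s n) = 1" for n
    using u uH by (auto simp: s_def)
  have sQ: "Q (s n) (s n) < m + 1 / Suc n" for n
  proof -
    have "1 / real (Suc (r n)) \<le> 1 / Suc n"
      using seq_suble[OF r, of n] by (intro divide_left_mono) auto
    then show ?thesis using u(3)[of "r n"] by (simp add: s_def)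
  qed
  \<comment> \<open>Parallelogram identity: \<open>Q\<close> at the sum is at least \<open>m\<close>
    times \<open>4 - I (s i - s j) (s i - s j)\<close>, so the terms \<open>4 * m\<close> cancel
    against \<open>2 * Q (s i) (s i) + 2 * Q (s j) (s j)\<close>, which exceeds them only by the
    errors of the minimising sequence.\<close>
  have Qdiff: "Q (s i - s j) (s i - s j) \<le> 2 / Suc i + 2 / Suc j + \<bar>m\<bar> * I (s i - s j) (s i - s j)" for i j
  proof -
    have "m * I (s i + s j) (s i + s j) \<le> Q (s i + s j) (s i + s j)"
      using s W by (intro m_hom subspace_add) auto
    moreover have "I (s i + s j) (s i + s j) = 4 - I (s i - s j) (s i - s j)"
      using s by (simp add: I.square_add I.square_diff)
    moreover have "Q (s i - s j) (s i - s j) = 2 * Q (s i) (s i) + 2 * Q (s j) (s j) - Q (s i + s j) (s i + s j)"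
      using s by (simp add: Q.square_add Q.square_diff)
    moreover have "m * I (s i - s j) (s i - s j) \<le> \<bar>m\<bar> * I (s i - s j) (s i - s j)"
      using s by (intro mult_right_mono I.nonneg) auto
    ultimately show ?thesis using sQ[of i] sQ[of j] by (simp add: algebra_simps)
  qed
  have Cauchy: "\<forall>e>0. \<exists>N. \<forall>i\<ge>N. \<forall>j\<ge>N. Q (s i - s j) (s i - s j) + C * I (s i - s j) (s i - s j) < e"
  proof (intro allI impI)
    fix e :: real assume e: "e > 0"
    \<comment> \<open>\<open>D\<close> collects the coefficient |m| of the previous estimate and |C|
      of the shift; the summand 1 keeps it positive. The \<open>I\<close>-term may then use e/2 and
      each of the terms \<open>2 / Suc k\<close> may use e/4.\<close>
    define D where "D = \<bar>m\<bar> + \<bar>C\<bar> + 1"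
    have D: "D > 0" by (simp add: D_def add_pos_nonneg add_nonneg_pos)
    obtain N1 where N1: "\<And>i j. i \<ge> N1 \<Longrightarrow> j \<ge> N1 \<Longrightarrow> I (s i - s j) (s i - s j) < e / 2 / D"
      using rC[rule_format, of "e / 2 / D"] e D by (auto simp: s_def)
    obtain N2 :: nat where N2: "8 / e < N2" using reals_Archimedean2 by blast
    have "Q (s i - s j) (s i - s j) + C * I (s i - s j) (s i - s j) < e" if ij: "i \<ge> max N1 N2" "j \<ge> max N1 N2" for i j
    proof -
      have small: "2 / real (Suc k) < e / 4" if "k \<ge> N2" for k
      proof -
        have "8 / e < Suc k" using N2 that by linarith
        then show ?thesis using e by (simp add: field_simps del: of_nat_Suc)
      qed
      have "D * I (s i - s j) (s i - s j) < e / 2"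
        using N1[of i j] ij D by (simp add: field_simps)
      moreover have "C * I (s i - s j) (s i - s j) \<le> \<bar>C\<bar> * I (s i - s j) (s i - s j)"
        using s by (intro mult_right_mono I.nonneg) auto
      moreover have "0 \<le> I (s i - s j) (s i - s j)" using s by (intro I.nonneg) auto
      ultimately show ?thesis using Qdiff[of i j] small[of i] small[of j] ij
        by (simp add: D_def algebra_simps del: of_nat_Suc)
    qed
    then show "\<exists>N. \<forall>i\<ge>N. \<forall>j\<ge>N. Q (s i - s j) (s i - s j) + C * I (s i - s j) (s i - s j) < e"
      by blast
  qed
  from complete_H[OF s(2) Cauchy] obtain v where v: "v \<in> H" and "(\<lambda>n. shifted (s n - v) (s n - v)) \<longlonglongrightarrow> 0"
    by (auto simp: shifted_def)
  note lim = this(2)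
  have Ilim: "(\<lambda>n. I (s n - v) (s n - v)) \<longlonglongrightarrow> 0"
    using I_le_shifted I.nonneg s v by (intro tendsto_sandwich[OF _ _ tendsto_const lim]) auto
  have vW: "v \<in> W" using closed[OF s(1) v Ilim] .
  \<comment> \<open>Continuity of squares holds for semidefinite forms by Cauchy-Schwarz. As
    \<open>Q\<close> may be indefinite, its convergence is obtained by applying this to
    \<open>I\<close> and to \<open>shifted\<close> and subtracting.\<close>
  have sq: "(\<lambda>n. F (s n) (s n)) \<longlonglongrightarrow> F v v" if "psd_form_on H F" "(\<lambda>n. F (s n - v) (s n - v)) \<longlonglongrightarrow> 0" for F
  proof -
    interpret F: psd_form_on H F by fact
    have "(\<lambda>n. sqrt (F (s n - v) (s n - v) * F v v)) \<longlonglongrightarrow> sqrt (0 * F v v)"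
      by (intro tendsto_intros that)
    then have "(\<lambda>n. sqrt (F (s n - v) (s n - v) * F v v)) \<longlonglongrightarrow> 0" by simp
    moreover have "norm (F (s n - v) v) \<le> sqrt (F (s n - v) (s n - v) * F v v)" for n
      using F.Cauchy_Schwarz[of "s n - v" v] s v by (simp add: real_le_rsqrt)
    ultimately have "(\<lambda>n. F (s n - v) v) \<longlonglongrightarrow> 0"
      by (intro Lim_null_comparison[of "\<lambda>n. F (s n - v) v" "\<lambda>n. sqrt (F (s n - v) (s n - v) * F v v)"]) auto
    then have "(\<lambda>n. F (s n - v) (s n - v) + 2 * F (s n - v) v + F v v) \<longlonglongrightarrow> 0 + 2 * 0 + F v v"
      by (intro tendsto_intros that)
    moreover have "F (s n) (s n) = F (s n - v) (s n - v) + 2 * F (s n - v) v + F v v" for n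
      using F.square_add[of "s n - v" v] s v by simp
    ultimately show ?thesis by simp
  qed
  have "psd_form_on H I"
    by unfold_locales (auto simp: I.add_left I.scale_left Q.subspace I.nonneg intro: I.sym)
  from sq[OF this Ilim] have "(\<lambda>n. 1) \<longlonglongrightarrow> I v v" using s by simp
  then have Iv: "I v v = 1" by (simp add: LIMSEQ_const_iff)
  have "(\<lambda>n. shifted (s n) (s n) - C * I (s n) (s n)) \<longlonglongrightarrow> shifted v v - C * I v v"
    by (intro tendsto_intros sq lim Ilim \<open>psd_form_on H I\<close> shifted.psd_form_on_axioms)
  then have Qlim: "(\<lambda>n. Q (s n) (s n)) \<longlonglongrightarrow> Q v v" by (simp add: shifted_def)
  have "(\<lambda>n. m + 1 / real (Suc n)) \<longlonglongrightarrow> m + 0"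
    by (intro tendsto_intros LIMSEQ_Suc[OF lim_1_over_n])
  from LIMSEQ_le[OF Qlim this] sQ have "Q v v \<le> m" by (auto intro: less_imp_le)
  with vW Iv m_le show ?thesis unfolding minimizer_def by (meson order_trans)
qed

definition orth_compl :: "(nat \<Rightarrow> 'v) \<Rightarrow> nat \<Rightarrow> 'v set" where
  "orth_compl \<xi> k = {u \<in> H. \<forall>i\<in>{1..<k}. I u (\<xi> i) = 0}"

lemma orth_compl_subset: "orth_compl \<xi> k \<subseteq> H" by (auto simp: orth_compl_def)

lemma orth_compl_subspace: "(\<And>i. i \<in> {1..<k} \<Longrightarrow> \<xi> i \<in> L) \<Longrightarrow> subspace (orth_compl \<xi> k)"
  by (auto simp: orth_compl_def subspace_def I.add_left I.scale_left I.zero_left)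

text \<open>A dimension count supplies a competitor. If all residuals \<open>P f\<close> were null,
  Bessel's inequality would be an equality for each of k + 1 orthonormal vectors \<open>e j\<close>;
  summing over \<open>j\<close>, exchanging the sums and applying Bessel to each
  \<open>\<xi> i\<close> against the \<open>e j\<close> bounds k + 1 by the number of the
  \<open>\<xi> i\<close>.\<close>

lemma minimizer_orth_compl_exists:
  assumes \<xi>: "\<And>i. i \<in> {1..<k} \<Longrightarrow> \<xi> i \<in> H"
    and on: "\<And>i j. i \<in> {1..<k} \<Longrightarrow> j \<in> {1..<k} \<Longrightarrow> I (\<xi> i) (\<xi> j) = (if i = j then 1 else 0)"
  shows "\<exists>v. minimizer (orth_compl \<xi> k) v"
proof -
  obtain e where e: "\<And>i. i < Suc k \<Longrightarrow> e i \<in> H"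
    and eo: "\<And>i j. i < Suc k \<Longrightarrow> j < Suc k \<Longrightarrow> I (e i) (e j) = (if i = j then 1 else 0)"
    using infinite_dim[of "Suc k"] by auto
  define P where "P f = f - (\<Sum>i\<in>{1..<k}. I f (\<xi> i) *\<^sub>R \<xi> i)" for f
  have PH: "P f \<in> H" if "f \<in> H" for f
    unfolding P_def using that \<xi> by (intro Q.mem_simps Q.mem_sum) auto
  have PI: "I (P f) (P f) = I f f - (\<Sum>i\<in>{1..<k}. (I f (\<xi> i))\<^sup>2)" if "f \<in> H" for f
    using I.square_residual[of "{1..<k}" \<xi> "\<lambda>_. 1" f "\<lambda>i. I f (\<xi> i)"] that \<xi> on
    by (simp add: P_def power2_eq_square)
  have PW: "P f \<in> orth_compl \<xi> k" if f: "f \<in> H" for f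
  proof -
    have "I (P f) (\<xi> j) = 0" if j: "j \<in> {1..<k}" for j
      unfolding P_def using f \<xi> on j by (intro I.residual_orthogonal) auto
    then show ?thesis using PH[OF f] by (auto simp: orth_compl_def)
  qed
  have "\<exists>f\<in>H. I (P f) (P f) > 0"
  proof (rule ccontr)
    assume "\<not> ?thesis"
    then have le: "I f f \<le> (\<Sum>i\<in>{1..<k}. (I f (\<xi> i))\<^sup>2)" if "f \<in> H" for f
      using PI[OF that] that by force
    have "real (Suc k) = (\<Sum>j<Suc k. I (e j) (e j))" using eo by simp
    also have "\<dots> \<le> (\<Sum>j<Suc k. \<Sum>i\<in>{1..<k}. (I (e j) (\<xi> i))\<^sup>2)"
      using e le by (intro sum_mono) auto
    also have "\<dots> = (\<Sum>i\<in>{1..<k}. \<Sum>j<Suc k. (I (\<xi> i) (e j))\<^sup>2)"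
      using e \<xi> by (subst sum.swap) (intro sum.cong refl, simp add: I.sym)
    also have "\<dots> \<le> (\<Sum>i\<in>{1..<k}. I (\<xi> i) (\<xi> i))"
      using e eo \<xi> by (intro sum_mono I.Bessel) auto
    also have "\<dots> = real (k - 1)" using on by simp
    finally show False by simp
  qed
  then obtain f where f: "f \<in> H" "I (P f) (P f) > 0" by blast
  have sub: "subspace (orth_compl \<xi> k)" using \<xi> by (intro orth_compl_subspace) auto
  show ?thesis
  proof (rule minimizer_exists[OF sub orth_compl_subset])
    show "(1 / sqrt (I (P f) (P f))) *\<^sub>R P f \<in> orth_compl \<xi> k" using PW[OF f(1)] sub by (intro subspace_scale)
    show "I ((1 / sqrt (I (P f) (P f))) *\<^sub>R P f) ((1 / sqrt (I (P f) (P f))) *\<^sub>R P f) = 1"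
      using f PH[OF f(1)] by (simp add: I.square_scale power_divide)
    fix u :: "nat \<Rightarrow> 'v" and v
    assume u: "\<And>n. u n \<in> orth_compl \<xi> k" and v: "v \<in> H" and lim: "(\<lambda>n. I (u n - v) (u n - v)) \<longlonglongrightarrow> 0"
    have "I v (\<xi> i) = 0" if i: "i \<in> {1..<k}" for i
    proof -
      \<comment> \<open>Since \<open>u n\<close> satisfies the constraint, the defect of
        \<open>v\<close> is the pairing of \<open>u n - v\<close> with the unit vector
        \<open>\<xi> i\<close>.\<close>
      have "(I v (\<xi> i))\<^sup>2 \<le> I (u n - v) (u n - v)" for n
      proof -
        have "I (u n - v) (\<xi> i) = - I v (\<xi> i)"
          using u[of n] v i \<xi>[OF i] by (subst I.diff_left) (auto simp: orth_compl_def)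
        moreover have "(I (u n - v) (\<xi> i))\<^sup>2 \<le> I (u n - v) (u n - v) * I (\<xi> i) (\<xi> i)"
          using u[of n] v \<xi>[OF i] by (intro I.Cauchy_Schwarz) (auto simp: orth_compl_def)
        ultimately show ?thesis using on[OF i i] by simp
      qed
      then have "(I v (\<xi> i))\<^sup>2 \<le> 0" using lim by (intro LIMSEQ_le[OF tendsto_const lim]) auto
      then show ?thesis by simp
    qed
    then show "v \<in> orth_compl \<xi> k" using v by (auto simp: orth_compl_def)
  qed
qed

lemma first_minimizer_exists: "\<exists>v. minimizer H v"
  using minimizer_orth_compl_exists[of 1 undefined] by (simp add: orth_compl_def)

text \<open>The first minimiser is prescribed rather than chosen, so that the application can start
  the sequence with a nonnegative function.\<close>

theorem spectral_sequence:
  assumes v1: "minimizer H v1"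
  obtains \<xi> :: "nat \<Rightarrow> 'v" and eig :: "nat \<Rightarrow> real" where
    "\<xi> 1 = v1"
    "\<And>k. k \<ge> 1 \<Longrightarrow> \<xi> k \<in> H"
    "\<And>k. k \<ge> 1 \<Longrightarrow> eig k = Q (\<xi> k) (\<xi> k)"
    "\<And>j k. j \<ge> 1 \<Longrightarrow> k \<ge> 1 \<Longrightarrow> I (\<xi> j) (\<xi> k) = (if j = k then 1 else 0)"
    "\<And>k. k \<ge> 1 \<Longrightarrow> minimizer (orth_compl \<xi> k) (\<xi> k)"
    "\<And>k \<phi>. k \<ge> 1 \<Longrightarrow> \<phi> \<in> H \<Longrightarrow> Q (\<xi> k) \<phi> = eig k * I (\<xi> k) \<phi>"
    "\<And>j k. 1 \<le> j \<Longrightarrow> j \<le> k \<Longrightarrow> eig j \<le> eig k"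
    "filterlim eig at_top sequentially"
    "\<And>f. f \<in> L \<Longrightarrow> (\<lambda>n. I (f - (\<Sum>k=1..n. I f (\<xi> k) *\<^sub>R \<xi> k)) (f - (\<Sum>k=1..n. I f (\<xi> k) *\<^sub>R \<xi> k))) \<longlonglongrightarrow> 0"
proof -
  \<comment> \<open>The recursion must offer a value for every prefix, also for one that is not
    orthonormal. Minimality is therefore demanded only conditionally, and \<open>main\<close>
    discharges the condition by induction. Index 0 is unconstrained.\<close>
  define Pr where "Pr = (\<lambda>\<xi> k v. (k \<ge> 1 \<longrightarrow>
     ((\<forall>i\<in>{1..<k}. \<xi> i \<in> H \<and> (\<forall>j\<in>{1..<k}. I (\<xi> i) (\<xi> j) = (if i = j then 1 else 0))) \<longrightarrow> minimizer (orth_compl \<xi> k) v) \<and>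
     (k = 1 \<longrightarrow> v = v1)))"
  have "\<exists>\<xi>::nat \<Rightarrow> 'v. \<forall>k. Pr \<xi> k (\<xi> k)"
  proof (rule dependent_wellorder_choice)
    fix r and f g :: "nat \<Rightarrow> 'v" and x
    assume "\<And>y. y < x \<Longrightarrow> f y = g y"
    then have "\<forall>y\<in>{1..<x}. f y = g y" by auto
    moreover from this have "orth_compl f x = orth_compl g x" by (auto simp: orth_compl_def)
    ultimately show "Pr f x r = Pr g x r" by (auto simp: Pr_def)
  next
    fix x and f :: "nat \<Rightarrow> 'v"
    show "\<exists>r. Pr f x r"
    proof (cases "x = 1")
      case True
      then show ?thesis using v1 by (auto simp: Pr_def orth_compl_def)
    next
      case False
      then show ?thesis using minimizer_orth_compl_exists[of x f] by (auto simp: Pr_def)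
    qed
  qed
  then obtain \<xi> where \<xi>: "\<And>k. Pr \<xi> k (\<xi> k)" by blast
  have x1: "\<xi> 1 = v1" using \<xi>[of 1] by (simp add: Pr_def)
  have main: "(\<forall>i\<in>{1..<k}. \<xi> i \<in> H \<and> (\<forall>j\<in>{1..<k}. I (\<xi> i) (\<xi> j) = (if i = j then 1 else 0)))" for k
  proof (induction k)
    case (Suc k)
    show ?case
    proof (cases "k \<ge> 1")
      case True
      then have "minimizer (orth_compl \<xi> k) (\<xi> k)" using \<xi>[of k] Suc by (auto simp: Pr_def)
      then have *: "\<xi> k \<in> H" "I (\<xi> k) (\<xi> k) = 1" "\<And>i. i \<in> {1..<k} \<Longrightarrow> I (\<xi> k) (\<xi> i) = 0"
        by (auto simp: minimizer_def orth_compl_def)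
      moreover have "I (\<xi> i) (\<xi> k) = 0" if "i \<in> {1..<k}" for i
        using *(1) *(3)[OF that] Suc that I.sym[of "\<xi> i" "\<xi> k"] by auto
      ultimately show ?thesis using Suc True
        by (auto simp: less_Suc_eq atLeastLessThanSuc split: if_splits)
    qed simp
  qed simp
  have min: "minimizer (orth_compl \<xi> k) (\<xi> k)" if "k \<ge> 1" for k
    using \<xi>[of k] main[of k] that by (auto simp: Pr_def)
  have H: "\<xi> k \<in> H" if "k \<ge> 1" for k using main[of "Suc k"] that by auto
  have on: "I (\<xi> j) (\<xi> k) = (if j = k then 1 else 0)" if "j \<ge> 1" "k \<ge> 1" for j k
    using main[of "Suc (max j k)"] that by auto
  define eig where "eig k = Q (\<xi> k) (\<xi> k)" for k
  have Wsub: "subspace (orth_compl \<xi> k)" for k using H by (intro orth_compl_subspace) auto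
  have orth_compl_mono: "orth_compl \<xi> k \<subseteq> orth_compl \<xi> j" if "j \<le> k" for j k using that by (auto simp: orth_compl_def)
  have mono: "eig j \<le> eig k" if "1 \<le> j" "j \<le> k" for j k
    using min[of j] min[of k] orth_compl_mono[of j k] that by (auto simp: minimizer_def eig_def)
  have orthQ: "Q (\<xi> k) (\<xi> i) = 0" if "1 \<le> i" "i < k" for i k
  proof -
    have "\<xi> k \<in> orth_compl \<xi> i" using min[of k] orth_compl_mono[of i k] that by (auto simp: minimizer_def)
    from Euler_Lagrange[OF min Wsub orth_compl_subset this] that have "Q (\<xi> i) (\<xi> k) = 0"
      using on[of i k] by simp
    then show ?thesis using H[of i] H[of k] that Q.sym[of "\<xi> k" "\<xi> i"] by simp
  qed
  have res_W: "f - (\<Sum>i=1..n. I f (\<xi> i) *\<^sub>R \<xi> i) \<in> orth_compl \<xi> (Suc n)" if f: "f \<in> H" for f n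
  proof -
    have "I (f - (\<Sum>i=1..n. I f (\<xi> i) *\<^sub>R \<xi> i)) (\<xi> j) = 0" if j: "j \<in> {1..<Suc n}" for j
      using f H on j by (intro I.residual_orthogonal) auto
    moreover have "f - (\<Sum>i=1..n. I f (\<xi> i) *\<^sub>R \<xi> i) \<in> H" using f H by (intro Q.mem_simps Q.mem_lincomb) auto
    ultimately show ?thesis by (simp add: orth_compl_def)
  qed
  \<comment> \<open>Minimality gives the equation only for test vectors in the complement.
    Subtracting from \<phi> its components along the earlier \<open>\<xi> i\<close> changes neither
    side, since \<open>\<xi> k\<close> is orthogonal to them both for \<open>I\<close> and for
    \<open>Q\<close>.\<close>
  have eqn: "Q (\<xi> k) \<phi> = eig k * I (\<xi> k) \<phi>" if k: "k \<ge> 1" and \<phi>: "\<phi> \<in> H" for k \<phi>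
  proof -
    define \<psi> where "\<psi> = \<phi> - (\<Sum>i=1..k-1. I \<phi> (\<xi> i) *\<^sub>R \<xi> i)"
    have \<psi>: "\<psi> \<in> orth_compl \<xi> k" "\<psi> \<in> H" using res_W[OF \<phi>, of "k - 1"] k by (auto simp: \<psi>_def orth_compl_def)
    have eq: "\<phi> = \<psi> + (\<Sum>i=1..k-1. I \<phi> (\<xi> i) *\<^sub>R \<xi> i)" by (simp add: \<psi>_def)
    have mem: "(\<Sum>i=1..k-1. I \<phi> (\<xi> i) *\<^sub>R \<xi> i) \<in> H" using H by (intro Q.mem_lincomb) auto
    have "Q (\<xi> k) (\<Sum>i=1..k-1. I \<phi> (\<xi> i) *\<^sub>R \<xi> i) = 0"
      using H k by (subst Q.lincomb_right) (auto simp: orthQ intro!: sum.neutral)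
    moreover have "I (\<xi> k) (\<Sum>i=1..k-1. I \<phi> (\<xi> i) *\<^sub>R \<xi> i) = 0"
      using H k by (subst I.lincomb_right) (auto simp: on intro!: sum.neutral)
    ultimately have "Q (\<xi> k) \<phi> = Q (\<xi> k) \<psi>" "I (\<xi> k) \<phi> = I (\<xi> k) \<psi>"
      using Q.add_right[OF \<psi>(2) mem H[OF k]] I.add_right[OF H_L[OF \<psi>(2)] H_L[OF mem] H_L[OF H[OF k]]]
      unfolding eq[symmetric] by linarith+
    then show ?thesis using Euler_Lagrange[OF min[OF k] Wsub orth_compl_subset \<psi>(1)] by (simp add: eig_def)
  qed
  \<comment> \<open>Bounded eigenvalues would give an energy-bounded orthonormal sequence; its
    members have squared distance 2, which no Cauchy subsequence tolerates.\<close>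
  have unbounded: "\<exists>k\<ge>1. eig k > M" for M
  proof (rule ccontr)
    assume "\<not> ?thesis"
    then have le: "eig (Suc k) \<le> M" for k by (metis One_nat_def le_add1 not_le plus_1_eq_Suc)
    have "Q (\<xi> (Suc n)) (\<xi> (Suc n)) + C * I (\<xi> (Suc n)) (\<xi> (Suc n)) \<le> M + C" for n
      using le[of n] on[of "Suc n" "Suc n"] by (simp add: eig_def)
    then have bnd: "\<And>n. Q (\<xi> (Suc n)) (\<xi> (Suc n)) + C * I (\<xi> (Suc n)) (\<xi> (Suc n)) \<le> M + C" .
    have HS: "\<xi> (Suc n) \<in> H" for n using H by simp
    obtain r :: "nat \<Rightarrow> nat" where r: "strict_mono r"
      "\<forall>e>0. \<exists>N. \<forall>m\<ge>N. \<forall>n\<ge>N. I (\<xi> (Suc (r m)) - \<xi> (Suc (r n))) (\<xi> (Suc (r m)) - \<xi> (Suc (r n))) < e"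
      using compact[of "\<lambda>n. \<xi> (Suc n)", OF HS bnd] by blast
    obtain N where N: "\<forall>m\<ge>N. \<forall>n\<ge>N. I (\<xi> (Suc (r m)) - \<xi> (Suc (r n))) (\<xi> (Suc (r m)) - \<xi> (Suc (r n))) < 1"
      using r(2)[rule_format, of 1] by auto
    have "I (\<xi> (Suc (r N)) - \<xi> (Suc (r (Suc N)))) (\<xi> (Suc (r N)) - \<xi> (Suc (r (Suc N)))) < 1"
      using N[rule_format, of N "Suc N"] by simp
    moreover have "r N \<noteq> r (Suc N)" using r(1) by (metis strict_mono_eq n_not_Suc_n)
    ultimately show False
      using I.square_diff[of "\<xi> (Suc (r N))" "\<xi> (Suc (r (Suc N)))"] HS on by simp
  qed
  have lim: "filterlim eig at_top sequentially"
    unfolding filterlim_at_top eventually_sequentially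
  proof
    fix Z
    obtain k where "k \<ge> 1" "eig k > Z" using unbounded by blast
    then show "\<exists>N. \<forall>n\<ge>N. Z \<le> eig n" using mono[of k] by (intro exI[of _ k]) fastforce
  qed
  \<comment> \<open>The residual lies in the next complement, so
    \<open>(eig (Suc n) + C) * I (s n) (s n)\<close> is at most its shifted energy. The eigenvectors
    are orthogonal for \<open>shifted\<close> too, so taking residuals does not increase that
    energy; division by the growing eigenvalue finishes.\<close>
  have basis_H: "(\<lambda>n. I (f - (\<Sum>k=1..n. I f (\<xi> k) *\<^sub>R \<xi> k)) (f - (\<Sum>k=1..n. I f (\<xi> k) *\<^sub>R \<xi> k))) \<longlonglongrightarrow> 0"
    if f: "f \<in> H" for f
  proof -
    define s where "s n = f - (\<Sum>k=1..n. I f (\<xi> k) *\<^sub>R \<xi> k)" for n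
    have sW: "s n \<in> orth_compl \<xi> (Suc n)" and sH: "s n \<in> H" for n
      using res_W[OF f, of n] by (auto simp: s_def orth_compl_def)
    have bound: "shifted (s n) (s n) \<le> shifted f f" for n
    proof -
      have orth_shifted: "shifted (\<xi> i) (\<xi> j) = (if i = j then eig i + C else 0)" if "i \<in> {1..n}" "j \<in> {1..n}" for i j
        using that eqn[of i "\<xi> j"] on[of i j] H by (auto simp: shifted_def)
      have shifted_f: "shifted f (\<xi> i) = (eig i + C) * I f (\<xi> i)" if "i \<in> {1..n}" for i
        using that eqn[of i f] H f Q.sym[of f "\<xi> i"] I.sym[of f "\<xi> i"] by (simp add: shifted_def algebra_simps)
      have nn: "0 \<le> eig i + C" if "i \<in> {1..n}" for i
        using orth_shifted[of i i] shifted.nonneg[of "\<xi> i"] H that by auto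
      have "shifted (s n) (s n) = shifted f f - 2 * (\<Sum>i=1..n. I f (\<xi> i) * shifted f (\<xi> i)) + (\<Sum>i=1..n. (I f (\<xi> i))\<^sup>2 * (eig i + C))"
        unfolding s_def using orth_shifted H f by (intro shifted.square_residual) auto
      also have "(\<Sum>i=1..n. I f (\<xi> i) * shifted f (\<xi> i)) = (\<Sum>i=1..n. (I f (\<xi> i))\<^sup>2 * (eig i + C))"
        by (intro sum.cong refl) (simp add: shifted_f power2_eq_square)
      finally have "shifted (s n) (s n) = shifted f f - (\<Sum>i=1..n. (I f (\<xi> i))\<^sup>2 * (eig i + C))" by simp
      moreover have "0 \<le> (\<Sum>i=1..n. (I f (\<xi> i))\<^sup>2 * (eig i + C))"
        using nn by (intro sum_nonneg) auto
      ultimately show ?thesis by simp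
    qed
    have hom: "(eig (Suc n) + C) * I (s n) (s n) \<le> shifted f f" for n
      using minimizer_homogeneous[OF min Wsub orth_compl_subset sW, of n] bound[of n]
      by (simp add: shifted_def eig_def algebra_simps)
    have "filterlim (\<lambda>n. eig (Suc n) + C) at_top sequentially"
      using filterlim_tendsto_add_at_top[OF tendsto_const[of C] filterlim_compose[OF lim filterlim_Suc]]
      by (simp add: add.commute)
    note atop = this
    have l0: "(\<lambda>n. shifted f f / (eig (Suc n) + C)) \<longlonglongrightarrow> 0"
      by (rule tendsto_divide_0[OF tendsto_const filterlim_at_top_imp_at_infinity[OF atop]])
    have ev: "eventually (\<lambda>n. eig (Suc n) + C > 0) sequentially"
      using atop by (simp add: filterlim_at_top_dense)
    have "eventually (\<lambda>n. I (s n) (s n) \<le> shifted f f / (eig (Suc n) + C)) sequentially"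
      using ev by eventually_elim (use hom in \<open>simp add: field_simps\<close>)
    then have "(\<lambda>n. I (s n) (s n)) \<longlonglongrightarrow> 0"
      using sH I.nonneg by (intro tendsto_sandwich[OF _ _ tendsto_const l0]) auto
    then show ?thesis by (simp add: s_def)
  qed
  \<comment> \<open>For general \<open>f\<close> no energy bound exists. The residuals are Cauchy
    because their squares decrease, and their limit \<open>r\<close> turns out to be orthogonal to
    \<open>H\<close>, hence null.\<close>
  have basis_L: "(\<lambda>n. I (f - (\<Sum>k=1..n. I f (\<xi> k) *\<^sub>R \<xi> k)) (f - (\<Sum>k=1..n. I f (\<xi> k) *\<^sub>R \<xi> k))) \<longlonglongrightarrow> 0"
    if f: "f \<in> L" for f
  proof -
    define s where "s n = f - (\<Sum>k=1..n. I f (\<xi> k) *\<^sub>R \<xi> k)" for n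
    have sL: "s n \<in> L" for n unfolding s_def using f H by (intro I.mem_simps I.mem_lincomb) auto
    have Is: "I (s n) (s n) = I f f - (\<Sum>k=1..n. (I f (\<xi> k))\<^sup>2)" for n
      using I.square_residual[of "{1..n}" \<xi> "\<lambda>_. 1" f "\<lambda>k. I f (\<xi> k)"] f H on
      by (auto simp: s_def power2_eq_square)
    have diff: "I (s m - s n) (s m - s n) = I (s n) (s n) - I (s m) (s m)" if "n \<le> m" for m n
    proof -
      have split: "{1..m} = {1..n} \<union> {Suc n..m}" using that by auto
      have "s m = s n - (\<Sum>k=Suc n..m. I f (\<xi> k) *\<^sub>R \<xi> k)"
        unfolding s_def split by (subst sum.union_disjoint) auto
      then have "s m - s n = 0 - (\<Sum>k=Suc n..m. I f (\<xi> k) *\<^sub>R \<xi> k)" by simp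
      then have "I (s m - s n) (s m - s n) = (\<Sum>k=Suc n..m. (I f (\<xi> k))\<^sup>2)"
        using I.square_residual[of "{Suc n..m}" \<xi> "\<lambda>_. 1" 0 "\<lambda>k. I f (\<xi> k)"] H on
        by (simp add: I.zero_left)
      moreover have "(\<Sum>k=1..m. (I f (\<xi> k))\<^sup>2) = (\<Sum>k=1..n. (I f (\<xi> k))\<^sup>2) + (\<Sum>k=Suc n..m. (I f (\<xi> k))\<^sup>2)"
        unfolding split by (subst sum.union_disjoint) auto
      ultimately show ?thesis by (simp add: Is)
    qed
    have "I (s m) (s m) \<le> I (s n) (s n)" if "n \<le> m" for m n
      using diff[OF that] I.nonneg[OF I.mem_simps(3)[OF sL sL], of m n] by linarith
    then have "decseq (\<lambda>n. I (s n) (s n))" by (simp add: decseq_def)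
    then obtain l where l: "(\<lambda>n. I (s n) (s n)) \<longlonglongrightarrow> l"
      using decseq_convergent[of "\<lambda>n. I (s n) (s n)" 0] I.nonneg[OF sL] by metis
    have "\<forall>e>0. \<exists>N. \<forall>m\<ge>N. \<forall>n\<ge>N. I (s m - s n) (s m - s n) < e"
    proof (intro allI impI)
      fix e :: real assume "e > 0"
      then obtain N where "\<forall>m\<ge>N. \<forall>n\<ge>N. dist (I (s m) (s m)) (I (s n) (s n)) < e"
        using LIMSEQ_imp_Cauchy[OF l] unfolding Cauchy_def by blast
      then have N: "\<bar>I (s m) (s m) - I (s n) (s n)\<bar> < e" if "m \<ge> N" "n \<ge> N" for m n
        using that by (simp add: dist_real_def)
      have "I (s m - s n) (s m - s n) < e" if "m \<ge> N" "n \<ge> N" for m n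
      proof (cases "n \<le> m")
        case True
        then show ?thesis using diff[OF True] N[OF that] by linarith
      next
        case False
        then show ?thesis using diff[of m n] N[OF that] I.square_diff_commute[OF sL sL, of m n] by linarith
      qed
      then show "\<exists>N. \<forall>m\<ge>N. \<forall>n\<ge>N. I (s m - s n) (s m - s n) < e" by blast
    qed
    from complete_L[OF sL this] obtain r where r: "r \<in> L" and rl: "(\<lambda>n. I (s n - r) (s n - r)) \<longlonglongrightarrow> 0" by blast
    have "I r \<phi> = 0" if \<phi>: "\<phi> \<in> H" for \<phi>
    proof -
      define p where "p n = \<phi> - (\<Sum>k=1..n. I \<phi> (\<xi> k) *\<^sub>R \<xi> k)" for n
      have pL: "p n \<in> L" for n unfolding p_def using \<phi> H by (intro I.mem_simps I.mem_lincomb) auto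
      \<comment> \<open>The projection is symmetric: it can be moved from \<open>f\<close> to
        \<phi>, whose residual \<open>p n\<close> tends to 0 by the case already treated.\<close>
      have sp: "I (s n) \<phi> = I f (p n)" for n
      proof -
        have "I (s n) \<phi> = I f \<phi> - (\<Sum>k=1..n. I f (\<xi> k) * I (\<xi> k) \<phi>)"
          unfolding s_def using f \<phi> H by (subst I.diff_left) (auto intro!: I.mem_lincomb I.lincomb_left)
        moreover have "I f (p n) = I f \<phi> - (\<Sum>k=1..n. I \<phi> (\<xi> k) * I f (\<xi> k))"
          unfolding p_def using f \<phi> H by (subst I.diff_right) (auto intro!: I.mem_lincomb I.lincomb_right)
        moreover have "(\<Sum>k=1..n. I f (\<xi> k) * I (\<xi> k) \<phi>) = (\<Sum>k=1..n. I \<phi> (\<xi> k) * I f (\<xi> k))"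
          using H \<phi> by (intro sum.cong refl) (simp add: I.sym[of \<phi>])
        ultimately show ?thesis by simp
      qed
      have b: "\<bar>I r \<phi>\<bar> \<le> sqrt (I f f * I (p n) (p n)) + sqrt (I (s n - r) (s n - r) * I \<phi> \<phi>)" for n
      proof -
        have "\<bar>I f (p n)\<bar> \<le> sqrt (I f f * I (p n) (p n))"
          using I.Cauchy_Schwarz[OF f pL] by (simp add: real_le_rsqrt)
        moreover have "\<bar>I (s n - r) \<phi>\<bar> \<le> sqrt (I (s n - r) (s n - r) * I \<phi> \<phi>)"
          using I.Cauchy_Schwarz[OF I.mem_simps(3)[OF sL r] H_L[OF \<phi>], of n] by (simp add: real_le_rsqrt)
        moreover have "I (s n - r) \<phi> = I f (p n) - I r \<phi>"
          using I.diff_left[OF sL r H_L[OF \<phi>], of n] sp[of n] by simp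
        ultimately show ?thesis by linarith
      qed
      have "(\<lambda>n. sqrt (I f f * I (p n) (p n)) + sqrt (I (s n - r) (s n - r) * I \<phi> \<phi>)) \<longlonglongrightarrow> sqrt (I f f * 0) + sqrt (0 * I \<phi> \<phi>)"
        unfolding p_def by (intro tendsto_intros rl basis_H \<phi>)
      from LIMSEQ_le[OF tendsto_const this, of "\<bar>I r \<phi>\<bar>"] b have "\<bar>I r \<phi>\<bar> \<le> 0" by simp
      then show ?thesis by simp
    qed
    then have r0: "I r r = 0" using dense r by blast
    have "I (s n) (s n) = I (s n - r) (s n - r)" for n
      using I.square_diff[OF sL r, of n] I.sym[OF sL r, of n] I.orthogonal_of_null[OF r sL r0, of n] r0 by simp
    then show ?thesis using rl by (simp add: s_def)
  qed
  show thesis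
  proof (rule that[of \<xi> eig])
    show "\<And>k. 1 \<le> k \<Longrightarrow> eig k = Q (\<xi> k) (\<xi> k)" by (simp add: eig_def)
  qed (fact x1 H on min eqn mono lim basis_L)+
qed

end

section \<open>The forms on Borel functions\<close>

text \<open>Pointwise operations make all functions one real vector space, in which
  \<open>L^2\<close> and the energy space are nested subspaces, as the abstract locale
  requires.\<close>

instantiation "fun" :: (type, scaleR) scaleR
begin
definition scaleR_fun_def: "c *\<^sub>R f = (\<lambda>x. c *\<^sub>R f x)"
instance ..
end

lemma scaleR_fun_apply [simp]: "(c *\<^sub>R f) x = c *\<^sub>R f x"
  by (simp add: scaleR_fun_def)

instance "fun" :: (type, real_vector) real_vector
  by standard (auto simp: fun_eq_iff algebra_simps)

lemma sum_fun_apply: "(\<Sum>i\<in>A. f i) x = (\<Sum>i\<in>A. f i x)"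
  for f :: "'i \<Rightarrow> 'b \<Rightarrow> 'c::comm_monoid_add"
  by (induction A rule: infinite_finite_induct) auto

text \<open>Fubini's theorem and product null sets are used on this uncompleted measure; integrals
  over the completed measure on pairs are converted to it at the end.\<close>

abbreviation lborel2 :: "('a::euclidean_space \<times> 'a) measure" where
  "lborel2 \<equiv> lborel \<Otimes>\<^sub>M lborel"

section \<open>Translation, reflection and product integrals\<close>

lemma nn_integral_lborel_shift:
  fixes f :: "'a::euclidean_space \<Rightarrow> ennreal"
  assumes [measurable]: "f \<in> borel_measurable borel"
  shows "(\<integral>\<^sup>+x. f (t + x) \<partial>lborel) = (\<integral>\<^sup>+x. f x \<partial>lborel)"
  by (subst (2) lborel_distr_plus[of t, symmetric]) (simp add: nn_integral_distr)

lemma nn_integral_lborel_reflect: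
  fixes f :: "'a::euclidean_space \<Rightarrow> ennreal"
  assumes [measurable]: "f \<in> borel_measurable borel"
  shows "(\<integral>\<^sup>+x. f (t - x) \<partial>lborel) = (\<integral>\<^sup>+x. f x \<partial>lborel)"
  by (subst (2) lborel_affine[of "-1" t]) (simp_all add: nn_integral_density nn_integral_distr)

text \<open>For fixed \<open>x\<close> the map \<open>y \<mapsto> x - y\<close> preserves Lebesgue
  measure, so the inner integral of the kernel does not depend on \<open>x\<close>.\<close>

lemma nn_integral_convolution_kernel:
  fixes k g :: "'a::euclidean_space \<Rightarrow> ennreal"
  assumes [measurable]: "k \<in> borel_measurable borel" "g \<in> borel_measurable borel"
  shows "(\<integral>\<^sup>+(x, y). k (x - y) * g x \<partial>lborel2) = (\<integral>\<^sup>+z. k z \<partial>lborel) * (\<integral>\<^sup>+x. g x \<partial>lborel)"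
proof -
  have "(\<integral>\<^sup>+(x, y). k (x - y) * g x \<partial>lborel2) = (\<integral>\<^sup>+x. \<integral>\<^sup>+y. k (x - y) * g x \<partial>lborel \<partial>lborel)"
    by (subst lborel.nn_integral_fst[symmetric]) (auto simp: case_prod_beta)
  also have "\<dots> = (\<integral>\<^sup>+x. (\<integral>\<^sup>+z. k z \<partial>lborel) * g x \<partial>lborel)"
    by (simp add: nn_integral_multc nn_integral_lborel_reflect)
  finally show ?thesis by (simp add: nn_integral_cmult)
qed

lemma integrable_iff_nn_integral:
  assumes "f \<in> borel_measurable M" "\<And>x. (0::real) \<le> f x"
  shows "integrable M f \<longleftrightarrow> (\<integral>\<^sup>+x. f x \<partial>M) < \<infinity>"
  using assms by (subst integrable_iff_bounded) (auto simp: abs_of_nonneg)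

lemma nn_integral_lborel2_product:
  fixes f g :: "'a::euclidean_space \<Rightarrow> ennreal"
  assumes [measurable]: "f \<in> borel_measurable borel" "g \<in> borel_measurable borel"
  shows "(\<integral>\<^sup>+(x, y). f x * g y \<partial>lborel2) = (\<integral>\<^sup>+x. f x \<partial>lborel) * (\<integral>\<^sup>+y. g y \<partial>lborel)"
  by (subst lborel.nn_integral_fst[symmetric]) (auto simp: nn_integral_cmult nn_integral_multc)

lemma integrable_lborel2_product:
  fixes f g :: "'a::euclidean_space \<Rightarrow> real"
  assumes f: "integrable lborel f" and g: "integrable lborel g"
  shows "integrable lborel2 (\<lambda>(x, y). f x * g y)"
proof -
  have [measurable]: "f \<in> borel_measurable borel" "g \<in> borel_measurable borel"
    using f g by (auto dest: borel_measurable_integrable)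
  have "(\<integral>\<^sup>+z. ennreal (norm (case z of (x, y) \<Rightarrow> f x * g y)) \<partial>lborel2)
    = (\<integral>\<^sup>+(x, y). ennreal \<bar>f x\<bar> * ennreal \<bar>g y\<bar> \<partial>lborel2)"
    by (intro nn_integral_cong) (auto simp: abs_mult ennreal_mult)
  also have "\<dots> = (\<integral>\<^sup>+x. ennreal \<bar>f x\<bar> \<partial>lborel) * (\<integral>\<^sup>+x. ennreal \<bar>g x\<bar> \<partial>lborel)"
    by (rule nn_integral_lborel2_product) auto
  also have "\<dots> < \<infinity>"
    using f g by (auto simp: integrable_iff_bounded ennreal_mult_less_top)
  finally show ?thesis by (intro integrableI_bounded) auto
qed

lemma integral_lborel2_iterated:
  fixes F :: "'a::euclidean_space \<Rightarrow> 'a \<Rightarrow> real"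
  assumes "integrable lborel2 (\<lambda>(x, y). F x y)"
  shows "(\<integral>(x, y). F x y \<partial>lborel2) = (\<integral>x. (\<integral>y. F x y \<partial>lborel) \<partial>lborel)"
  using lborel_pair.integral_fst'[OF assms] by simp

lemma abs_mult_le_sum_squares: "\<bar>a * b\<bar> \<le> a\<^sup>2 + b\<^sup>2" for a b :: real
proof -
  have "2 * (\<bar>a\<bar> * \<bar>b\<bar>) \<le> \<bar>a\<bar>\<^sup>2 + \<bar>b\<bar>\<^sup>2"
    using zero_le_power2[of "\<bar>a\<bar> - \<bar>b\<bar>"] by (simp only: power2_diff)
  moreover have "0 \<le> \<bar>a\<bar> * \<bar>b\<bar>" by simp
  ultimately show ?thesis unfolding abs_mult power2_abs by linarith
qed

lemma weighted_cross_integrable: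
  fixes k f g :: "'b \<Rightarrow> real"
  assumes [measurable]: "k \<in> borel_measurable M" "f \<in> borel_measurable M" "g \<in> borel_measurable M"
    and k: "\<And>x. 0 \<le> k x"
    and "integrable M (\<lambda>x. k x * (f x)\<^sup>2)" "integrable M (\<lambda>x. k x * (g x)\<^sup>2)"
  shows "integrable M (\<lambda>x. k x * (f x * g x))"
proof (rule Bochner_Integration.integrable_bound)
  show "integrable M (\<lambda>x. k x * (f x)\<^sup>2 + k x * (g x)\<^sup>2)" using assms by simp
  have "\<bar>f x * g x\<bar> \<le> (f x)\<^sup>2 + (g x)\<^sup>2" for x
    using abs_mult_le_sum_squares[of "f x" "g x"] .
  then have "k x * \<bar>f x * g x\<bar> \<le> k x * ((f x)\<^sup>2 + (g x)\<^sup>2)" for x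
    using k by (intro mult_left_mono) auto
  then show "AE x in M. norm (k x * (f x * g x)) \<le> norm (k x * (f x)\<^sup>2 + k x * (g x)\<^sup>2)"
    using k by (auto simp: abs_mult distrib_left)
qed simp

lemma cross_integrable:
  fixes f g :: "'b \<Rightarrow> real"
  assumes "f \<in> borel_measurable M" "g \<in> borel_measurable M"
    and "integrable M (\<lambda>x. (f x)\<^sup>2)" "integrable M (\<lambda>x. (g x)\<^sup>2)"
  shows "integrable M (\<lambda>x. f x * g x)"
  using weighted_cross_integrable[of "\<lambda>_. 1" M f g] assms by simp

text \<open>At 0 division by zero gives the value 0, the convention for the diagonal. On the unit
  sphere both \<open>near\<close> and \<open>far\<close> equal 1, matching the two closed domains of
  integration in the form.\<close>

definition near :: "'a::euclidean_space \<Rightarrow> real" where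
  "near z = (if norm z \<le> 1 then 1 / norm z ^ DIM('a) else 0)"

definition far :: "'a::euclidean_space \<Rightarrow> real" where
  "far z = (if norm z \<ge> 1 then 1 / norm z ^ DIM('a) else 0)"

lemma near_measurable [measurable]: "near \<in> borel_measurable borel"
  unfolding near_def by measurable

lemma far_measurable [measurable]: "far \<in> borel_measurable borel"
  unfolding far_def by measurable

lemma near_nonneg [simp]: "0 \<le> near z" by (simp add: near_def)
lemma far_nonneg [simp]: "0 \<le> far z" by (simp add: far_def)
lemma far_le_1: "far z \<le> 1" by (simp add: far_def divide_le_eq one_le_power)
lemma near_ge_1: "z \<noteq> 0 \<Longrightarrow> norm z \<le> 1 \<Longrightarrow> 1 \<le> near z"
  by (simp add: near_def le_divide_eq power_le_one)
lemma far_commute: "far (x - y) = far (y - x)" by (simp add: far_def norm_minus_commute)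

text \<open>Representatives vanish everywhere outside \<Omega>, not merely almost everywhere, which
  permits pointwise estimates with case distinctions on membership in \<Omega>.\<close>

definition borel_L2 :: "'a::euclidean_space set \<Rightarrow> ('a \<Rightarrow> real) set" where
  "borel_L2 \<Omega> = {u \<in> borel_measurable borel. (\<forall>x. x \<notin> \<Omega> \<longrightarrow> u x = 0) \<and> integrable lborel (\<lambda>x. (u x)\<^sup>2)}"

definition borel_H :: "'a::euclidean_space set \<Rightarrow> ('a \<Rightarrow> real) set" where
  "borel_H \<Omega> = {u \<in> borel_measurable borel. (\<forall>x. x \<notin> \<Omega> \<longrightarrow> u x = 0) \<and>
     integrable lborel2 (\<lambda>(x, y). near (x - y) * (u x - u y)\<^sup>2)}"

definition mass_form :: "('a::euclidean_space \<Rightarrow> real) \<Rightarrow> ('a \<Rightarrow> real) \<Rightarrow> real" where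
  "mass_form u w = (\<integral>x. u x * w x \<partial>lborel)"

definition near_form :: "('a::euclidean_space \<Rightarrow> real) \<Rightarrow> ('a \<Rightarrow> real) \<Rightarrow> real" where
  "near_form u w = (\<integral>(x, y). near (x - y) * ((u x - u y) * (w x - w y)) \<partial>lborel2)"

definition far_form :: "('a::euclidean_space \<Rightarrow> real) \<Rightarrow> ('a \<Rightarrow> real) \<Rightarrow> real" where
  "far_form u w = (\<integral>(x, y). far (x - y) * (u x * w y) \<partial>lborel2)"

definition energy_form :: "('a::euclidean_space \<Rightarrow> real) \<Rightarrow> ('a \<Rightarrow> real) \<Rightarrow> real" where
  "energy_form u w = log_const DIM('a) / 2 * near_form u w - log_const DIM('a) * far_form u w
     + log_rho DIM('a) * mass_form u w"

lemma log_const_pos: "log_const DIM('a::euclidean_space) > 0"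
  unfolding log_const_def by (intro mult_pos_pos Gamma_real_pos) auto

lemma borel_L2_cross: "u \<in> borel_L2 \<Omega> \<Longrightarrow> w \<in> borel_L2 \<Omega> \<Longrightarrow> integrable lborel (\<lambda>x. u x * w x)"
  by (rule cross_integrable) (auto simp: borel_L2_def)

lemma measurable_borel_L2: "u \<in> borel_L2 \<Omega> \<Longrightarrow> u \<in> borel_measurable borel" by (simp add: borel_L2_def)
lemma measurable_borel_H: "u \<in> borel_H \<Omega> \<Longrightarrow> u \<in> borel_measurable borel" by (simp add: borel_H_def)

lemma borel_H_cross:
  assumes "u \<in> borel_H \<Omega>" "w \<in> borel_H \<Omega>"
  shows "integrable lborel2 (\<lambda>(x, y). near (x - y) * ((u x - u y) * (w x - w y)))"
proof -
  have [measurable]: "u \<in> borel_measurable borel" "w \<in> borel_measurable borel"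
    using assms by (auto simp: borel_H_def)
  show ?thesis
    unfolding case_prod_unfold
    by (rule weighted_cross_integrable) (use assms in \<open>auto simp: borel_H_def case_prod_unfold\<close>)
qed

lemma square_sum_le: "(a + b)\<^sup>2 \<le> 2 * a\<^sup>2 + 2 * b\<^sup>2" for a b :: real
  using zero_le_power2[of "a - b"] by (simp add: power2_eq_square algebra_simps)

lemma subspace_borel_L2: "subspace (borel_L2 \<Omega>)"
proof (rule subspaceI)
  fix u w assume u: "u \<in> borel_L2 \<Omega>" and w: "w \<in> borel_L2 \<Omega>"
  have [measurable]: "u \<in> borel_measurable borel" "w \<in> borel_measurable borel"
    using u w by (auto simp: borel_L2_def)
  have "integrable lborel (\<lambda>x. (u x + w x)\<^sup>2)"
  proof (rule Bochner_Integration.integrable_bound)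
    show "integrable lborel (\<lambda>x. 2 * (u x)\<^sup>2 + 2 * (w x)\<^sup>2)" using u w by (simp add: borel_L2_def)
  qed (auto simp: square_sum_le)
  then show "u + w \<in> borel_L2 \<Omega>" using u w by (simp add: borel_L2_def plus_fun_def)
qed (auto simp: borel_L2_def scaleR_fun_def power_mult_distrib zero_fun_def)

lemma subspace_borel_H: "subspace (borel_H \<Omega>)"
proof (rule subspaceI)
  fix u w assume u: "u \<in> borel_H \<Omega>" and w: "w \<in> borel_H \<Omega>"
  have [measurable]: "u \<in> borel_measurable borel" "w \<in> borel_measurable borel"
    using u w by (auto simp: borel_H_def)
  have "integrable lborel2 (\<lambda>(x, y). near (x - y) * ((u x + w x) - (u y + w y))\<^sup>2)"
  proof (rule Bochner_Integration.integrable_bound)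
    show "integrable lborel2 (\<lambda>p. 2 * (case p of (x, y) \<Rightarrow> near (x - y) * (u x - u y)\<^sup>2)
        + 2 * (case p of (x, y) \<Rightarrow> near (x - y) * (w x - w y)\<^sup>2))"
      using u w by (simp add: borel_H_def)
    have "near (x - y) * ((u x + w x) - (u y + w y))\<^sup>2
        \<le> 2 * (near (x - y) * (u x - u y)\<^sup>2) + 2 * (near (x - y) * (w x - w y)\<^sup>2)" for x y
      using mult_left_mono[OF square_sum_le[of "u x - u y" "w x - w y"] near_nonneg[of "x - y"]]
      by (simp add: algebra_simps)
    then show "AE p in lborel2. norm (case p of (x, y) \<Rightarrow> near (x - y) * ((u x + w x) - (u y + w y))\<^sup>2)
      \<le> norm (2 * (case p of (x, y) \<Rightarrow> near (x - y) * (u x - u y)\<^sup>2)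
        + 2 * (case p of (x, y) \<Rightarrow> near (x - y) * (w x - w y)\<^sup>2))"
      by (auto simp: abs_mult abs_of_nonneg)
  qed measurable
  then show "u + w \<in> borel_H \<Omega>" using u w by (simp add: borel_H_def plus_fun_def)
next
  fix c :: real and u assume u: "u \<in> borel_H \<Omega>"
  have "integrable lborel2 (\<lambda>p. c\<^sup>2 * (case p of (x, y) \<Rightarrow> near (x - y) * (u x - u y)\<^sup>2))"
    using u by (simp add: borel_H_def)
  also have "(\<lambda>p. c\<^sup>2 * (case p of (x, y) \<Rightarrow> near (x - y) * (u x - u y)\<^sup>2))
    = (\<lambda>(x, y). near (x - y) * (c * u x - c * u y)\<^sup>2)"
    by (auto simp: fun_eq_iff power2_eq_square algebra_simps)
  finally have "integrable lborel2 (\<lambda>(x, y). near (x - y) * (c * u x - c * u y)\<^sup>2)" .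
  moreover have "(\<lambda>x. c * u x) \<in> borel_measurable borel"
    using measurable_borel_H[OF u] by measurable
  ultimately show "c *\<^sub>R u \<in> borel_H \<Omega>" using u by (simp add: borel_H_def scaleR_fun_def)
qed (auto simp: borel_H_def zero_fun_def case_prod_unfold)

lemma psd_mass_form: "psd_form_on (borel_L2 \<Omega>) mass_form"
proof
  show "mass_form (u + v) w = mass_form u w + mass_form v w" if "u \<in> borel_L2 \<Omega>" "v \<in> borel_L2 \<Omega>" "w \<in> borel_L2 \<Omega>" for u v w
    using borel_L2_cross[OF that(1,3)] borel_L2_cross[OF that(2,3)]
    by (simp add: mass_form_def distrib_right flip: Bochner_Integration.integral_add)
qed (auto simp: mass_form_def subspace_borel_L2 mult.commute mult.left_commute)

lemma psd_near_form: "psd_form_on (borel_H \<Omega>) near_form"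
proof
  show "near_form (u + v) w = near_form u w + near_form v w" if "u \<in> borel_H \<Omega>" "v \<in> borel_H \<Omega>" "w \<in> borel_H \<Omega>" for u v w
    unfolding near_form_def
    by (subst Bochner_Integration.integral_add[OF borel_H_cross[OF that(1,3)] borel_H_cross[OF that(2,3)], symmetric])
      (auto intro!: Bochner_Integration.integral_cong simp: algebra_simps)
  show "near_form (c *\<^sub>R u) w = c * near_form u w" for c u w
  proof -
    have "(\<lambda>(x, y). near (x - y) * (((c *\<^sub>R u) x - (c *\<^sub>R u) y) * (w x - w y)))
      = (\<lambda>p. c * (case p of (x, y) \<Rightarrow> near (x - y) * ((u x - u y) * (w x - w y))))"
      by (auto simp: fun_eq_iff algebra_simps)
    then show ?thesis by (simp add: near_form_def)
  qed
  show "0 \<le> near_form u u" for u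
    unfolding near_form_def by (intro integral_nonneg_AE) auto
qed (auto simp: near_form_def subspace_borel_H mult.commute)

section \<open>Consequences of boundedness: integrability, the far form, coercivity\<close>

lemma bounded_subset_cball0:
  assumes "bounded (\<Omega> :: 'a::euclidean_space set)"
  obtains R where "R > 0" "\<Omega> \<subseteq> cball 0 R"
  using assms unfolding bounded_pos by (auto simp: subset_iff)

lemma cball_measurable [measurable]: "cball c r \<in> sets borel"
  by simp

lemma integrable_indicator_cball: "integrable lborel (indicator (cball c r) :: 'a::euclidean_space \<Rightarrow> real)"
  using emeasure_bounded_finite[OF bounded_cball, of c r]
  by (intro integrable_real_indicator) (auto simp: less_top)

lemma borel_L2_integrable:
  assumes u: "u \<in> borel_L2 \<Omega>" and bd: "bounded \<Omega>"
  shows "integrable lborel u"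
proof -
  obtain R where R: "\<Omega> \<subseteq> cball 0 R" using bounded_subset_cball0[OF bd] .
  show ?thesis
  proof (rule Bochner_Integration.integrable_bound)
    show "integrable lborel (\<lambda>x. indicator (cball 0 R) x + (u x)\<^sup>2)"
      using u integrable_indicator_cball[of 0 R] by (auto simp: borel_L2_def)
    have "\<bar>u x\<bar> \<le> indicator (cball 0 R) x + (u x)\<^sup>2" for x
    proof (cases "x \<in> \<Omega>")
      case True
      then have "x \<in> cball 0 R" using R by auto
      moreover have "\<bar>u x\<bar> \<le> 1 + (u x)\<^sup>2" using abs_mult_le_sum_squares[of 1 "u x"] by simp
      ultimately show ?thesis by simp
    qed (use u in \<open>auto simp: borel_L2_def\<close>)
    then show "AE x in lborel. norm (u x) \<le> norm (indicator (cball 0 R) x + (u x)\<^sup>2)"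
      by (auto intro!: order_trans[OF _ abs_ge_self])
  qed (use u in \<open>simp add: borel_L2_def\<close>)
qed

lemma far_form_integrable:
  assumes u: "u \<in> borel_L2 \<Omega>" and w: "w \<in> borel_L2 \<Omega>" and bd: "bounded \<Omega>"
  shows "integrable lborel2 (\<lambda>(x, y). far (x - y) * (u x * w y))"
proof (rule Bochner_Integration.integrable_bound)
  have [measurable]: "u \<in> borel_measurable borel" "w \<in> borel_measurable borel"
    using u w by (auto simp: borel_L2_def)
  show "integrable lborel2 (\<lambda>(x, y). u x * w y)"
    by (intro integrable_lborel2_product borel_L2_integrable[OF _ bd] u w)
  show "(\<lambda>(x, y). far (x - y) * (u x * w y)) \<in> borel_measurable lborel2" by measurable
  show "AE p in lborel2. norm (case p of (x, y) \<Rightarrow> far (x - y) * (u x * w y)) \<le> norm (case p of (x, y) \<Rightarrow> u x * w y)"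
    by (intro AE_I2) (use far_le_1 in \<open>auto simp: abs_mult intro!: mult_left_le_one_le split: prod.splits\<close>)
qed

text \<open>\<open>far\<close> is at most 1 and |u(x) u(y)| is at most half the sum of the squares;
  since \<open>u\<close> lives in the ball, integrating out the idle variable costs the volume of
  the ball.\<close>

lemma far_form_bound:
  fixes u :: "'a::euclidean_space \<Rightarrow> real"
  assumes u: "u \<in> borel_L2 \<Omega>" and R: "\<Omega> \<subseteq> cball 0 R"
  shows "\<bar>far_form u u\<bar> \<le> measure lborel (cball (0::'a) R) * mass_form u u"
proof -
  let ?i = "indicator (cball 0 R) :: 'a \<Rightarrow> real"
  have [measurable]: "u \<in> borel_measurable borel" using u by (auto simp: borel_L2_def)
  have i1: "integrable lborel2 (\<lambda>(x, y). (u x)\<^sup>2 * ?i y)" and i2: "integrable lborel2 (\<lambda>(x, y). ?i x * (u y)\<^sup>2)"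
    using u by (auto intro!: integrable_lborel2_product integrable_indicator_cball simp: borel_L2_def)
  have e1: "(\<integral>(x, y). (u x)\<^sup>2 * ?i y \<partial>lborel2) = measure lborel (cball (0::'a) R) * mass_form u u"
    by (subst integral_lborel2_iterated[OF i1]) (simp add: mass_form_def power2_eq_square)
  have e2: "(\<integral>(x, y). ?i x * (u y)\<^sup>2 \<partial>lborel2) = measure lborel (cball (0::'a) R) * mass_form u u"
    by (subst integral_lborel2_iterated[OF i2]) (simp add: mass_form_def power2_eq_square)
  have pt: "\<bar>far (x - y) * (u x * u y)\<bar> \<le> ((u x)\<^sup>2 * ?i y + ?i x * (u y)\<^sup>2) / 2" for x y
  proof (cases "x \<in> \<Omega> \<and> y \<in> \<Omega>")
    case True
    then have "x \<in> cball 0 R" "y \<in> cball 0 R" using R by auto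
    moreover have "\<bar>far (x - y) * (u x * u y)\<bar> \<le> \<bar>u x * u y\<bar>"
      using far_le_1 by (auto simp: abs_mult intro!: mult_left_le_one_le)
    moreover have "2 * \<bar>u x * u y\<bar> \<le> (u x)\<^sup>2 + (u y)\<^sup>2"
      using sum_squares_bound[of "\<bar>u x\<bar>" "\<bar>u y\<bar>"] by (simp add: abs_mult)
    ultimately show ?thesis by simp
  next
    case False
    then have "u x = 0 \<or> u y = 0" using u by (auto simp: borel_L2_def)
    then have "far (x - y) * (u x * u y) = 0" by auto
    moreover have "0 \<le> ((u x)\<^sup>2 * ?i y + ?i x * (u y)\<^sup>2) / 2" by simp
    ultimately show ?thesis by (simp only: abs_zero)
  qed
  have "\<bar>far_form u u\<bar> \<le> (\<integral>p. \<bar>case p of (x, y) \<Rightarrow> far (x - y) * (u x * u y)\<bar> \<partial>lborel2)"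
    unfolding far_form_def by (rule integral_abs_bound)
  also have "\<dots> \<le> (\<integral>p. ((case p of (x, y) \<Rightarrow> (u x)\<^sup>2 * ?i y) + (case p of (x, y) \<Rightarrow> ?i x * (u y)\<^sup>2)) / 2 \<partial>lborel2)"
  proof (rule integral_mono')
    show "integrable lborel2 (\<lambda>p. ((case p of (x, y) \<Rightarrow> (u x)\<^sup>2 * ?i y) + (case p of (x, y) \<Rightarrow> ?i x * (u y)\<^sup>2)) / 2)"
      using i1 i2 by simp
  qed (use pt in \<open>auto split: prod.splits\<close>)
  also have "\<dots> = measure lborel (cball (0::'a) R) * mass_form u u"
    using i1 i2 e1 e2 by simp
  finally show ?thesis .
qed

lemma AE_lborel_open_witness:
  assumes "AE x in lborel. P x" and "open S" "S \<noteq> {}"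
  shows "\<exists>x\<in>S. P (x::'a::euclidean_space)"
proof (rule ccontr)
  assume none: "\<not> ?thesis"
  from assms(1) obtain N where N: "N \<in> null_sets lborel" "{x. \<not> P x} \<subseteq> N"
    by (auto elim!: AE_E simp: null_sets_def)
  then have "negligible N"
    by (simp add: negligible_iff_null_sets null_sets_completionI)
  moreover have "S \<subseteq> N" using none N(2) by auto
  ultimately have "negligible S" by (rule negligible_subset)
  then show False using open_not_negligible assms by blast
qed

text \<open>
  Some translate difference \<open>u(x) - u(x - z)\<close> with \<open>z \<noteq> 0\<close> is square integrable; summing it along
  \<open>x, x - z, x - 2z, \<dots>\<close> until the argument has left \<open>\<Omega>\<close> recovers \<open>u(x)\<close>.
\<close>

theorem borel_H_subset_borel_L2:
  assumes bd: "bounded (\<Omega> :: 'a::euclidean_space set)"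
  shows "borel_H \<Omega> \<subseteq> borel_L2 \<Omega>"
proof
  fix u assume u: "u \<in> borel_H \<Omega>"
  then have [measurable]: "u \<in> borel_measurable borel" and off: "\<And>x. x \<notin> \<Omega> \<Longrightarrow> u x = 0"
    by (auto simp: borel_H_def)
  obtain R where R: "R > 0" "\<Omega> \<subseteq> cball 0 R" using bounded_subset_cball0[OF bd] .
  define D where "D z = (\<integral>\<^sup>+x. ennreal ((u x - u (x - z))\<^sup>2) \<partial>lborel)" for z
  \<comment> \<open>Substituting \<open>y = x - z\<close> and exchanging the integrals writes the
    energy as the integral of \<open>near z * D z\<close>. Its finiteness makes
    \<open>near z * D z\<close> finite for almost every \<open>z\<close>, and an open punctured ball
    cannot be exceptional.\<close>
  have "(\<integral>\<^sup>+z. ennreal (near z) * D z \<partial>lborel)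
    = (\<integral>\<^sup>+z. \<integral>\<^sup>+x. ennreal (near z * (u x - u (x - z))\<^sup>2) \<partial>lborel \<partial>lborel)"
    unfolding D_def by (simp add: ennreal_mult nn_integral_cmult)
  also have "\<dots> = (\<integral>\<^sup>+x. \<integral>\<^sup>+z. ennreal (near z * (u x - u (x - z))\<^sup>2) \<partial>lborel \<partial>lborel)"
    by (rule lborel_pair.Fubini') measurable
  also have "\<dots> = (\<integral>\<^sup>+x. \<integral>\<^sup>+y. ennreal (near (x - y) * (u x - u y)\<^sup>2) \<partial>lborel \<partial>lborel)"
  proof (rule nn_integral_cong)
    fix x
    show "(\<integral>\<^sup>+z. ennreal (near z * (u x - u (x - z))\<^sup>2) \<partial>lborel) = (\<integral>\<^sup>+y. ennreal (near (x - y) * (u x - u y)\<^sup>2) \<partial>lborel)"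
      by (subst nn_integral_lborel_reflect[of _ x, symmetric]) simp_all
  qed
  also have "\<dots> = (\<integral>\<^sup>+p. ennreal (case p of (x, y) \<Rightarrow> near (x - y) * (u x - u y)\<^sup>2) \<partial>lborel2)"
    by (subst lborel.nn_integral_fst[symmetric]) (auto simp: case_prod_unfold)
  also have "\<dots> < \<infinity>"
    using u by (subst integrable_iff_nn_integral[symmetric]) (auto simp: borel_H_def)
  finally have fin: "(\<integral>\<^sup>+z. ennreal (near z) * D z \<partial>lborel) < \<infinity>" .
  have [measurable]: "D \<in> borel_measurable borel" unfolding D_def by measurable
  have "AE z in lborel. ennreal (near z) * D z \<noteq> \<infinity>"
    using fin by (intro nn_integral_noteq_infinite) auto
  moreover have "open (ball 0 1 - {0::'a})" by (intro open_Diff) auto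
  moreover have "ball 0 1 - {0::'a} \<noteq> {}"
  proof -
    obtain b :: 'a where "b \<in> Basis" using nonempty_Basis by blast
    then have "(1/2) *\<^sub>R b \<in> ball 0 1 - {0}" using nonzero_Basis[of b] by auto
    then show ?thesis by blast
  qed
  ultimately obtain z where z: "z \<in> ball 0 1 - {0::'a}" "ennreal (near z) * D z \<noteq> \<infinity>"
    using AE_lborel_open_witness by blast
  then have "near z > 0" using near_ge_1[of z] by auto
  then have Dz: "D z < \<infinity>"
    using z(2) by (cases "D z = \<infinity>") (auto simp: ennreal_mult_top less_top)
  \<comment> \<open>After \<open>m\<close> steps of length |z| the point has moved farther than the
    diameter \<open>2 * R\<close> of the ball and so has left \<Omega>.\<close>
  obtain m :: nat where m: "2 * R / norm z < m" using reals_Archimedean2 by blast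
  then have m': "2 * R < m * norm z" using z by (simp add: field_simps)
  define d where "d x = u x - u (x - z)" for x
  have [measurable]: "d \<in> borel_measurable borel" unfolding d_def by measurable
  have pt: "(u x)\<^sup>2 \<le> (\<Sum>j<m. (d (x - real j *\<^sub>R z))\<^sup>2) * real m" for x
  proof (cases "x \<in> \<Omega>")
    case True
    then have xR: "norm x \<le> R" using R by auto
    have "norm (real m *\<^sub>R z) \<le> norm (x - real m *\<^sub>R z) + norm x"
      by (metis norm_minus_commute norm_triangle_sub add.commute)
    then have "x - real m *\<^sub>R z \<notin> \<Omega>" using R xR m' by (auto simp: subset_iff)
    then have 0: "u (x - real m *\<^sub>R z) = 0" by (rule off)
    have "(\<Sum>j<m. d (x - real j *\<^sub>R z)) = (\<Sum>j<m. u (x - real j *\<^sub>R z) - u (x - real (Suc j) *\<^sub>R z))"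
      by (simp add: d_def algebra_simps)
    also have "\<dots> = u (x - real 0 *\<^sub>R z) - u (x - real m *\<^sub>R z)"
      by (rule sum_lessThan_telescope')
    finally have "u x = (\<Sum>j<m. d (x - real j *\<^sub>R z))" using 0 by simp
    then show ?thesis using sum_squared_le_sum_of_squares[of "\<lambda>j. d (x - real j *\<^sub>R z)" "{..<m}"] by simp
  next
    case False
    then show ?thesis using off by (simp add: sum_nonneg)
  qed
  have "(\<integral>\<^sup>+x. ennreal ((u x)\<^sup>2) \<partial>lborel) \<le> (\<integral>\<^sup>+x. (\<Sum>j<m. ennreal ((d (x - real j *\<^sub>R z))\<^sup>2)) * ennreal (real m) \<partial>lborel)"
    using pt by (intro nn_integral_mono) (simp add: sum_nonneg flip: ennreal_mult)
  also have "\<dots> = (\<Sum>j<m. (\<integral>\<^sup>+x. ennreal ((d (x - real j *\<^sub>R z))\<^sup>2) \<partial>lborel)) * ennreal (real m)"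
    by (subst nn_integral_multc, measurable) (subst nn_integral_sum, auto)
  also have "\<dots> = (\<Sum>j<m. D z) * ennreal (real m)"
  proof -
    have "(\<integral>\<^sup>+x. ennreal ((d (x - real j *\<^sub>R z))\<^sup>2) \<partial>lborel) = D z" for j
      using nn_integral_lborel_shift[of "\<lambda>x. ennreal ((d x)\<^sup>2)" "- (real j *\<^sub>R z)"]
      by (simp add: D_def d_def)
    then show ?thesis by simp
  qed
  also have "\<dots> < \<infinity>" using Dz by (auto simp: ennreal_mult_less_top of_nat_less_top)
  finally have "integrable lborel (\<lambda>x. (u x)\<^sup>2)"
    by (subst integrable_iff_nn_integral) auto
  then show "u \<in> borel_L2 \<Omega>" using u by (auto simp: borel_L2_def borel_H_def)
qed

lemma sym_energy_form:
  assumes bd: "bounded \<Omega>"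
  shows "sym_form_on (borel_H \<Omega>) energy_form"
proof -
  interpret I: psd_form_on "borel_L2 \<Omega>" mass_form by (rule psd_mass_form)
  interpret G: psd_form_on "borel_H \<Omega>" near_form by (rule psd_near_form)
  note sub = borel_H_subset_borel_L2[OF bd, THEN subsetD]
  have Fadd: "far_form (u + v) w = far_form u w + far_form v w" if "u \<in> borel_H \<Omega>" "v \<in> borel_H \<Omega>" "w \<in> borel_H \<Omega>" for u v w
    unfolding far_form_def
    by (subst Bochner_Integration.integral_add[OF far_form_integrable[OF sub sub bd] far_form_integrable[OF sub sub bd], symmetric, OF that(1,3,2,3)])
      (auto intro!: Bochner_Integration.integral_cong simp: algebra_simps)
  have Fscale: "far_form (c *\<^sub>R u) w = c * far_form u w" for c u and w :: "'a \<Rightarrow> real"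
  proof -
    have "(\<lambda>(x, y). far (x - y) * ((c *\<^sub>R u) x * w y)) = (\<lambda>p. c * (case p of (x, y) \<Rightarrow> far (x - y) * (u x * w y)))"
      by (auto simp: fun_eq_iff algebra_simps)
    then show ?thesis by (simp add: far_form_def)
  qed
  have Fsym: "far_form u w = far_form w u" if "u \<in> borel_H \<Omega>" "w \<in> borel_H \<Omega>" for u w
  proof -
    have [measurable]: "u \<in> borel_measurable borel" "w \<in> borel_measurable borel"
      using that by (auto simp: borel_H_def)
    have "far_form u w = (\<integral>(x, y). far (y - x) * (u y * w x) \<partial>lborel2)"
      unfolding far_form_def
      by (subst lborel_pair.integral_product_swap[symmetric]) (auto intro!: Bochner_Integration.integral_cong)
    also have "\<dots> = far_form w u"
      unfolding far_form_def by (intro Bochner_Integration.integral_cong) (auto simp: far_commute mult.commute)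
    finally show ?thesis .
  qed
  show ?thesis
  proof
    show "energy_form (u + v) w = energy_form u w + energy_form v w" if "u \<in> borel_H \<Omega>" "v \<in> borel_H \<Omega>" "w \<in> borel_H \<Omega>" for u v w
      using that sub by (simp add: energy_form_def Fadd G.add_left I.add_left algebra_simps)
    show "energy_form (c *\<^sub>R u) w = c * energy_form u w" if "u \<in> borel_H \<Omega>" "w \<in> borel_H \<Omega>" for c u w
      using that sub by (simp add: energy_form_def Fscale G.scale_left I.scale_left algebra_simps)
    show "energy_form u w = energy_form w u" if "u \<in> borel_H \<Omega>" "w \<in> borel_H \<Omega>" for u w
      using that sub Fsym[of u w] G.sym[of u w] I.sym[of u w] by (simp add: energy_form_def)
  qed (rule subspace_borel_H)
qed

text \<open>\<open>C\<close> adds up the bound for the far form, the absolute value of the constant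
  in front of the \<open>L^2\<close> term, and 1 for the \<open>L^2\<close> term gained on the left.
  The upper estimate is used for completeness: it turns convergence in \<open>near_form\<close> and
  \<open>mass_form\<close> into convergence in shifted energy.\<close>

lemma coercive_energy_form:
  fixes \<Omega> :: "'a::euclidean_space set"
  assumes bd: "bounded \<Omega>"
  obtains C where "\<And>u. u \<in> borel_H \<Omega> \<Longrightarrow> log_const DIM('a) / 2 * near_form u u + mass_form u u \<le> energy_form u u + C * mass_form u u"
    "\<And>u. u \<in> borel_H \<Omega> \<Longrightarrow> energy_form u u + C * mass_form u u \<le> log_const DIM('a) / 2 * near_form u u + 2 * C * mass_form u u"
    "C > 0"
proof -
  obtain R where R: "\<Omega> \<subseteq> cball 0 R" using bounded_subset_cball0[OF bd] .
  define V where "V = measure lborel (cball (0::'a) R)"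
  define c where "c = log_const DIM('a)"
  have c: "c > 0" unfolding c_def by (rule log_const_pos)
  interpret I: psd_form_on "borel_L2 \<Omega>" mass_form by (rule psd_mass_form)
  define C where "C = c * V + \<bar>log_rho DIM('a)\<bar> + 1"
  have V: "V \<ge> 0" by (simp add: V_def)
  have C: "C > 0" using c V by (simp add: C_def add_nonneg_pos)
  have b: "\<bar>- c * far_form u u + log_rho DIM('a) * mass_form u u\<bar> \<le> (C - 1) * mass_form u u" if "u \<in> borel_H \<Omega>" for u
  proof -
    have uL: "u \<in> borel_L2 \<Omega>" using borel_H_subset_borel_L2[OF bd] that by auto
    have "c * \<bar>far_form u u\<bar> \<le> c * (V * mass_form u u)"
      using far_form_bound[OF uL R] c by (simp add: V_def)
    moreover have "\<bar>log_rho DIM('a) * mass_form u u\<bar> = \<bar>log_rho DIM('a)\<bar> * mass_form u u"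
      using I.nonneg[OF uL] by (simp add: abs_mult)
    moreover have "\<bar>- c * far_form u u\<bar> = c * \<bar>far_form u u\<bar>" using c by (simp add: abs_mult)
    ultimately show ?thesis by (simp add: C_def algebra_simps)
  qed
  have nn: "0 \<le> mass_form u u" if "u \<in> borel_H \<Omega>" for u
    using I.nonneg borel_H_subset_borel_L2[OF bd] that by auto
  have Q: "energy_form u u = c / 2 * near_form u u + (- c * far_form u u + log_rho DIM('a) * mass_form u u)" for u :: "'a \<Rightarrow> real"
    by (simp add: energy_form_def c_def)
  show thesis
  proof (rule that[of C])
    fix u :: "'a \<Rightarrow> real" assume u: "u \<in> borel_H \<Omega>"
    show "log_const DIM('a) / 2 * near_form u u + mass_form u u \<le> energy_form u u + C * mass_form u u"
      using b[OF u] nn[OF u] unfolding Q c_def[symmetric] abs_le_iff by (simp add: algebra_simps)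
    show "energy_form u u + C * mass_form u u \<le> log_const DIM('a) / 2 * near_form u u + 2 * C * mass_form u u"
      using b[OF u] nn[OF u] unfolding Q c_def[symmetric] abs_le_iff by (simp add: algebra_simps)
  qed (fact C)
qed

section \<open>Integrability of the kernel\<close>

lemma nn_integral_lborel_scale:
  fixes f :: "'a::euclidean_space \<Rightarrow> ennreal"
  assumes [measurable]: "f \<in> borel_measurable borel" and c: "c > 0"
  shows "(\<integral>\<^sup>+x. f x \<partial>lborel) = ennreal (c ^ DIM('a)) * (\<integral>\<^sup>+x. f (c *\<^sub>R x) \<partial>lborel)"
  using c by (subst lborel_affine[of c 0]) (simp_all add: nn_integral_density nn_integral_distr nn_integral_cmult)

lemma emeasure_lborel_open_pos:
  assumes "open S" "S \<noteq> {}"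
  shows "emeasure lborel (S :: 'a::euclidean_space set) > 0"
proof (rule ccontr)
  assume "\<not> ?thesis"
  then have "S \<in> null_sets lborel" using assms by (auto simp: null_sets_def)
  then show False
    using open_not_negligible[OF assms] by (simp add: negligible_iff_null_sets null_sets_completionI)
qed

text \<open>Self-similarity: halving multiplies the kernel by \<open>2 ^ DIM('a)\<close>, the
  inverse of the change of volume. Divergence of its integral and convergence of its second moment
  both rest on this.\<close>

lemma near_scale_half: "near ((1/2) *\<^sub>R z) * indicator (cball 0 (1/2)) ((1/2) *\<^sub>R z) = 2 ^ DIM('a) * near z"
  for z :: "'a::euclidean_space"
  by (auto simp: near_def indicator_def power_divide)

text \<open>By self-similarity the integral over the half ball equals the integral over the whole
  ball, although the shell between them contributes a positive amount; a finite integral is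
  impossible.\<close>

lemma nn_integral_near: "(\<integral>\<^sup>+z. ennreal (near z) \<partial>(lborel :: 'a::euclidean_space measure)) = \<infinity>"
proof (rule ccontr)
  let ?N = "DIM('a)"
  define F where "F = (\<integral>\<^sup>+z. ennreal (near (z::'a)) \<partial>lborel)"
  define F2 where "F2 = (\<integral>\<^sup>+z. ennreal (near (z::'a) * indicator (cball 0 (1/2)) z) \<partial>lborel)"
  assume "\<not> ?thesis"
  then have fin: "F \<noteq> \<infinity>" by (simp add: F_def)
  have [measurable]: "(\<lambda>z::'a. near z * indicator (cball 0 (1/2)) z) \<in> borel_measurable borel"
    by measurable
  have "F2 = ennreal ((1/2) ^ ?N) * (\<integral>\<^sup>+z. ennreal (2 ^ ?N * near (z::'a)) \<partial>lborel)"
    unfolding F2_def by (subst nn_integral_lborel_scale[of _ "1/2"], measurable) (simp_all add: near_scale_half)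
  also have "\<dots> = ennreal ((1/2) ^ ?N) * (ennreal (2 ^ ?N) * F)"
    unfolding F_def by (subst ennreal_mult) (simp_all add: nn_integral_cmult)
  also have "\<dots> = F"
    by (simp add: mult.assoc[symmetric] power_divide flip: ennreal_mult)
  finally have F2: "F2 = F" .
  define U where "U = ball 0 1 - cball (0::'a) (1/2)"
  have U: "open U" unfolding U_def by (intro open_Diff) auto
  obtain b :: 'a where b: "b \<in> Basis" using nonempty_Basis by blast
  then have "(3/4) *\<^sub>R b \<in> U" by (simp add: U_def)
  then have pos: "emeasure lborel U > 0" by (intro emeasure_lborel_open_pos U) auto
  have [measurable]: "U \<in> sets borel" using U by simp
  have "F2 + emeasure lborel U = (\<integral>\<^sup>+z. ennreal (near (z::'a) * indicator (cball 0 (1/2)) z) + indicator U z \<partial>lborel)"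
    unfolding F2_def using U by (subst nn_integral_add) auto
  also have "\<dots> \<le> F"
    unfolding F_def
  proof (rule nn_integral_mono)
    fix z :: 'a
    have "near z \<ge> 1" if "z \<in> U" using that by (intro near_ge_1) (auto simp: U_def)
    then show "ennreal (near z * indicator (cball 0 (1/2)) z) + indicator U z \<le> ennreal (near z)"
      by (cases "z \<in> U") (auto simp: U_def indicator_def)
  qed
  finally show False using F2 pos fin
    by (metis add.right_neutral ennreal_add_left_cancel_le infinity_ennreal_def leD)
qed

text \<open>With the factor |z|^2 halving contracts by 1/4, so the integrals \<open>P n\<close> away
  from the ball of radius \<open>(1/2)^n\<close> obey \<open>P (Suc n) \<le> B + P n / 4\<close>.
  Truncation is needed to start the induction from a finite value.\<close>

lemma nn_integral_near_norm_square:
  "(\<integral>\<^sup>+z. ennreal (near z * (norm z)\<^sup>2) \<partial>(lborel :: 'a::euclidean_space measure)) < \<infinity>"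
proof -
  let ?N = "DIM('a)"
  define g where "g n z = near z * (norm z)\<^sup>2 * indicator (- cball 0 ((1/2)^n)) z" for n and z :: 'a
  have [measurable]: "g n \<in> borel_measurable borel" for n unfolding g_def by measurable
  have g_nn: "0 \<le> g n z" for n z by (simp add: g_def)
  define P where "P n = (\<integral>\<^sup>+z. ennreal (g n z) \<partial>lborel)" for n
  define B where "B = ennreal (2 ^ ?N) * emeasure lborel (cball (0::'a) 1)"
  have B: "B < \<infinity>" using emeasure_bounded_finite[OF bounded_cball, of "0::'a" 1]
    by (simp add: B_def ennreal_mult_less_top less_top)
  have step: "P (Suc n) \<le> B + ennreal (1/4) * P n" for n
  proof -
    have "g (Suc n) z \<le> 2 ^ ?N * indicator (cball 0 1) z + g (Suc n) z * indicator (cball 0 (1/2)) z" for z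
    proof (cases "norm z \<le> 1 \<and> \<not> norm z \<le> 1/2")
      case True
      then have z: "norm z \<le> 1" "norm z > 1/2" by auto
      have "z \<noteq> 0" using z by auto
      then have pos: "norm z ^ ?N > 0" by simp
      from z have "(1/2) ^ ?N \<le> norm z ^ ?N" by (intro power_mono) auto
      then have "near z \<le> 2 ^ ?N" using z pos
        by (simp add: near_def power_one_over field_simps)
      moreover have "(norm z)\<^sup>2 \<le> 1" using z by (simp add: power_le_one)
      moreover have "indicator (- cball 0 ((1/2)^Suc n)) z \<le> (1::real)" by (simp add: indicator_def)
      ultimately have "g (Suc n) z \<le> 2 ^ ?N * 1 * 1" unfolding g_def by (intro mult_mono) auto
      then show ?thesis using z g_nn[of "Suc n" z] by simp
    next
      case False
      then show ?thesis by (auto simp: g_def near_def)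
    qed
    then have "ennreal (g (Suc n) z) \<le> ennreal (2 ^ ?N * indicator (cball 0 1) z + g (Suc n) z * indicator (cball 0 (1/2)) z)" for z
      by (rule ennreal_leI)
    also have "ennreal (2 ^ ?N * indicator (cball 0 1) z + g (Suc n) z * indicator (cball 0 (1/2)) z)
      = ennreal (2 ^ ?N) * indicator (cball 0 1) z + ennreal (g (Suc n) z * indicator (cball 0 (1/2)) z)" for z
      using g_nn[of "Suc n" z] by (subst ennreal_plus) (auto simp: indicator_def)
    finally have "P (Suc n) \<le> (\<integral>\<^sup>+z. ennreal (2 ^ ?N) * indicator (cball 0 1) z + ennreal (g (Suc n) z * indicator (cball 0 (1/2)) z) \<partial>lborel)"
      unfolding P_def by (intro nn_integral_mono)
    also have "\<dots> = B + (\<integral>\<^sup>+z. ennreal (g (Suc n) z * indicator (cball 0 (1/2)) z) \<partial>lborel)"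
      by (subst nn_integral_add) (auto simp: nn_integral_cmult_indicator B_def)
    also have "(\<integral>\<^sup>+z. ennreal (g (Suc n) z * indicator (cball 0 (1/2)) z) \<partial>lborel) = ennreal (1/4) * P n"
    proof -
      have "g (Suc n) ((1/2) *\<^sub>R z) * indicator (cball 0 (1/2)) ((1/2) *\<^sub>R z) = 2 ^ ?N * (1/4) * g n z" for z :: 'a
      proof -
        have "g (Suc n) ((1/2) *\<^sub>R z) * indicator (cball 0 (1/2)) ((1/2) *\<^sub>R z)
          = (near ((1/2) *\<^sub>R z) * indicator (cball 0 (1/2)) ((1/2) *\<^sub>R z)) * ((1/4) * (norm z)\<^sup>2) * indicator (- cball 0 ((1/2)^n)) z"
          by (auto simp: g_def indicator_def power_divide)
        then show ?thesis by (simp add: near_scale_half g_def)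
      qed
      note sc = this
      have "(\<integral>\<^sup>+z. ennreal (g (Suc n) z * indicator (cball 0 (1/2)) z) \<partial>lborel)
        = ennreal ((1/2) ^ ?N) * (\<integral>\<^sup>+z. ennreal (g (Suc n) ((1/2) *\<^sub>R z) * indicator (cball 0 (1/2)) ((1/2) *\<^sub>R z)) \<partial>lborel)"
        by (rule nn_integral_lborel_scale) auto
      also have "\<dots> = ennreal ((1/2) ^ ?N) * (\<integral>\<^sup>+z. ennreal (2 ^ ?N * (1/4)) * ennreal (g n z) \<partial>lborel)"
        unfolding sc by (subst ennreal_mult) (auto simp: g_nn)
      also have "\<dots> = ennreal ((1/2) ^ ?N) * (ennreal (2 ^ ?N * (1/4)) * P n)"
        unfolding P_def by (subst nn_integral_cmult) auto
      also have "\<dots> = ennreal (1/4) * P n"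
        by (simp add: mult.assoc[symmetric] power_divide flip: ennreal_mult)
      finally show ?thesis .
    qed
    finally show ?thesis .
  qed
  obtain b where b: "B = ennreal b" "b \<ge> 0" using B by (cases B) auto
  \<comment> \<open>The bound reproduces itself: \<open>b + (1/4) * (2 * b)\<close> is at most
    \<open>2 * b\<close>.\<close>
  have bound: "P n \<le> ennreal (2 * b)" for n
  proof (induction n)
    case 0
    have "g 0 z = 0" for z :: 'a by (auto simp: g_def near_def)
    then show ?case by (simp add: P_def)
  next
    case (Suc n)
    have "P (Suc n) \<le> B + ennreal (1/4) * ennreal (2 * b)"
      by (rule order_trans[OF step]) (intro add_mono mult_left_mono Suc order_refl zero_le)
    also have "\<dots> \<le> ennreal (2 * b)"
      using b by (simp flip: ennreal_mult ennreal_plus)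
    finally show ?case .
  qed
  have "incseq (\<lambda>n z. ennreal (g n z))"
  proof (rule incseq_SucI, rule le_funI, rule ennreal_leI)
    fix n and z :: 'a
    have "cball (0::'a) ((1/2) ^ Suc n) \<subseteq> cball 0 ((1/2) ^ n)" by (intro subset_cball) simp
    then have "(indicator (- cball 0 ((1/2)^n)) z :: real) \<le> indicator (- cball 0 ((1/2)^Suc n)) z"
      by (auto simp: indicator_def subset_iff simp del: power_Suc mem_cball)
    then show "g n z \<le> g (Suc n) z"
      unfolding g_def by (intro mult_left_mono) auto
  qed
  moreover have "(SUP n. ennreal (g n z)) = ennreal (near z * (norm z)\<^sup>2)" for z
  proof (cases "z = 0")
    case False
    obtain n where n: "(1/2) ^ n < norm z" using real_arch_pow_inv[of "norm z" "1/2"] False by auto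
    show ?thesis
    proof (rule SUP_eqI)
      show "ennreal (g i z) \<le> ennreal (near z * (norm z)\<^sup>2)" for i
        by (intro ennreal_leI) (auto simp: g_def indicator_def)
      show "ennreal (near z * (norm z)\<^sup>2) \<le> y" if "\<And>i. i \<in> UNIV \<Longrightarrow> ennreal (g i z) \<le> y" for y
        using that[of n] n by (simp add: g_def)
    qed
  qed (simp add: g_def)
  ultimately have "(\<integral>\<^sup>+z. ennreal (near z * (norm z)\<^sup>2) \<partial>(lborel :: 'a measure)) = (SUP n. P n)"
    unfolding P_def by (subst nn_integral_monotone_convergence_SUP[symmetric]) auto
  also have "\<dots> \<le> ennreal (2 * b)" using bound by (intro SUP_least)
  also have "\<dots> < \<infinity>" by simp
  finally show ?thesis .
qed

section \<open>The compact embedding\<close>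

text \<open>Subtracting 1 makes the truncated kernel continuous across the sphere \<open>|z| = 1\<close>.\<close>

definition trunc_kernel :: "real \<Rightarrow> 'a::euclidean_space \<Rightarrow> real" where
  "trunc_kernel e z = max 0 (1 / max (norm z) e ^ DIM('a) - 1)"

lemma trunc_kernel_nonneg [simp]: "0 \<le> trunc_kernel e z" by (simp add: trunc_kernel_def)

lemma trunc_kernel_continuous: "e > 0 \<Longrightarrow> continuous_on UNIV (trunc_kernel e :: 'a::euclidean_space \<Rightarrow> real)"
  unfolding trunc_kernel_def by (intro continuous_intros) (auto simp: max_def)

lemma trunc_kernel_measurable [measurable]: "trunc_kernel e \<in> borel_measurable borel"
  unfolding trunc_kernel_def by measurable

lemma trunc_kernel_commute: "trunc_kernel e (x - y) = trunc_kernel e (y - x)"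
  by (simp add: trunc_kernel_def norm_minus_commute)

lemma trunc_kernel_le: "e > 0 \<Longrightarrow> trunc_kernel e (z::'a::euclidean_space) \<le> (1 / e ^ DIM('a)) * indicator (cball 0 1) z"
proof -
  assume e: "e > 0"
  have 1: "1 / max (norm z) e ^ DIM('a) \<le> 1 / e ^ DIM('a)"
    using e by (intro divide_left_mono power_mono) auto
  show ?thesis
  proof (cases "norm z \<le> 1")
    case True
    then show ?thesis using 1 e by (simp add: trunc_kernel_def)
  next
    case False
    then have "1 / max (norm z) e ^ DIM('a) \<le> 1" by (simp add: divide_le_eq one_le_power)
    then show ?thesis using False by (simp add: trunc_kernel_def)
  qed
qed

text \<open>The point 0 is excluded because \<open>near\<close> is 0 there, whereas the truncated
  kernel may be positive.\<close>

lemma trunc_kernel_le_near: "e > 0 \<Longrightarrow> z \<noteq> 0 \<Longrightarrow> trunc_kernel e z \<le> near (z::'a::euclidean_space)"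
proof -
  assume e: "e > 0" and z: "z \<noteq> 0"
  have 1: "1 / max (norm z) e ^ DIM('a) \<le> 1 / norm z ^ DIM('a)"
    using z by (intro divide_left_mono power_mono mult_pos_pos zero_less_power) (auto simp: less_max_iff_disj)
  show ?thesis
  proof (cases "norm z \<le> 1")
    case True
    then show ?thesis using 1 by (simp add: trunc_kernel_def near_def)
  next
    case False
    then have "1 / max (norm z) e ^ DIM('a) \<le> 1" by (simp add: divide_le_eq one_le_power)
    then show ?thesis by (simp add: trunc_kernel_def)
  qed
qed

lemma trunc_kernel_integrable: "e > 0 \<Longrightarrow> integrable lborel (trunc_kernel e :: 'a::euclidean_space \<Rightarrow> real)"
proof (rule Bochner_Integration.integrable_bound)
  show "integrable lborel (\<lambda>z::'a. (1 / e ^ DIM('a)) * indicator (cball 0 1) z)"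
    by (intro integrable_mult_right integrable_indicator_cball)
  show "AE z in lborel. norm (trunc_kernel e z) \<le> norm ((1 / e ^ DIM('a)) * indicator (cball 0 1) (z::'a))" if "e > 0"
  proof (intro AE_I2)
    fix z :: 'a
    show "norm (trunc_kernel e z) \<le> norm ((1 / e ^ DIM('a)) * indicator (cball 0 1) z)"
      using trunc_kernel_le[OF that, of z] that by simp
  qed
qed auto

text \<open>As \<open>e\<close> decreases to 0 the truncated kernels increase, and their supremum
  together with the indicator of the unit ball dominates \<open>near\<close>. A uniform bound on the
  integrals would pass to the limit and contradict the divergence for \<open>near\<close>.\<close>

lemma trunc_kernel_integral_unbounded:
  "\<exists>e>0. (\<integral>z. trunc_kernel e (z::'a::euclidean_space) \<partial>lborel) \<ge> c"
proof (rule ccontr)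
  assume none: "\<not> ?thesis"
  define k where "k n = (trunc_kernel (1 / Suc n) :: 'a \<Rightarrow> real)" for n :: nat
  have [measurable]: "k n \<in> borel_measurable borel" for n unfolding k_def by measurable
  define P where "P n = (\<integral>\<^sup>+z. ennreal (k n (z::'a)) \<partial>lborel)" for n
  have P: "P n \<le> ennreal c" for n
  proof -
    have "P n = ennreal (\<integral>z. k n (z::'a) \<partial>lborel)"
      unfolding P_def k_def by (intro nn_integral_eq_integral trunc_kernel_integrable) auto
    moreover have "(\<integral>z. k n (z::'a) \<partial>lborel) \<le> c"
      using none[unfolded not_ex, rule_format, of "1 / Suc n"] by (auto simp: k_def)
    ultimately show ?thesis by (simp add: ennreal_leI)
  qed
  have inc: "incseq (\<lambda>n (z::'a). ennreal (k n z))"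
  proof (rule incseq_SucI, rule le_funI, rule ennreal_leI)
    fix n and z :: 'a
    have "1 / real (Suc (Suc n)) \<le> 1 / Suc n" by (intro divide_left_mono) auto
    then have "1 / max (norm z) (1 / Suc n) ^ DIM('a) \<le> 1 / max (norm z) (1 / Suc (Suc n)) ^ DIM('a)"
      by (intro divide_left_mono power_mono mult_pos_pos zero_less_power) (auto simp: max_def simp del: of_nat_Suc)
    then show "k n z \<le> k (Suc n) z" by (auto simp: k_def trunc_kernel_def)
  qed
  have "ennreal (near z) \<le> (SUP n. ennreal (k n z)) + indicator (cball 0 1) z" for z :: 'a
  proof (cases "z = 0 \<or> norm z > 1")
    case False
    then have z: "z \<noteq> 0" "norm z \<le> 1" by auto
    obtain n :: nat where n: "1 / Suc n < norm z" using reals_Archimedean z by (metis inverse_eq_divide zero_less_norm_iff)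
    have "near z \<le> k n z + 1"
      using n z by (auto simp: near_def k_def trunc_kernel_def max_def)
    then have "ennreal (near z) \<le> ennreal (k n z) + indicator (cball 0 1) z"
      using z by (simp add: ennreal_leI k_def flip: ennreal_plus ennreal_1)
    also have "\<dots> \<le> (SUP n. ennreal (k n z)) + indicator (cball 0 1) z"
      by (intro add_right_mono SUP_upper) auto
    finally show ?thesis .
  qed (use nonempty_Basis in \<open>auto simp: near_def card_gt_0_iff power_0_left\<close>)
  then have "(\<integral>\<^sup>+z. ennreal (near z) \<partial>(lborel :: 'a measure))
    \<le> (\<integral>\<^sup>+z. (SUP n. ennreal (k n z)) + indicator (cball 0 1) z \<partial>(lborel :: 'a measure))"
    by (intro nn_integral_mono) auto
  also have "\<dots> = (\<integral>\<^sup>+z. (SUP n. ennreal (k n z)) \<partial>(lborel :: 'a measure)) + emeasure lborel (cball (0::'a) 1)"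
    by (subst nn_integral_add) auto
  also have "(\<integral>\<^sup>+z. (SUP n. ennreal (k n z)) \<partial>(lborel :: 'a measure)) = (SUP n. P n)"
    unfolding P_def by (rule nn_integral_monotone_convergence_SUP[OF inc]) auto
  also have "(SUP n. P n) + emeasure lborel (cball (0::'a) 1) \<le> ennreal c + emeasure lborel (cball (0::'a) 1)"
    by (intro add_right_mono SUP_least P)
  also have "\<dots> < \<infinity>" using emeasure_bounded_finite[OF bounded_cball, of "0::'a" 1] by (simp add: less_top)
  finally show False by (simp add: nn_integral_near)
qed

definition conv :: "real \<Rightarrow> ('a::euclidean_space \<Rightarrow> real) \<Rightarrow> 'a \<Rightarrow> real" where
  "conv e w x = (\<integral>y. trunc_kernel e (x - y) * w y \<partial>lborel)"

lemma conv_integrable: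
  assumes e: "e > 0" and w: "integrable lborel (w :: 'a::euclidean_space \<Rightarrow> real)"
  shows "integrable lborel (\<lambda>y. trunc_kernel e (x - y) * w y)"
proof (rule Bochner_Integration.integrable_bound)
  have [measurable]: "w \<in> borel_measurable borel" using w by auto
  show "integrable lborel (\<lambda>y. (1 / e ^ DIM('a)) * w y)" using w by simp
  show "(\<lambda>y. trunc_kernel e (x - y) * w y) \<in> borel_measurable lborel" by measurable
  have "trunc_kernel e z \<le> 1 / e ^ DIM('a)" for z :: 'a
    using trunc_kernel_le[OF e, of z] e by (auto simp: indicator_def split: if_splits intro: order_trans)
  then show "AE y in lborel. norm (trunc_kernel e (x - y) * w y) \<le> norm ((1 / e ^ DIM('a)) * w y)"
    using e unfolding norm_mult by (intro AE_I2 mult_right_mono) auto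
qed

text \<open>
  Integrate \<open>k(x-y) (w(x)\<^sup>2 + w(y)\<^sup>2) = k(x-y) (w(x) - w(y))\<^sup>2 + 2 k(x-y) w(x) w(y)\<close>.
\<close>

lemma energy_controls_L2:
  assumes w: "w \<in> borel_H \<Omega>" and bd: "bounded (\<Omega> :: 'a::euclidean_space set)" and e: "e > 0"
    and S: "\<And>x. x \<in> \<Omega> \<Longrightarrow> \<bar>conv e w x\<bar> \<le> S"
  shows "2 * (\<integral>z. trunc_kernel e (z::'a) \<partial>lborel) * mass_form w w \<le> near_form w w + 2 * S * (\<integral>x. \<bar>w x\<bar> \<partial>lborel)"
proof -
  let ?k = "trunc_kernel e :: 'a \<Rightarrow> real"
  let ?c = "\<integral>z. ?k z \<partial>lborel"
  have wL: "w \<in> borel_L2 \<Omega>" using w borel_H_subset_borel_L2[OF bd] by auto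
  have [measurable]: "w \<in> borel_measurable borel" using w by (simp add: borel_H_def)
  have w1: "integrable lborel w" by (rule borel_L2_integrable[OF wL bd])
  have w2: "integrable lborel (\<lambda>x. (w x)\<^sup>2)" using wL by (simp add: borel_L2_def)
  have off: "w x = 0" if "x \<notin> \<Omega>" for x using wL that by (simp add: borel_L2_def)
  have kB: "?k z \<le> 1 / e ^ DIM('a)" for z
    using trunc_kernel_le[OF e, of z] e by (auto simp: indicator_def split: if_splits intro: order_trans)
  have nn1: "(\<integral>\<^sup>+p. ennreal (case p of (x, y) \<Rightarrow> ?k (x - y) * (w x)\<^sup>2) \<partial>lborel2) = ennreal (?c * mass_form w w)"
  proof -
    have "(\<integral>\<^sup>+p. ennreal (case p of (x, y) \<Rightarrow> ?k (x - y) * (w x)\<^sup>2) \<partial>lborel2)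
      = (\<integral>\<^sup>+(x, y). ennreal (?k (x - y)) * ennreal ((w x)\<^sup>2) \<partial>lborel2)"
      by (intro nn_integral_cong) (auto simp: ennreal_mult)
    also have "\<dots> = (\<integral>\<^sup>+z. ennreal (?k z) \<partial>lborel) * (\<integral>\<^sup>+x. ennreal ((w x)\<^sup>2) \<partial>lborel)"
      by (rule nn_integral_convolution_kernel) auto
    also have "\<dots> = ennreal ?c * ennreal (mass_form w w)"
      using w2 by (subst (1 2) nn_integral_eq_integral) (auto simp: trunc_kernel_integrable[OF e] mass_form_def power2_eq_square)
    finally show ?thesis
      by (subst ennreal_mult) (auto simp: mass_form_def intro!: integral_nonneg_AE)
  qed
  have I0: "0 \<le> ?c * mass_form w w"
    by (auto simp: mass_form_def intro!: integral_nonneg_AE mult_nonneg_nonneg)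
  have i1: "integrable lborel2 (\<lambda>(x, y). ?k (x - y) * (w x)\<^sup>2)"
    by (subst integrable_iff_nn_integral) (auto simp: nn1)
  have v1: "(\<integral>(x, y). ?k (x - y) * (w x)\<^sup>2 \<partial>lborel2) = ?c * mass_form w w"
    by (subst integral_eq_nn_integral) (auto simp: nn1 I0)
  have sw: "(\<lambda>(x, y). ?k (x - y) * (w y)\<^sup>2) = (\<lambda>(x, y). (case (y, x) of (x, y) \<Rightarrow> ?k (x - y) * (w x)\<^sup>2))"
    by (auto simp: fun_eq_iff trunc_kernel_commute)
  have i2: "integrable lborel2 (\<lambda>(x, y). ?k (x - y) * (w y)\<^sup>2)"
    unfolding sw using lborel_pair.integrable_product_swap[OF i1] by simp
  have v2: "(\<integral>(x, y). ?k (x - y) * (w y)\<^sup>2 \<partial>lborel2) = ?c * mass_form w w"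
    unfolding sw v1[symmetric]
    using lborel_pair.integral_product_swap[of "\<lambda>(x, y). ?k (x - y) * (w x)\<^sup>2"] i1
    by (simp add: borel_measurable_integrable)
  have i3: "integrable lborel2 (\<lambda>(x, y). ?k (x - y) * (w x - w y)\<^sup>2)"
    and v3: "(\<integral>(x, y). ?k (x - y) * (w x - w y)\<^sup>2 \<partial>lborel2) \<le> near_form w w"
  proof -
    have le: "?k (x - y) * (w x - w y)\<^sup>2 \<le> near (x - y) * (w x - w y)\<^sup>2" for x y
      by (cases "x = y") (auto intro!: mult_right_mono trunc_kernel_le_near e)
    have G: "integrable lborel2 (\<lambda>(x, y). near (x - y) * (w x - w y)\<^sup>2)" using w by (simp add: borel_H_def)
    show i3: "integrable lborel2 (\<lambda>(x, y). ?k (x - y) * (w x - w y)\<^sup>2)"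
    proof (rule Bochner_Integration.integrable_bound[OF G])
      show "AE p in lborel2. norm (case p of (x, y) \<Rightarrow> ?k (x - y) * (w x - w y)\<^sup>2) \<le> norm (case p of (x, y) \<Rightarrow> near (x - y) * (w x - w y)\<^sup>2)"
        by (intro AE_I2) (use le in \<open>auto split: prod.splits\<close>)
    qed measurable
    show "(\<integral>(x, y). ?k (x - y) * (w x - w y)\<^sup>2 \<partial>lborel2) \<le> near_form w w"
      unfolding near_form_def power2_eq_square[symmetric] using le by (intro integral_mono i3 G) auto
  qed
  have i4: "integrable lborel2 (\<lambda>(x, y). w x * (?k (x - y) * w y))"
  proof (rule Bochner_Integration.integrable_bound)
    show "integrable lborel2 (\<lambda>p. (1 / e ^ DIM('a)) * (case p of (x, y) \<Rightarrow> w x * w y))"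
      using integrable_lborel2_product[OF w1 w1] by simp
    have "\<bar>w x * (?k (x - y) * w y)\<bar> \<le> (1 / e ^ DIM('a)) * \<bar>w x * w y\<bar>" for x y
      using mult_right_mono[OF kB[of "x - y"], of "\<bar>w x * w y\<bar>"] by (simp add: abs_mult algebra_simps)
    then show "AE p in lborel2. norm (case p of (x, y) \<Rightarrow> w x * (?k (x - y) * w y)) \<le> norm ((1 / e ^ DIM('a)) * (case p of (x, y) \<Rightarrow> w x * w y))"
      using e by (intro AE_I2) (auto simp: abs_mult split: prod.splits)
  qed measurable
  have v4: "(\<integral>(x, y). w x * (?k (x - y) * w y) \<partial>lborel2) \<le> S * (\<integral>x. \<bar>w x\<bar> \<partial>lborel)"
  proof -
    have "(\<integral>(x, y). w x * (?k (x - y) * w y) \<partial>lborel2) = (\<integral>x. w x * conv e w x \<partial>lborel)"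
      by (subst integral_lborel2_iterated[OF i4]) (simp add: conv_def)
    also have "\<dots> \<le> (\<integral>x. S * \<bar>w x\<bar> \<partial>lborel)"
    proof (rule integral_mono)
      show "integrable lborel (\<lambda>x. w x * conv e w x)"
        using lborel_pair.integrable_fst'[OF i4] by (simp add: conv_def)
      show "integrable lborel (\<lambda>x. S * \<bar>w x\<bar>)" using w1 by simp
      show "w x * conv e w x \<le> S * \<bar>w x\<bar>" for x
      proof (cases "x \<in> \<Omega>")
        case True
        have "w x * conv e w x \<le> \<bar>w x\<bar> * \<bar>conv e w x\<bar>" by (simp flip: abs_mult)
        also have "\<dots> \<le> \<bar>w x\<bar> * S" using S[OF True] by (intro mult_left_mono) auto
        finally show ?thesis by (simp add: mult.commute)
      qed (simp add: off)
    qed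
    finally show ?thesis by simp
  qed
  have "2 * (?c * mass_form w w) = (\<integral>p. (case p of (x, y) \<Rightarrow> ?k (x - y) * (w x)\<^sup>2) + (case p of (x, y) \<Rightarrow> ?k (x - y) * (w y)\<^sup>2) \<partial>lborel2)"
    using i1 i2 v1 v2 by simp
  also have "\<dots> = (\<integral>p. (case p of (x, y) \<Rightarrow> ?k (x - y) * (w x - w y)\<^sup>2) + 2 * (case p of (x, y) \<Rightarrow> w x * (?k (x - y) * w y)) \<partial>lborel2)"
    by (intro Bochner_Integration.integral_cong) (auto simp: power2_eq_square algebra_simps)
  also have "\<dots> \<le> near_form w w + 2 * (S * (\<integral>x. \<bar>w x\<bar> \<partial>lborel))"
    using i3 i4 v3 v4 by simp
  finally show ?thesis by (simp add: mult.assoc)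
qed

text \<open>The modulus comes from uniform continuity of the kernel on the compact square of the
  closure of \<Omega>, so one \<open>d\<close> serves all \<open>w\<close> with \<open>L^1\<close>
  norm at most \<open>M\<close>, as Arzela-Ascoli demands.\<close>

lemma conv_equicontinuous:
  assumes bd: "bounded (\<Omega> :: 'a::euclidean_space set)" and e: "e > 0"
    and x: "x \<in> closure \<Omega>" and \<eta>: "\<eta> > 0" and M: "M > 0"
  shows "\<exists>d>0. \<forall>y w. y \<in> closure \<Omega> \<and> norm (x - y) < d \<and> w \<in> borel_L2 \<Omega> \<and> (\<integral>z. \<bar>w z\<bar> \<partial>lborel) \<le> M \<longrightarrow>
    \<bar>conv e w x - conv e w y\<bar> < \<eta>"
proof -
  let ?S = "closure \<Omega>"
  have cS: "compact (?S \<times> ?S)" using bd by (intro compact_Times) (auto simp: compact_closure)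
  have "continuous_on (?S \<times> ?S) (\<lambda>p. trunc_kernel e (fst p - snd p))"
    by (rule continuous_on_compose2[OF trunc_kernel_continuous[OF e]]) (auto intro!: continuous_intros)
  then have "uniformly_continuous_on (?S \<times> ?S) (\<lambda>p. trunc_kernel e (fst p - snd p))"
    using cS by (rule compact_uniformly_continuous)
  then obtain d where d: "d > 0" and ud: "\<And>p q. p \<in> ?S \<times> ?S \<Longrightarrow> q \<in> ?S \<times> ?S \<Longrightarrow> dist q p < d \<Longrightarrow>
      dist (trunc_kernel e (fst q - snd q)) (trunc_kernel e (fst p - snd p)) < \<eta> / (2 * M)"
    unfolding uniformly_continuous_on_def using \<eta> M by (metis divide_pos_pos mult_pos_pos zero_less_numeral)
  have "\<bar>conv e w x - conv e w y\<bar> < \<eta>"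
    if y: "y \<in> ?S" "norm (x - y) < d" and w: "w \<in> borel_L2 \<Omega>" and wM: "(\<integral>z. \<bar>w z\<bar> \<partial>lborel) \<le> M" for y w
  proof -
    have w1: "integrable lborel w" by (rule borel_L2_integrable[OF w bd])
    have "conv e w x - conv e w y = (\<integral>z. trunc_kernel e (x - z) * w z - trunc_kernel e (y - z) * w z \<partial>lborel)"
      unfolding conv_def by (subst Bochner_Integration.integral_diff[OF conv_integrable[OF e w1] conv_integrable[OF e w1]]) simp
    then have "\<bar>conv e w x - conv e w y\<bar> \<le> (\<integral>z. \<bar>trunc_kernel e (x - z) * w z - trunc_kernel e (y - z) * w z\<bar> \<partial>lborel)"
      by (simp only: integral_abs_bound)
    also have "\<dots> \<le> (\<integral>z. \<eta> / (2 * M) * \<bar>w z\<bar> \<partial>lborel)"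
    proof (rule integral_mono)
      show "integrable lborel (\<lambda>z. \<bar>trunc_kernel e (x - z) * w z - trunc_kernel e (y - z) * w z\<bar>)"
        using conv_integrable[OF e w1] by auto
      show "integrable lborel (\<lambda>z. \<eta> / (2 * M) * \<bar>w z\<bar>)" using w1 by simp
      show "\<bar>trunc_kernel e (x - z) * w z - trunc_kernel e (y - z) * w z\<bar> \<le> \<eta> / (2 * M) * \<bar>w z\<bar>" for z
      proof (cases "z \<in> \<Omega>")
        case True
        then have z: "z \<in> ?S" using closure_subset by auto
        have "dist (x, z) (y, z) < d" using y(2) by (simp add: dist_Pair_Pair dist_norm)
        then have "\<bar>trunc_kernel e (x - z) - trunc_kernel e (y - z)\<bar> \<le> \<eta> / (2 * M)"
          using ud[of "(y, z)" "(x, z)"] x y z by (simp add: dist_real_def)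
        then have "\<bar>trunc_kernel e (x - z) - trunc_kernel e (y - z)\<bar> * \<bar>w z\<bar> \<le> \<eta> / (2 * M) * \<bar>w z\<bar>"
          by (intro mult_right_mono) auto
        then show ?thesis by (simp add: left_diff_distrib flip: abs_mult)
      next
        case False
        then have "w z = 0" using w by (simp add: borel_L2_def)
        then show ?thesis by simp
      qed
    qed
    also have "\<dots> = \<eta> / (2 * M) * (\<integral>z. \<bar>w z\<bar> \<partial>lborel)" by simp
    also have "\<dots> \<le> \<eta> / (2 * M) * M" using wM \<eta> M by (intro mult_left_mono) auto
    also have "\<dots> < \<eta>" using \<eta> M by simp
    finally show ?thesis .
  qed
  then show ?thesis using d by blast
qed

text \<open>The parameter weights |u| \<le> t + u^2 / t. With \<open>t = 1\<close> it bounds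
  \<open>L^1\<close> norms along bounded sequences; with \<open>t = (1/2)^k\<close> it makes rapidly
  decreasing \<open>L^2\<close> distances summable in \<open>L^1\<close>.\<close>

lemma borel_L2_L1_bound:
  fixes u :: "'a::euclidean_space \<Rightarrow> real"
  assumes u: "u \<in> borel_L2 \<Omega>" and R: "\<Omega> \<subseteq> cball 0 R" and t: "t > 0"
  shows "(\<integral>x. \<bar>u x\<bar> \<partial>lborel) \<le> t * measure lborel (cball (0::'a) R) + mass_form u u / t"
proof -
  have bd: "bounded \<Omega>" using R bounded_cball bounded_subset by blast
  have i: "integrable lborel (\<lambda>x. t * indicator (cball 0 R) x + (u x)\<^sup>2 / t)"
    using u integrable_indicator_cball[of 0 R] by (auto simp: borel_L2_def)
  have "(\<integral>x. \<bar>u x\<bar> \<partial>lborel) \<le> (\<integral>x. t * indicator (cball 0 R) x + (u x)\<^sup>2 / t \<partial>lborel)"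
  proof (rule integral_mono)
    show "integrable lborel (\<lambda>x. \<bar>u x\<bar>)" using borel_L2_integrable[OF u bd] by simp
    show "\<bar>u x\<bar> \<le> t * indicator (cball 0 R) x + (u x)\<^sup>2 / t" for x
    proof (cases "x \<in> \<Omega>")
      case True
      then have "x \<in> cball 0 R" using R by auto
      moreover have "\<bar>u x\<bar> \<le> t + (u x)\<^sup>2 / t"
        using abs_mult_le_sum_squares[of t "u x"] t by (simp add: field_simps abs_mult power2_eq_square)
      ultimately show ?thesis by simp
    qed (use u t in \<open>auto simp: borel_L2_def\<close>)
  qed (fact i)
  also have "\<dots> = t * measure lborel (cball (0::'a) R) + mass_form u u / t"
  proof (subst Bochner_Integration.integral_add)
    show "integrable lborel (\<lambda>x. t * indicator (cball 0 R) (x::'a))"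
      by (intro integrable_mult_right integrable_indicator_cball)
    show "integrable lborel (\<lambda>x. (u x)\<^sup>2 / t)" using u by (simp add: borel_L2_def)
  qed (simp add: mass_form_def power2_eq_square)
  finally show ?thesis .
qed

text \<open>The kernel must be chosen according to the accuracy \<epsilon>, so this yields a
  subsequence for one \<epsilon> only.\<close>

lemma near_Cauchy_subsequence:
  fixes u :: "nat \<Rightarrow> 'a::euclidean_space \<Rightarrow> real"
  assumes bd: "bounded \<Omega>" and u: "\<And>n. u n \<in> borel_H \<Omega>" and G: "\<And>n. near_form (u n) (u n) \<le> M"
    and I: "\<And>n. mass_form (u n) (u n) \<le> M" and \<epsilon>: "\<epsilon> > 0"
  shows "\<exists>r. strict_mono (r::nat\<Rightarrow>nat) \<and> (\<forall>m n. mass_form (u (r m) - u (r n)) (u (r m) - u (r n)) < \<epsilon>)"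
proof -
  interpret I: psd_form_on "borel_L2 \<Omega>" mass_form by (rule psd_mass_form)
  interpret G: psd_form_on "borel_H \<Omega>" near_form by (rule psd_near_form)
  obtain R where R: "\<Omega> \<subseteq> cball 0 R" using bounded_subset_cball0[OF bd] .
  have uL: "u n \<in> borel_L2 \<Omega>" for n using u borel_H_subset_borel_L2[OF bd] by auto
  have u1: "integrable lborel (u n)" for n by (rule borel_L2_integrable[OF uL bd])
  have M0: "0 \<le> M" using G[of 0] G.nonneg[OF u, of 0] by simp
  define M1 where "M1 = measure lborel (cball (0::'a) R) + M + 1"
  have M1: "M1 > 0" using M0 by (simp add: M1_def add_nonneg_pos)
  have L1: "(\<integral>x. \<bar>u n x\<bar> \<partial>lborel) \<le> M1" for n
    using borel_L2_L1_bound[OF uL R, of 1 n] I[of n] by (simp add: M1_def)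
  have L1d: "(\<integral>x. \<bar>(u m - u n) x\<bar> \<partial>lborel) \<le> 2 * M1" for m n
  proof -
    have "(\<integral>x. \<bar>(u m - u n) x\<bar> \<partial>lborel) \<le> (\<integral>x. \<bar>u m x\<bar> + \<bar>u n x\<bar> \<partial>lborel)"
      using u1 by (intro integral_mono) (auto simp: abs_triangle_ineq4)
    also have "\<dots> \<le> 2 * M1" using u1 L1[of m] L1[of n] by simp
    finally show ?thesis .
  qed
  \<comment> \<open>Differences of the sequence have near form at most \<open>4 * M\<close>. A
    kernel of mass \<open>4 * M / \<epsilon>\<close> balances this term, and the extra 1 leaves a
    margin \<epsilon> for the convolution term.\<close>
  obtain e where e: "e > 0" and c: "(\<integral>z. trunc_kernel e (z::'a) \<partial>lborel) \<ge> 4 * M / \<epsilon> + 1"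
    using trunc_kernel_integral_unbounded by blast
  define c where "c = (\<integral>z. trunc_kernel e (z::'a) \<partial>lborel)"
  have c0: "4 * M / \<epsilon> + 1 \<le> c" using c by (simp add: c_def)
  have "0 \<le> 4 * M / \<epsilon>" using M0 \<epsilon> by simp
  then have c1: "c \<ge> 1" using c0 by linarith
  have c2: "4 * M + \<epsilon> \<le> c * \<epsilon>" using c0 \<epsilon> by (simp add: field_simps)
  have kB: "trunc_kernel e z \<le> 1 / e ^ DIM('a)" for z :: 'a
    using trunc_kernel_le[OF e, of z] e by (auto simp: indicator_def split: if_splits intro: order_trans)
  have bound: "norm (conv e (u n) x) \<le> 1 / e ^ DIM('a) * M1" for n x
  proof -
    have "norm (conv e (u n) x) \<le> (\<integral>y. norm (trunc_kernel e (x - y) * u n y) \<partial>lborel)"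
      unfolding conv_def by (rule integral_norm_bound)
    also have "\<dots> \<le> (\<integral>y. 1 / e ^ DIM('a) * \<bar>u n y\<bar> \<partial>lborel)"
    proof (rule integral_mono)
      show "integrable lborel (\<lambda>y. norm (trunc_kernel e (x - y) * u n y))"
        using conv_integrable[OF e u1] by auto
      show "integrable lborel (\<lambda>y. 1 / e ^ DIM('a) * \<bar>u n y\<bar>)"
        by (intro integrable_mult_right integrable_abs u1)
      show "norm (trunc_kernel e (x - y) * u n y) \<le> 1 / e ^ DIM('a) * \<bar>u n y\<bar>" for y
        using kB[of "x - y"] e unfolding norm_mult by (intro mult_mono) auto
    qed
    also have "\<dots> = 1 / e ^ DIM('a) * (\<integral>y. \<bar>u n y\<bar> \<partial>lborel)" by (rule integral_mult_right_zero)
    also have "\<dots> \<le> 1 / e ^ DIM('a) * M1" using L1[of n] e by (intro mult_left_mono) auto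
    finally show ?thesis .
  qed
  have equi: "\<exists>d>0. \<forall>n y. y \<in> closure \<Omega> \<and> norm (x - y) < d \<longrightarrow> norm (conv e (u n) x - conv e (u n) y) < \<eta>"
    if "x \<in> closure \<Omega>" "0 < \<eta>" for x \<eta>
    using conv_equicontinuous[OF bd e that M1] uL L1 unfolding real_norm_def by meson
  obtain g k where k: "strict_mono (k :: nat \<Rightarrow> nat)"
    and gk: "\<And>\<eta>. 0 < \<eta> \<Longrightarrow> \<exists>N. \<forall>n x. n \<ge> N \<and> x \<in> closure \<Omega> \<longrightarrow> norm (conv e (u (k n)) x - g x) < \<eta>"
    by (rule Arzela_Ascoli[of "closure \<Omega>" "\<lambda>n. conv e (u n)" "1 / e ^ DIM('a) * M1", OF _ bound equi])
       (use bd in \<open>auto simp: compact_closure\<close>)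
  \<comment> \<open>With convolutions within \<open>2 * \<eta>\<close> and \<open>L^1\<close> norms
    within \<open>2 * M1\<close>, the error term is at most \<open>4 * \<eta> * (2 * M1)\<close>,
    that is, \<epsilon> / 2.\<close>
  define \<eta> where "\<eta> = \<epsilon> / (16 * M1)"
  have \<eta>: "\<eta> > 0" using \<epsilon> M1 by (simp add: \<eta>_def)
  from gk[OF \<eta>] obtain N where N: "\<And>n x. n \<ge> N \<Longrightarrow> x \<in> closure \<Omega> \<Longrightarrow> norm (conv e (u (k n)) x - g x) < \<eta>"
    by blast
  have small: "mass_form (u (k m) - u (k n)) (u (k m) - u (k n)) < \<epsilon>" if mn: "m \<ge> N" "n \<ge> N" for m n
  proof -
    let ?w = "u (k m) - u (k n)"
    have wH: "?w \<in> borel_H \<Omega>" by (intro G.mem_simps u)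
    have "\<bar>conv e ?w x\<bar> \<le> 2 * \<eta>" if x: "x \<in> \<Omega>" for x
    proof -
      have xc: "x \<in> closure \<Omega>" using x closure_subset by auto
      have "conv e ?w x = conv e (u (k m)) x - conv e (u (k n)) x"
        unfolding conv_def
        by (subst Bochner_Integration.integral_diff[OF conv_integrable[OF e u1] conv_integrable[OF e u1], symmetric])
           (simp add: algebra_simps)
      then show ?thesis using N[OF mn(1) xc] N[OF mn(2) xc] by simp
    qed
    from energy_controls_L2[OF wH bd e this]
    have "2 * c * mass_form ?w ?w \<le> near_form ?w ?w + 4 * \<eta> * (\<integral>x. \<bar>?w x\<bar> \<partial>lborel)"
      by (simp add: c_def)
    also have "\<dots> \<le> 4 * M + 4 * \<eta> * (2 * M1)"
      using G.square_diff_le[OF u u, of "k m" "k n"] G[of "k m"] G[of "k n"] \<eta>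
      by (intro add_mono mult_left_mono L1d) auto
    also have "\<dots> = 4 * M + \<epsilon> / 2" using M1 by (simp add: \<eta>_def)
    also have "\<dots> < c * \<epsilon>" using c2 \<epsilon> by linarith
    finally have "c * (2 * mass_form ?w ?w) < c * \<epsilon>" by simp
    then have "2 * mass_form ?w ?w < \<epsilon>" using c1 by simp
    moreover have "0 \<le> mass_form ?w ?w" by (intro I.nonneg I.mem_simps uL)
    ultimately show ?thesis by simp
  qed
  show ?thesis
    using small strict_mono_o[OF k, of "\<lambda>n. n + N"]
    by (intro exI[of _ "k \<circ> (\<lambda>n. n + N)"]) (auto simp: strict_mono_def)
qed

text \<open>Being uniformly closer than \<open>1 / Suc k\<close> is inherited by subsequences, so a
  diagonal sequence combines all accuracies.\<close>

theorem borel_H_compact_embedding: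
  fixes u :: "nat \<Rightarrow> 'a::euclidean_space \<Rightarrow> real"
  assumes bd: "bounded \<Omega>" and u: "\<And>n. u n \<in> borel_H \<Omega>" and G: "\<And>n. near_form (u n) (u n) \<le> M"
    and I: "\<And>n. mass_form (u n) (u n) \<le> M"
  shows "\<exists>r. strict_mono (r::nat\<Rightarrow>nat) \<and>
    (\<forall>e>0. \<exists>N. \<forall>m\<ge>N. \<forall>n\<ge>N. mass_form (u (r m) - u (r n)) (u (r m) - u (r n)) < e)"
proof -
  interpret subseqs "\<lambda>k s. \<forall>m n. mass_form (u (s m) - u (s n)) (u (s m) - u (s n)) < 1 / Suc k"
  proof
    fix k and s :: "nat \<Rightarrow> nat"
    show "\<exists>r'. strict_mono (r' :: nat \<Rightarrow> nat) \<and> (\<forall>m n. mass_form (u ((s \<circ> r') m) - u ((s \<circ> r') n)) (u ((s \<circ> r') m) - u ((s \<circ> r') n)) < 1 / Suc k)"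
    proof -
      obtain r :: "nat \<Rightarrow> nat" where "strict_mono r" "\<forall>m n. mass_form (u (s (r m)) - u (s (r n))) (u (s (r m)) - u (s (r n))) < 1 / Suc k"
        using near_Cauchy_subsequence[of \<Omega> "\<lambda>n. u (s n)" M "1 / Suc k"] bd u G I by auto
      then show ?thesis by (intro exI[of _ r]) simp
    qed
  qed
  \<comment> \<open>From index \<open>Suc k\<close> on, the diagonal sequence runs inside the
    subsequence selected for accuracy \<open>1 / Suc k\<close>.\<close>
  have D: "\<forall>m n. mass_form (u ((diagseq \<circ> ((+) (Suc k))) m) - u ((diagseq \<circ> ((+) (Suc k))) n))
     (u ((diagseq \<circ> ((+) (Suc k))) m) - u ((diagseq \<circ> ((+) (Suc k))) n)) < 1 / Suc k" for k
    by (rule diagseq_holds) auto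
  have "\<exists>N. \<forall>m\<ge>N. \<forall>n\<ge>N. mass_form (u (diagseq m) - u (diagseq n)) (u (diagseq m) - u (diagseq n)) < e"
    if e: "e > 0" for e
  proof -
    obtain k :: nat where k: "1 / Suc k < e" using reals_Archimedean[OF e] by (metis inverse_eq_divide)
    have "mass_form (u (diagseq m) - u (diagseq n)) (u (diagseq m) - u (diagseq n)) < e"
      if "m \<ge> Suc k" "n \<ge> Suc k" for m n
      using D[of k, rule_format, of "m - Suc k" "n - Suc k"] that k by (simp del: of_nat_Suc)
    then show ?thesis by blast
  qed
  then show ?thesis using subseq_diagseq by blast
qed

section \<open>Completeness\<close>

text \<open>Integrability of the limit is part of the conclusion; this is how limits are shown to
  belong to the spaces.\<close>

lemma Fatou_bound:
  fixes f :: "nat \<Rightarrow> 'b \<Rightarrow> real"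
  assumes f: "\<And>n. integrable M (f n)" "\<And>n x. 0 \<le> f n x" and b: "\<And>n. integral\<^sup>L M (f n) \<le> c"
    and lim: "AE x in M. (\<lambda>n. f n x) \<longlonglongrightarrow> g x" and g: "g \<in> borel_measurable M" "\<And>x. 0 \<le> g x"
  shows "integrable M g" "integral\<^sup>L M g \<le> c"
proof -
  have "0 \<le> integral\<^sup>L M (f 0)" using f(2) by (intro integral_nonneg_AE) auto
  then have c: "c \<ge> 0" using b[of 0] by linarith
  have "(\<integral>\<^sup>+x. ennreal (g x) \<partial>M) = (\<integral>\<^sup>+x. liminf (\<lambda>n. ennreal (f n x)) \<partial>M)"
  proof (rule nn_integral_cong_AE)
    show "AE x in M. ennreal (g x) = liminf (\<lambda>n. ennreal (f n x))"
      using lim by eventually_elim (metis lim_imp_Liminf tendsto_ennrealI trivial_limit_sequentially)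
  qed
  also have "\<dots> \<le> liminf (\<lambda>n. \<integral>\<^sup>+x. ennreal (f n x) \<partial>M)"
    using f by (intro nn_integral_liminf) auto
  also have "\<dots> \<le> ennreal c"
  proof -
    have "(\<integral>\<^sup>+x. ennreal (f n x) \<partial>M) \<le> ennreal c" for n
      using f b by (subst nn_integral_eq_integral) (auto intro: ennreal_leI)
    then have "eventually (\<lambda>n. (\<integral>\<^sup>+x. ennreal (f n x) \<partial>M) \<le> ennreal c) sequentially" by simp
    then have "liminf (\<lambda>n. \<integral>\<^sup>+x. ennreal (f n x) \<partial>M) \<le> liminf (\<lambda>n::nat. ennreal c)"
      by (rule Liminf_mono)
    then show ?thesis by (simp add: Liminf_const)
  qed
  finally have le: "(\<integral>\<^sup>+x. ennreal (g x) \<partial>M) \<le> ennreal c" .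
  show i: "integrable M g"
    using le g by (subst integrable_iff_nn_integral) (auto intro: le_less_trans)
  show "integral\<^sup>L M g \<le> c"
    using le c g i by (subst (asm) nn_integral_eq_integral) auto
qed

text \<open>Along indices with consecutive \<open>mass_form\<close> distances below
  \<open>(1/4)^k\<close> the \<open>L^1\<close> distances are at most a constant times
  \<open>(1/2)^k\<close>. Their sum is finite, so the increments are absolutely summable at almost
  every point and the sequence telescopes to a limit.\<close>

lemma L2_Cauchy_AE_subseq:
  fixes u :: "nat \<Rightarrow> 'a::euclidean_space \<Rightarrow> real"
  assumes bd: "bounded \<Omega>" and u: "\<And>n. u n \<in> borel_L2 \<Omega>"
    and C: "\<forall>e>0. \<exists>N. \<forall>m\<ge>N. \<forall>n\<ge>N. mass_form (u m - u n) (u m - u n) < e"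
  obtains r v where "strict_mono (r :: nat \<Rightarrow> nat)" "v \<in> borel_measurable borel"
    "\<And>x. x \<notin> \<Omega> \<Longrightarrow> v x = 0" "AE x in lborel. (\<lambda>n. u (r n) x) \<longlonglongrightarrow> v x"
proof -
  interpret I: psd_form_on "borel_L2 \<Omega>" mass_form by (rule psd_mass_form)
  obtain R where R: "\<Omega> \<subseteq> cball 0 R" using bounded_subset_cball0[OF bd] .
  define V where "V = measure lborel (cball (0::'a) R)"
  have V: "V \<ge> 0" by (simp add: V_def)
  have "\<exists>N. \<forall>m\<ge>N. \<forall>n\<ge>N. mass_form (u m - u n) (u m - u n) < (1/4) ^ k" for k
    using C by simp
  then obtain N where N: "\<And>k m n. m \<ge> N k \<Longrightarrow> n \<ge> N k \<Longrightarrow> mass_form (u m - u n) (u m - u n) < (1/4) ^ k"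
    by metis
  \<comment> \<open>The partial sum dominates \<open>N k\<close>, and adding \<open>k\<close> makes
    the indices strictly increasing.\<close>
  define r where "r k = (\<Sum>j\<le>k. N j) + k" for k
  have r: "strict_mono r" by (rule strict_mono_Suc_iff[THEN iffD2]) (simp add: r_def)
  have rN: "N k \<le> r k" for k
  proof -
    have "N k \<le> (\<Sum>j\<le>k. N j)" by (rule member_le_sum) auto
    then show ?thesis by (simp add: r_def)
  qed
  define d where "d k = u (r (Suc k)) - u (r k)" for k
  have dL: "d k \<in> borel_L2 \<Omega>" for k unfolding d_def by (intro I.mem_simps u)
  have [measurable]: "u k \<in> borel_measurable borel" "d k \<in> borel_measurable borel" for k
    using u dL by (auto simp: borel_L2_def)
  have d1: "(\<integral>\<^sup>+x. ennreal \<bar>d k x\<bar> \<partial>lborel) \<le> ennreal ((V + 1) * (1/2) ^ k)" for k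
  proof -
    have "r k \<le> r (Suc k)" using r by (simp add: strict_mono_less_eq)
    then have "mass_form (d k) (d k) < (1/4) ^ k"
      unfolding d_def using rN[of k] by (intro N) auto
    then have "mass_form (d k) (d k) / (1/2) ^ k \<le> (1/4) ^ k / (1/2) ^ k"
      by (intro divide_right_mono) auto
    also have "\<dots> = (1/2) ^ k" by (simp flip: power_divide)
    finally have "(\<integral>x. \<bar>d k x\<bar> \<partial>lborel) \<le> (V + 1) * (1/2) ^ k"
      using borel_L2_L1_bound[OF dL R, of "(1/2) ^ k" k] by (simp add: V_def algebra_simps)
    then show ?thesis
      using borel_L2_integrable[OF dL bd] by (subst nn_integral_eq_integral) (auto intro: ennreal_leI)
  qed
  have "(\<integral>\<^sup>+x. (\<Sum>k. ennreal \<bar>d k x\<bar>) \<partial>lborel) = (\<Sum>k. \<integral>\<^sup>+x. ennreal \<bar>d k x\<bar> \<partial>lborel)"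
    by (rule nn_integral_suminf) auto
  also have "\<dots> \<le> (\<Sum>k. ennreal ((V + 1) * (1/2) ^ k))"
    by (intro suminf_le d1) auto
  also have "\<dots> = ennreal (\<Sum>k. (V + 1) * (1/2) ^ k)"
    using V by (intro suminf_ennreal2) (auto intro!: summable_mult summable_geometric)
  also have "\<dots> < \<infinity>" by simp
  finally have "AE x in lborel. (\<Sum>k. ennreal \<bar>d k x\<bar>) \<noteq> \<infinity>"
    by (intro nn_integral_noteq_infinite) auto
  then have conv: "AE x in lborel. convergent (\<lambda>n. u (r n) x)"
  proof eventually_elim
    case (elim x)
    then have "summable (\<lambda>k. \<bar>d k x\<bar>)" by (intro summable_suminf_not_top) auto
    then have "summable (\<lambda>k. d k x)" by (rule summable_rabs_cancel)
    then have "convergent (\<lambda>n. \<Sum>k<n. d k x)" by (simp add: summable_iff_convergent)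
    moreover have "(\<Sum>k<n. d k x) = u (r n) x - u (r 0) x" for n
      unfolding d_def by (simp add: sum_lessThan_telescope[of "\<lambda>k. u (r k) x"])
    ultimately have "convergent (\<lambda>n. u (r 0) x + (u (r n) x - u (r 0) x))"
      by (intro convergent_add convergent_const) simp
    then show ?case by simp
  qed
  \<comment> \<open>\<open>lim\<close> is measurable even where the sequence diverges, and outside
    \<Omega> the sequence is constantly 0, so the limit vanishes there everywhere.\<close>
  define v where "v x = lim (\<lambda>n. u (r n) x)" for x
  show thesis
  proof (rule that[OF r, of v])
    show "v \<in> borel_measurable borel" unfolding v_def by measurable
    show "v x = 0" if "x \<notin> \<Omega>" for x
      using u that by (simp add: v_def borel_L2_def)
    show "AE x in lborel. (\<lambda>n. u (r n) x) \<longlonglongrightarrow> v x"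
      using conv by eventually_elim (simp add: v_def convergent_LIMSEQ_iff)
  qed
qed

text \<open>Distances are measured from a fixed \<open>w\<close>. Taking for \<open>w\<close> a
  member of the Cauchy sequence yields in one stroke that the limit belongs to the space and that it
  is approximated; membership of \<open>v\<close> is read off from
  \<open>v = w - (w - v)\<close>.\<close>

lemma borel_L2_limit:
  fixes u :: "nat \<Rightarrow> 'a::euclidean_space \<Rightarrow> real"
  assumes u: "\<And>n. u n \<in> borel_L2 \<Omega>" and v: "v \<in> borel_measurable borel" "\<And>x. x \<notin> \<Omega> \<Longrightarrow> v x = 0"
    and lim: "AE x in lborel. (\<lambda>n. u n x) \<longlonglongrightarrow> v x" and w: "w \<in> borel_L2 \<Omega>"
    and b: "\<And>n. mass_form (w - u n) (w - u n) \<le> c"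
  shows "v \<in> borel_L2 \<Omega>" "mass_form (w - v) (w - v) \<le> c"
proof -
  interpret I: psd_form_on "borel_L2 \<Omega>" mass_form by (rule psd_mass_form)
  have [measurable]: "v \<in> borel_measurable borel" "w \<in> borel_measurable borel" using v w by (auto simp: borel_L2_def)
  have [measurable]: "w - v \<in> borel_measurable borel" unfolding fun_diff_def by measurable
  have dL: "w - u n \<in> borel_L2 \<Omega>" for n by (intro I.mem_simps w u)
  have *: "integrable lborel (\<lambda>x. ((w - v) x)\<^sup>2)" "(\<integral>x. ((w - v) x)\<^sup>2 \<partial>lborel) \<le> c"
  proof (rule_tac [!] Fatou_bound[where f = "\<lambda>n x. ((w - u n) x)\<^sup>2"])
    show "AE x in lborel. (\<lambda>n. ((w - u n) x)\<^sup>2) \<longlonglongrightarrow> ((w - v) x)\<^sup>2"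
      using lim by eventually_elim (auto intro!: tendsto_intros)
    then show "AE x in lborel. (\<lambda>n. ((w - u n) x)\<^sup>2) \<longlonglongrightarrow> ((w - v) x)\<^sup>2" .
  qed (use dL b in \<open>auto simp: borel_L2_def mass_form_def power2_eq_square\<close>)
  then have wv: "w - v \<in> borel_L2 \<Omega>" using v w by (auto simp: borel_L2_def)
  have "w - (w - v) \<in> borel_L2 \<Omega>" by (rule I.mem_simps(3)[OF w wv])
  moreover have "w - (w - v) = v" by (simp add: fun_eq_iff)
  ultimately show "v \<in> borel_L2 \<Omega>" by metis
  show "mass_form (w - v) (w - v) \<le> c" using * by (simp add: mass_form_def power2_eq_square)
qed

text \<open>If \<open>N\<close> is the exceptional null set, the exceptional pairs lie in the union
  of the null strips \<open>N \<times> UNIV\<close> and \<open>UNIV \<times> N\<close>.\<close>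

lemma AE_lborel2_both:
  assumes "AE x in lborel. P (x::'a::euclidean_space)"
  shows "AE p in lborel2. P (fst p) \<and> P (snd p)"
proof -
  from assms obtain N where N: "N \<in> null_sets lborel" "{x. \<not> P x} \<subseteq> N"
    by (auto elim!: AE_E simp: null_sets_def)
  have "(N \<times> UNIV) \<union> (UNIV \<times> N) \<in> null_sets (lborel2 :: ('a \<times> 'a) measure)"
    using N(1) by (intro null_sets.Un) (auto simp: null_sets_def lborel.emeasure_pair_measure_Times)
  then show ?thesis by (rule AE_I') (use N(2) in auto)
qed

lemma borel_H_limit:
  fixes u :: "nat \<Rightarrow> 'a::euclidean_space \<Rightarrow> real"
  assumes u: "\<And>n. u n \<in> borel_H \<Omega>" and v: "v \<in> borel_measurable borel" "\<And>x. x \<notin> \<Omega> \<Longrightarrow> v x = 0"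
    and lim: "AE x in lborel. (\<lambda>n. u n x) \<longlonglongrightarrow> v x" and w: "w \<in> borel_H \<Omega>"
    and b: "\<And>n. near_form (w - u n) (w - u n) \<le> c"
  shows "v \<in> borel_H \<Omega>" "near_form (w - v) (w - v) \<le> c"
proof -
  interpret G: psd_form_on "borel_H \<Omega>" near_form by (rule psd_near_form)
  have [measurable]: "v \<in> borel_measurable borel" "w \<in> borel_measurable borel" using v w by (auto simp: borel_H_def)
  have [measurable]: "w - v \<in> borel_measurable borel" unfolding fun_diff_def by measurable
  define E where "E f = (\<lambda>(x, y). near (x - y) * (f x - f y)\<^sup>2)" for f :: "'a \<Rightarrow> real"
  have dH: "w - u n \<in> borel_H \<Omega>" for n by (intro G.mem_simps w u)
  have GE: "near_form f f = integral\<^sup>L lborel2 (E f)" for f by (simp add: near_form_def E_def power2_eq_square)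
  have lim2: "AE p in lborel2. (\<lambda>n. E (w - u n) p) \<longlonglongrightarrow> E (w - v) p"
    using AE_lborel2_both[OF lim] by eventually_elim (auto simp: E_def case_prod_unfold intro!: tendsto_intros)
  have m: "E (w - v) \<in> borel_measurable lborel2" unfolding E_def minus_apply by measurable
  have i: "integrable lborel2 (E (w - u n))" for n using dH[of n] by (simp add: borel_H_def E_def)
  have nn: "0 \<le> E f p" for f p by (cases p) (simp add: E_def)
  have bb: "integral\<^sup>L lborel2 (E (w - u n)) \<le> c" for n using b[of n] by (simp add: GE)
  note F = Fatou_bound[where f = "\<lambda>n. E (w - u n)", OF i nn bb lim2 m nn]
  have wv: "w - v \<in> borel_H \<Omega>" using v w F(1) by (auto simp: borel_H_def E_def)
  have "w - (w - v) \<in> borel_H \<Omega>" by (rule G.mem_simps(3)[OF w wv])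
  moreover have "w - (w - v) = v" by (simp add: fun_eq_iff)
  ultimately show "v \<in> borel_H \<Omega>" by metis
  show "near_form (w - v) (w - v) \<le> c" using F(2) by (simp add: GE)
qed

section \<open>Density and dimension of the energy space\<close>

text \<open>The squared difference is at most K^2 |x - y|^2, which the second moment of the kernel
  absorbs. A pair contributes only if one point lies in \<Omega> and the other within distance 1, so
  \<open>x\<close> may be confined to the ball of radius \<open>R + 1\<close>.\<close>

lemma Lipschitz_borel_H:
  fixes f :: "'a::euclidean_space \<Rightarrow> real"
  assumes bd: "bounded \<Omega>" and off: "\<And>x. x \<notin> \<Omega> \<Longrightarrow> f x = 0"
    and lip: "\<And>x y. \<bar>f x - f y\<bar> \<le> K * norm (x - y)"
  shows "f \<in> borel_H \<Omega>"
proof -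
  obtain R where R: "\<Omega> \<subseteq> cball 0 R" using bounded_subset_cball0[OF bd] .
  have "continuous_on UNIV f"
  proof (rule continuous_onI)
    fix x e assume "(e::real) > 0"
    then have "\<bar>f y - f x\<bar> \<le> e" if "dist y x < e / (\<bar>K\<bar> + 1)" for y
    proof -
      have "\<bar>f y - f x\<bar> \<le> K * norm (y - x)" by (rule lip)
      also have "\<dots> \<le> (\<bar>K\<bar> + 1) * norm (y - x)" by (intro mult_right_mono) auto
      also have "\<dots> \<le> e" using that by (simp add: dist_norm field_simps pos_less_divide_eq)
      finally show ?thesis .
    qed
    moreover have "e / (\<bar>K\<bar> + 1) > 0" using \<open>e > 0\<close> by (simp add: add_nonneg_pos)
    ultimately show "\<exists>d>0. \<forall>x'\<in>UNIV. dist x' x < d \<longrightarrow> dist (f x') (f x) \<le> e"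
      by (auto simp: dist_real_def)
  qed
  then have [measurable]: "f \<in> borel_measurable borel" by (rule borel_measurable_continuous_onI)
  let ?B = "cball (0::'a) (R + 1)"
  have pt: "near (x - y) * (f x - f y)\<^sup>2 \<le> K\<^sup>2 * (near (x - y) * (norm (x - y))\<^sup>2 * indicator ?B x)" for x y
  proof (cases "(x \<in> \<Omega> \<or> y \<in> \<Omega>) \<and> norm (x - y) \<le> 1")
    case True
    have "norm x \<le> norm y + norm (x - y)" using norm_triangle_sub by blast
    then have "x \<in> ?B" using True R by (auto simp: subset_iff)
    moreover have "(f x - f y)\<^sup>2 \<le> (K * norm (x - y))\<^sup>2"
      using lip[of x y] by (simp add: abs_le_square_iff[symmetric] abs_le_iff)
    then have "near (x - y) * (f x - f y)\<^sup>2 \<le> near (x - y) * (K * norm (x - y))\<^sup>2" by (intro mult_left_mono) auto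
    ultimately show ?thesis by (simp add: power_mult_distrib mult_ac)
  next
    case False
    then have "near (x - y) = 0 \<or> f x - f y = 0" using off by (auto simp: near_def)
    then have "near (x - y) * (f x - f y)\<^sup>2 = 0" by auto
    then show ?thesis by (simp only: zero_le_mult_iff) (simp add: zero_le_mult_iff)
  qed
  have "(\<integral>\<^sup>+p. ennreal (case p of (x, y) \<Rightarrow> near (x - y) * (f x - f y)\<^sup>2) \<partial>lborel2)
    \<le> (\<integral>\<^sup>+(x, y). ennreal (K\<^sup>2 * (near (x - y) * (norm (x - y))\<^sup>2)) * indicator ?B x \<partial>lborel2)"
  proof (rule nn_integral_mono)
    fix p :: "'a \<times> 'a"
    obtain x y where p: "p = (x, y)" by (cases p)
    have "ennreal (near (x - y) * (f x - f y)\<^sup>2) \<le> ennreal (K\<^sup>2 * (near (x - y) * (norm (x - y))\<^sup>2 * indicator ?B x))"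
      using pt by (rule ennreal_leI)
    also have "\<dots> = ennreal (K\<^sup>2 * (near (x - y) * (norm (x - y))\<^sup>2)) * indicator ?B x"
      by (auto simp: indicator_def)
    finally show "ennreal (case p of (x, y) \<Rightarrow> near (x - y) * (f x - f y)\<^sup>2)
      \<le> (case p of (x, y) \<Rightarrow> ennreal (K\<^sup>2 * (near (x - y) * (norm (x - y))\<^sup>2)) * indicator ?B x)"
      by (simp add: p)
  qed
  also have "\<dots> = (\<integral>\<^sup>+z. ennreal (K\<^sup>2 * (near (z::'a) * (norm z)\<^sup>2)) \<partial>lborel) * (\<integral>\<^sup>+x. indicator ?B x \<partial>lborel)"
    by (rule nn_integral_convolution_kernel) measurable
  also have "(\<integral>\<^sup>+z. ennreal (K\<^sup>2 * (near (z::'a) * (norm z)\<^sup>2)) \<partial>lborel) = ennreal (K\<^sup>2) * (\<integral>\<^sup>+z. ennreal (near (z::'a) * (norm z)\<^sup>2) \<partial>lborel)"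
    by (subst ennreal_mult) (auto simp: nn_integral_cmult)
  also have "\<dots> * (\<integral>\<^sup>+x. indicator ?B x \<partial>lborel) < \<infinity>"
    using nn_integral_near_norm_square emeasure_bounded_finite[OF bounded_cball, of "0::'a" "R + 1"]
    by (auto simp: ennreal_mult_less_top less_top)
  finally have "integrable lborel2 (\<lambda>(x, y). near (x - y) * (f x - f y)\<^sup>2)"
    by (subst integrable_iff_nn_integral) auto
  then show ?thesis using off by (auto simp: borel_H_def)
qed

lemma mass_form_pos_of_continuous:
  fixes f :: "'a::euclidean_space \<Rightarrow> real"
  assumes f: "f \<in> borel_L2 \<Omega>" and c: "continuous_on UNIV f" and x: "f x \<noteq> 0"
  shows "mass_form f f > 0"
proof (rule ccontr)
  assume "\<not> ?thesis"
  moreover have "mass_form f f \<ge> 0" by (auto simp: mass_form_def intro!: integral_nonneg_AE)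
  ultimately have "mass_form f f = 0" by linarith
  then have "(\<integral>x. (f x)\<^sup>2 \<partial>lborel) = 0" by (simp add: mass_form_def power2_eq_square)
  then have "AE x in lborel. (f x)\<^sup>2 = 0"
    using f by (subst (asm) integral_nonneg_eq_0_iff_AE) (auto simp: borel_L2_def)
  moreover have "open {x. f x \<noteq> 0}"
    using c by (intro open_Collect_neq continuous_on_const)
  ultimately show False
    using AE_lborel_open_witness[of "\<lambda>x. (f x)\<^sup>2 = 0" "{x. f x \<noteq> 0}"] x by auto
qed

lemma compl_bounded_nonempty: "bounded (\<Omega> :: 'a::euclidean_space set) \<Longrightarrow> - \<Omega> \<noteq> {}"
  using not_bounded_UNIV by (metis double_complement Compl_empty_eq)

lemma borel_H_infinite_dim:
  fixes \<Omega> :: "'a::euclidean_space set"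
  assumes op: "open \<Omega>" and ne: "\<Omega> \<noteq> {}" and bd: "bounded \<Omega>"
  shows "\<exists>e. (\<forall>i<n::nat. e i \<in> borel_H \<Omega>) \<and> (\<forall>i<n. \<forall>j<n. mass_form (e i) (e j) = (if i = j then 1 else 0))"
proof -
  interpret I: psd_form_on "borel_L2 \<Omega>" mass_form by (rule psd_mass_form)
  have "infinite \<Omega>" using op ne finite_imp_not_open by blast
  then obtain T where T: "finite T" "card T = n" "T \<subseteq> \<Omega>" by (metis infinite_arbitrarily_large)
  then obtain h where h: "bij_betw h {..<n} T"
    using ex_bij_betw_nat_finite[OF T(1)] by (auto simp: atLeast0LessThan)
  define C where "C x = - \<Omega> \<union> (T - {x})" for x
  \<comment> \<open>\<open>f x\<close> lives on the points closer to \<open>x\<close> than to the rest of \<open>T\<close>, so the supports are disjoint.\<close>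
  define f where "f x z = max 0 (infdist z (C x) - dist z x)" for x z
  have cne: "C x \<noteq> {}" for x using compl_bounded_nonempty[OF bd] by (auto simp: C_def)
  have lip: "\<bar>f x y - f x z\<bar> \<le> 2 * norm (y - z)" for x y z
  proof -
    have "\<bar>infdist y (C x) - infdist z (C x)\<bar> \<le> dist y z" by (rule infdist_triangle_abs)
    moreover have "\<bar>dist y x - dist z x\<bar> \<le> dist y z"
      using dist_triangle[of y x z] dist_triangle[of z x y] dist_commute[of y z] by linarith
    ultimately show ?thesis by (auto simp: f_def dist_norm max_def)
  qed
  have off: "f x z = 0" if "z \<notin> \<Omega>" for x z
    using that by (simp add: f_def C_def)
  have fH: "f x \<in> borel_H \<Omega>" for x by (rule Lipschitz_borel_H[OF bd off lip])
  have cont: "continuous_on UNIV (f x)" for x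
    unfolding f_def by (intro continuous_intros)
  \<comment> \<open>If both values were positive, \<open>z\<close> would be strictly closer to
    \<open>x\<close> than to \<open>y\<close> and strictly closer to \<open>y\<close> than to
    \<open>x\<close>.\<close>
  have disj: "f x z * f y z = 0" if "x \<in> T" "y \<in> T" "x \<noteq> y" for x y z
  proof -
    have "infdist z (C x) \<le> dist z y" "infdist z (C y) \<le> dist z x"
      using that by (auto simp: C_def intro!: infdist_le)
    then have "f x z = 0 \<or> f y z = 0" by (auto simp: f_def max_def)
    then show ?thesis by auto
  qed
  have pos: "f x x \<noteq> 0" if "x \<in> T" for x
  proof -
    have "closed (C x)" unfolding C_def
      by (intro closed_Un closed_Compl op finite_imp_closed finite_Diff T(1))
    moreover have "x \<notin> C x" using that T by (auto simp: C_def)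
    ultimately have "infdist x (C x) > 0" using infdist_pos_not_in_closed[OF _ cne] by simp
    then show ?thesis by (simp add: f_def)
  qed
  have fL: "f x \<in> borel_L2 \<Omega>" for x using fH borel_H_subset_borel_L2[OF bd] by auto
  have Ipos: "mass_form (f x) (f x) > 0" if "x \<in> T" for x
    using mass_form_pos_of_continuous[OF fL cont pos[OF that]] .
  define e where "e i = (1 / sqrt (mass_form (f (h i)) (f (h i)))) *\<^sub>R f (h i)" for i
  have hT: "h i \<in> T" if "i < n" for i using h that by (auto simp: bij_betw_def)
  have hinj: "h i \<noteq> h j" if "i < n" "j < n" "i \<noteq> j" for i j
    using h that by (auto simp: bij_betw_def inj_on_def)
  have "e i \<in> borel_H \<Omega>" for i
    unfolding e_def by (intro subspace_scale[OF subspace_borel_H] fH)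
  moreover have "mass_form (e i) (e j) = (if i = j then 1 else 0)" if "i < n" "j < n" for i j
  proof (cases "i = j")
    case True
    then show ?thesis using Ipos[OF hT[OF that(1)]] fL
      by (simp add: e_def I.square_scale power_divide)
  next
    case False
    have "mass_form (f (h i)) (f (h j)) = 0"
      unfolding mass_form_def disj[OF hT[OF that(1)] hT[OF that(2)] hinj[OF that False]] by simp
    then show ?thesis using False fL by (simp add: e_def I.scale_left I.scale_right)
  qed
  ultimately show ?thesis by blast
qed

text \<open>The indicator of an open set is the pointwise limit of the Lipschitz cutoffs
  \<open>min 1 (m * infdist x (- U))\<close>, which lie in the energy space; |r| dominates the
  products.\<close>

lemma orthogonal_integral_open:
  fixes r :: "'a::euclidean_space \<Rightarrow> real"
  assumes bd: "bounded \<Omega>" and r: "r \<in> borel_L2 \<Omega>" and orth: "\<And>\<phi>. \<phi> \<in> borel_H \<Omega> \<Longrightarrow> mass_form r \<phi> = 0"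
    and U: "open U" "U \<subseteq> \<Omega>"
  shows "mass_form r (indicator U) = 0"
proof -
  define f where "f m x = min 1 (real m * infdist x (- U))" for m and x :: 'a
  have Une: "- U \<noteq> {}" using compl_bounded_nonempty[OF bd] U by auto
  have r1: "integrable lborel r" by (rule borel_L2_integrable[OF r bd])
  have [measurable]: "r \<in> borel_measurable borel" "U \<in> sets borel" using r U by (auto simp: borel_L2_def)
  have fH: "f m \<in> borel_H \<Omega>" for m
  proof (rule Lipschitz_borel_H[OF bd])
    show "f m x = 0" if "x \<notin> \<Omega>" for x
    proof -
      have "x \<in> - U" using that U by auto
      then show ?thesis by (simp add: f_def)
    qed
    fix x y
    have "\<bar>real m * infdist x (- U) - real m * infdist y (- U)\<bar> \<le> real m * norm (x - y)"
      using mult_left_mono[OF infdist_triangle_abs[of x "- U" y], of "real m"]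
      by (simp add: abs_mult dist_norm flip: right_diff_distrib)
    then show "\<bar>f m x - f m y\<bar> \<le> real m * norm (x - y)" by (auto simp: f_def min_def)
  qed
  have [measurable]: "f m \<in> borel_measurable borel" for m using fH by (simp add: borel_H_def)
  have "(\<lambda>m. \<integral>x. r x * f m x \<partial>lborel) \<longlonglongrightarrow> (\<integral>x. r x * indicator U x \<partial>lborel)"
  proof (rule integral_dominated_convergence[where w = "\<lambda>x. \<bar>r x\<bar>"])
    show "AE x in lborel. (\<lambda>m. r x * f m x) \<longlonglongrightarrow> r x * indicator U x"
    proof (intro AE_I2 tendsto_mult tendsto_const)
      fix x
      show "(\<lambda>m. f m x) \<longlonglongrightarrow> indicator U x"
      proof (cases "x \<in> U")
        case True
        then have pos: "infdist x (- U) > 0" using U Une by (intro infdist_pos_not_in_closed) auto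
        obtain M :: nat where M: "1 / infdist x (- U) < M" using reals_Archimedean2 by blast
        have "f m x = 1" if "m \<ge> M" for m
        proof -
          have "1 / infdist x (- U) < m" using M that by simp
          then show ?thesis using pos by (simp add: f_def field_simps)
        qed
        then have "eventually (\<lambda>m. f m x = 1) sequentially" by (auto simp: eventually_sequentially)
        then show ?thesis using True by (simp add: tendsto_eventually)
      qed (simp add: f_def)
    qed
    show "AE x in lborel. norm (r x * f m x) \<le> \<bar>r x\<bar>" for m
      by (intro AE_I2) (auto simp: abs_mult f_def infdist_nonneg intro!: mult_right_le_one_le)
  qed (use r1 in auto)
  moreover have "(\<integral>x. r x * f m x \<partial>lborel) = 0" for m using orth[OF fH] by (simp add: mass_form_def)
  ultimately show ?thesis by (simp add: mass_form_def LIMSEQ_const_iff)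
qed

text \<open>Outer regularity encloses the positivity set \<open>A\<close> of \<open>r\<close> in an
  open set with small excess \<open>S\<close>. The integral over the open set vanishes and
  Cauchy-Schwarz controls the one over \<open>S\<close>, so the integral of \<open>r\<close> over
  \<open>A\<close> is 0.\<close>

lemma orthogonal_AE_nonpos:
  fixes r :: "'a::euclidean_space \<Rightarrow> real"
  assumes op: "open \<Omega>" and bd: "bounded \<Omega>" and r: "r \<in> borel_L2 \<Omega>" and orth: "\<And>\<phi>. \<phi> \<in> borel_H \<Omega> \<Longrightarrow> mass_form r \<phi> = 0"
  shows "AE x in lborel. r x \<le> 0"
proof -
  interpret I: psd_form_on "borel_L2 \<Omega>" mass_form by (rule psd_mass_form)
  have r1: "integrable lborel r" by (rule borel_L2_integrable[OF r bd])
  have [measurable]: "r \<in> borel_measurable borel" "\<Omega> \<in> sets borel" using r op by (auto simp: borel_L2_def)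
  define A where "A = {x \<in> \<Omega>. r x > 0}"
  have A [measurable]: "A \<in> sets borel" unfolding A_def by measurable
  have ind: "(indicator S :: 'a \<Rightarrow> real) \<in> borel_L2 \<Omega>" "mass_form (indicator S) (indicator S :: 'a \<Rightarrow> real) = measure lborel S"
    if S: "S \<in> sets borel" "S \<subseteq> \<Omega>" for S
  proof -
    have "bounded S" using S bd bounded_subset by blast
    then have "emeasure lborel S < \<infinity>" by (rule emeasure_bounded_finite)
    then have "integrable lborel (indicator S :: 'a \<Rightarrow> real)" using S by (intro integrable_real_indicator) auto
    moreover have sq: "(\<lambda>x. (indicator S x :: real)\<^sup>2) = indicator S" by (auto simp: indicator_def)
    ultimately show "(indicator S :: 'a \<Rightarrow> real) \<in> borel_L2 \<Omega>" using S by (auto simp: borel_L2_def indicator_def)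
    show "mass_form (indicator S) (indicator S :: 'a \<Rightarrow> real) = measure lborel S"
      using S by (simp add: mass_form_def flip: power2_eq_square) (simp add: sq)
  qed
  have small: "(mass_form r (indicator A))\<^sup>2 \<le> mass_form r r * \<epsilon>" if \<epsilon>: "\<epsilon> > 0" for \<epsilon>
  proof -
    obtain U where U: "open U" "A \<subseteq> U" "emeasure lebesgue (U - A) < ennreal \<epsilon>"
      using sets_lebesgue_outer_open[of A \<epsilon>] A \<epsilon> by auto
    define S where "S = (U \<inter> \<Omega>) - A"
    have [measurable]: "U \<in> sets borel" using U by simp
    have S: "S \<in> sets borel" "S \<subseteq> \<Omega>" unfolding S_def by auto
    have "emeasure lborel S \<le> emeasure lborel (U - A)" by (rule emeasure_mono) (auto simp: S_def)
    also have "\<dots> < ennreal \<epsilon>" using U(3) by simp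
    finally have mS: "measure lborel S \<le> \<epsilon>"
      using \<epsilon> by (simp add: measure_def enn2real_leI less_imp_le)
    have "indicator (U \<inter> \<Omega>) = indicator A + (indicator S :: 'a \<Rightarrow> real)"
      using U(2) by (auto simp: fun_eq_iff indicator_def S_def A_def)
    then have "mass_form r (indicator A + indicator S) = 0"
      using orthogonal_integral_open[OF bd r orth, of "U \<inter> \<Omega>"] U op by (simp add: open_Int)
    moreover have "mass_form r (indicator A + indicator S) = mass_form r (indicator A) + mass_form r (indicator S)"
      using ind(1)[OF A] ind(1)[OF S] r by (intro I.add_right) (auto simp: A_def)
    ultimately have "(mass_form r (indicator A))\<^sup>2 = (mass_form r (indicator S))\<^sup>2"
      by (metis add_eq_0_iff power2_minus)
    also have "\<dots> \<le> mass_form r r * mass_form (indicator S) (indicator S)"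
      by (rule I.Cauchy_Schwarz[OF r ind(1)[OF S]])
    also have "\<dots> \<le> mass_form r r * \<epsilon>"
      using mS I.nonneg[OF r] by (simp add: ind(2)[OF S] mult_left_mono)
    finally show ?thesis .
  qed
  have "(mass_form r (indicator A))\<^sup>2 \<le> 0"
  proof (rule field_le_epsilon)
    fix e :: real assume e: "e > 0"
    have "(mass_form r (indicator A))\<^sup>2 \<le> mass_form r r * (e / (mass_form r r + 1))"
      using e I.nonneg[OF r] by (intro small) (auto intro!: divide_pos_pos)
    also have "\<dots> \<le> e" using e I.nonneg[OF r] by (simp add: field_simps)
    finally show "(mass_form r (indicator A))\<^sup>2 \<le> 0 + e" by simp
  qed
  then have "(\<integral>x. r x * indicator A x \<partial>lborel) = 0" by (simp add: mass_form_def)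
  moreover have "integrable lborel (\<lambda>x. r x * indicator A x)"
    using r1 by (intro integrable_real_mult_indicator) auto
  ultimately have "AE x in lborel. r x * indicator A x = 0"
    by (subst (asm) integral_nonneg_eq_0_iff_AE) (auto simp: A_def indicator_def)
  then show ?thesis
  proof eventually_elim
    case (elim x)
    show ?case
    proof (cases "x \<in> \<Omega>")
      case True
      then show ?thesis using elim by (auto simp: A_def indicator_def split: if_splits)
    qed (use r in \<open>simp add: borel_L2_def\<close>)
  qed
qed

lemma borel_H_dense:
  fixes r :: "'a::euclidean_space \<Rightarrow> real"
  assumes op: "open \<Omega>" and bd: "bounded \<Omega>" and r: "r \<in> borel_L2 \<Omega>" and orth: "\<And>\<phi>. \<phi> \<in> borel_H \<Omega> \<Longrightarrow> mass_form r \<phi> = 0"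
  shows "mass_form r r = 0"
proof -
  interpret I: psd_form_on "borel_L2 \<Omega>" mass_form by (rule psd_mass_form)
  have "AE x in lborel. r x \<le> 0" by (rule orthogonal_AE_nonpos[OF op bd r orth])
  moreover have "AE x in lborel. ((-1) *\<^sub>R r) x \<le> 0"
  proof (rule orthogonal_AE_nonpos[OF op bd])
    show "(-1) *\<^sub>R r \<in> borel_L2 \<Omega>" using r by (intro I.mem_simps)
    show "mass_form ((-1) *\<^sub>R r) \<phi> = 0" if "\<phi> \<in> borel_H \<Omega>" for \<phi>
      using r that orth[OF that] borel_H_subset_borel_L2[OF bd] by (subst I.scale_left) auto
  qed
  ultimately have "AE x in lborel. r x * r x = 0" by eventually_elim auto
  then show ?thesis unfolding mass_form_def by (rule integral_eq_zero_AE)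
qed

text \<open>The two-sided comparison of shifted energy with \<open>near_form\<close> and
  \<open>mass_form\<close> translates each abstract requirement into a fact about these two forms
  separately.\<close>

lemma log_spectral_problem:
  fixes \<Omega> :: "'a::euclidean_space set"
  assumes op: "open \<Omega>" and ne: "\<Omega> \<noteq> {}" and bd: "bounded \<Omega>"
  shows "\<exists>C. spectral_problem (borel_L2 \<Omega>) (borel_H \<Omega>) mass_form energy_form C"
proof -
  interpret I: psd_form_on "borel_L2 \<Omega>" mass_form by (rule psd_mass_form)
  interpret G: psd_form_on "borel_H \<Omega>" near_form by (rule psd_near_form)
  interpret Q: sym_form_on "borel_H \<Omega>" energy_form by (rule sym_energy_form[OF bd])
  define c where "c = log_const DIM('a)"
  have c: "c > 0" unfolding c_def by (rule log_const_pos)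
  obtain C where lo: "\<And>u. u \<in> borel_H \<Omega> \<Longrightarrow> c / 2 * near_form u u + mass_form u u \<le> energy_form u u + C * mass_form u u"
    and hi: "\<And>u. u \<in> borel_H \<Omega> \<Longrightarrow> energy_form u u + C * mass_form u u \<le> c / 2 * near_form u u + 2 * C * mass_form u u" and C: "C > 0"
    using coercive_energy_form[OF bd] unfolding c_def by metis
  note HL = borel_H_subset_borel_L2[OF bd, THEN subsetD]
  have I_le: "mass_form u u \<le> energy_form u u + C * mass_form u u" if "u \<in> borel_H \<Omega>" for u
  proof -
    have "0 \<le> c / 2 * near_form u u" using c G.nonneg[OF that] by simp
    then show ?thesis using lo[OF that] by linarith
  qed
  have G_le: "near_form u u \<le> 2 / c * (energy_form u u + C * mass_form u u)" if "u \<in> borel_H \<Omega>" for u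
  proof -
    have "c / 2 * near_form u u \<le> energy_form u u + C * mass_form u u" using lo[OF that] I.nonneg[OF HL[OF that]] by linarith
    then show ?thesis using c by (simp add: field_simps)
  qed
  show ?thesis
  proof (rule exI[of _ C], unfold_locales)
    show "borel_H \<Omega> \<subseteq> borel_L2 \<Omega>" by (rule borel_H_subset_borel_L2[OF bd])
    show "mass_form u u \<le> energy_form u u + C * mass_form u u" if "u \<in> borel_H \<Omega>" for u by (rule I_le[OF that])
  next
    fix u :: "nat \<Rightarrow> 'a \<Rightarrow> real" and M
    assume u: "\<And>n. u n \<in> borel_H \<Omega>" and M: "\<And>n. energy_form (u n) (u n) + C * mass_form (u n) (u n) \<le> M"
    show "\<exists>r. strict_mono (r::nat\<Rightarrow>nat) \<and> (\<forall>e>0. \<exists>N. \<forall>m\<ge>N. \<forall>n\<ge>N. mass_form (u (r m) - u (r n)) (u (r m) - u (r n)) < e)"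
    proof (rule borel_H_compact_embedding[OF bd u])
      fix n
      have "2 / c * (energy_form (u n) (u n) + C * mass_form (u n) (u n)) \<le> 2 / c * M"
        using M c by (intro mult_left_mono) auto
      then show "near_form (u n) (u n) \<le> max M (2 / c * M)" using G_le[OF u, of n] by linarith
      show "mass_form (u n) (u n) \<le> max M (2 / c * M)" using I_le[OF u, of n] M[of n] by linarith
    qed
  next
    fix u :: "nat \<Rightarrow> 'a \<Rightarrow> real"
    assume u: "\<And>n. u n \<in> borel_H \<Omega>" and Cau: "\<forall>e>0. \<exists>N. \<forall>m\<ge>N. \<forall>n\<ge>N. energy_form (u m - u n) (u m - u n) + C * mass_form (u m - u n) (u m - u n) < e"
    have uL: "u n \<in> borel_L2 \<Omega>" for n using HL[OF u] .
    have dH: "u m - u n \<in> borel_H \<Omega>" for m n by (rule G.mem_simps(3)[OF u u])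
    have "\<forall>e>0. \<exists>N. \<forall>m\<ge>N. \<forall>n\<ge>N. mass_form (u m - u n) (u m - u n) < e"
      using Cau I_le[OF dH] by (meson le_less_trans)
    then obtain r v where r: "strict_mono (r :: nat \<Rightarrow> nat)" and v: "v \<in> borel_measurable borel" "\<And>x. x \<notin> \<Omega> \<Longrightarrow> v x = 0"
      and lim: "AE x in lborel. (\<lambda>n. u (r n) x) \<longlonglongrightarrow> v x"
      by (rule L2_Cauchy_AE_subseq[OF bd uL]) blast
    have lim': "AE x in lborel. (\<lambda>n. u (r (n + N)) x) \<longlonglongrightarrow> v x" for N
      using lim by eventually_elim (rule LIMSEQ_ignore_initial_segment)
    \<comment> \<open>Fatou's lemma is applied to \<open>u m\<close> minus the tail of the
      subsequence: \<open>near_form\<close> stays below \<open>2 / c * e\<close> and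
      \<open>mass_form\<close> below \<open>e\<close>, and the upper comparison combines them into
      \<open>(1 + 2 * C) * e\<close>.\<close>
    have key: "v \<in> borel_H \<Omega> \<and> energy_form (u m - v) (u m - v) + C * mass_form (u m - v) (u m - v) \<le> (1 + 2 * C) * e"
      if N: "\<forall>m\<ge>N. \<forall>n\<ge>N. energy_form (u m - u n) (u m - u n) + C * mass_form (u m - u n) (u m - u n) < e" and m: "m \<ge> N" for e N m
    proof -
      have "r (n + N) \<ge> N" for n using seq_suble[OF r, of "n + N"] by linarith
      then have b: "energy_form (u m - u (r (n + N))) (u m - u (r (n + N))) + C * mass_form (u m - u (r (n + N))) (u m - u (r (n + N))) \<le> e" for n
        using N m by (meson less_imp_le)
      have bG: "near_form (u m - u (r (n + N))) (u m - u (r (n + N))) \<le> 2 / c * e" for n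
        using G_le[OF dH, of m "r (n + N)"] mult_left_mono[OF b[of n], of "2 / c"] c by simp
      have bI: "mass_form (u m - u (r (n + N))) (u m - u (r (n + N))) \<le> e" for n
        using I_le[OF dH, of m "r (n + N)"] b[of n] by linarith
      have vH: "v \<in> borel_H \<Omega>" and Gv: "near_form (u m - v) (u m - v) \<le> 2 / c * e"
        using borel_H_limit[OF u v lim' u bG] by auto
      have Iv: "mass_form (u m - v) (u m - v) \<le> e"
        using borel_L2_limit[OF uL v lim' uL bI] by auto
      have "c / 2 * near_form (u m - v) (u m - v) \<le> e" using Gv c by (simp add: field_simps)
      moreover have "2 * C * mass_form (u m - v) (u m - v) \<le> 2 * C * e" using Iv C by (intro mult_left_mono) auto
      ultimately show ?thesis using hi[OF G.mem_simps(3)[OF u vH], of m] vH by (simp add: algebra_simps)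
    qed
    have vH: "v \<in> borel_H \<Omega>" using Cau[rule_format, of 1] key by (metis le_refl zero_less_one)
    have "(\<lambda>n. energy_form (u n - v) (u n - v) + C * mass_form (u n - v) (u n - v)) \<longlonglongrightarrow> 0"
    proof (rule LIMSEQ_I)
      fix e :: real assume e: "e > 0"
      define e' where "e' = e / (2 * (1 + 2 * C))"
      have e': "e' > 0" "(1 + 2 * C) * e' = e / 2" using e C by (auto simp: e'_def field_simps add_pos_pos)
      obtain N where N: "\<forall>m\<ge>N. \<forall>n\<ge>N. energy_form (u m - u n) (u m - u n) + C * mass_form (u m - u n) (u m - u n) < e'"
        using Cau e'(1) by blast
      have "norm (energy_form (u m - v) (u m - v) + C * mass_form (u m - v) (u m - v) - 0) < e" if "m \<ge> N" for m
      proof -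
        have "0 \<le> mass_form (u m - v) (u m - v)" using uL HL[OF vH] by (intro I.nonneg I.mem_simps(3))
        then have "0 \<le> energy_form (u m - v) (u m - v) + C * mass_form (u m - v) (u m - v)"
          using I_le[OF G.mem_simps(3)[OF u vH], of m] by linarith
        then show ?thesis using key[OF N that] e' e by simp
      qed
      then show "\<exists>N. \<forall>m\<ge>N. norm (energy_form (u m - v) (u m - v) + C * mass_form (u m - v) (u m - v) - 0) < e" by blast
    qed
    then show "\<exists>v\<in>borel_H \<Omega>. (\<lambda>n. energy_form (u n - v) (u n - v) + C * mass_form (u n - v) (u n - v)) \<longlonglongrightarrow> 0"
      using vH by blast
  next
    fix u :: "nat \<Rightarrow> 'a \<Rightarrow> real"
    assume u: "\<And>n. u n \<in> borel_L2 \<Omega>" and Cau: "\<forall>e>0. \<exists>N. \<forall>m\<ge>N. \<forall>n\<ge>N. mass_form (u m - u n) (u m - u n) < e"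
    obtain r v where r: "strict_mono (r :: nat \<Rightarrow> nat)" and v: "v \<in> borel_measurable borel" "\<And>x. x \<notin> \<Omega> \<Longrightarrow> v x = 0"
      and lim: "AE x in lborel. (\<lambda>n. u (r n) x) \<longlonglongrightarrow> v x"
      by (rule L2_Cauchy_AE_subseq[OF bd u Cau]) blast
    have lim': "AE x in lborel. (\<lambda>n. u (r (n + N)) x) \<longlonglongrightarrow> v x" for N
      using lim by eventually_elim (rule LIMSEQ_ignore_initial_segment)
    have key: "v \<in> borel_L2 \<Omega> \<and> mass_form (u m - v) (u m - v) \<le> e"
      if N: "\<forall>m\<ge>N. \<forall>n\<ge>N. mass_form (u m - u n) (u m - u n) < e" and m: "m \<ge> N" for e N m
    proof -
      have "r (n + N) \<ge> N" for n using seq_suble[OF r, of "n + N"] by linarith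
      then have b: "mass_form (u m - u (r (n + N))) (u m - u (r (n + N))) \<le> e" for n
        using N m by (meson less_imp_le)
      show ?thesis using borel_L2_limit[OF u v lim' u b] by auto
    qed
    have vL: "v \<in> borel_L2 \<Omega>" using Cau[rule_format, of 1] key by (metis le_refl zero_less_one)
    have "(\<lambda>n. mass_form (u n - v) (u n - v)) \<longlonglongrightarrow> 0"
    proof (rule LIMSEQ_I)
      fix e :: real assume e: "e > 0"
      obtain N where N: "\<forall>m\<ge>N. \<forall>n\<ge>N. mass_form (u m - u n) (u m - u n) < e / 2"
        using Cau half_gt_zero[OF e] by blast
      have "norm (mass_form (u m - v) (u m - v) - 0) < e" if "m \<ge> N" for m
        using key[OF N that] e I.nonneg[OF I.mem_simps(3)[OF u vL], of m] by simp
      then show "\<exists>N. \<forall>m\<ge>N. norm (mass_form (u m - v) (u m - v) - 0) < e" by blast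
    qed
    then show "\<exists>v\<in>borel_L2 \<Omega>. (\<lambda>n. mass_form (u n - v) (u n - v)) \<longlonglongrightarrow> 0" using vL by blast
  next
    show "mass_form r r = 0" if "r \<in> borel_L2 \<Omega>" "\<And>\<phi>. \<phi> \<in> borel_H \<Omega> \<Longrightarrow> mass_form r \<phi> = 0" for r
      by (rule borel_H_dense[OF op bd that])
    show "\<exists>e. (\<forall>i<n. e i \<in> borel_H \<Omega>) \<and> (\<forall>i<n. \<forall>j<n. mass_form (e i) (e j) = (if i = j then 1 else 0))" for n :: nat
      by (rule borel_H_infinite_dim[OF op ne bd])
  qed
qed

section \<open>Positivity of the first eigenfunction\<close>

lemma abs_diff_abs_square_le: "(\<bar>a\<bar> - \<bar>b\<bar>)\<^sup>2 \<le> (a - b)\<^sup>2" for a b :: real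
  using abs_le_square_iff[of "\<bar>a\<bar> - \<bar>b\<bar>" "a - b"] by (simp add: abs_triangle_ineq3)

lemma borel_H_abs:
  assumes u: "u \<in> borel_H \<Omega>"
  shows "(\<lambda>x. \<bar>u x\<bar>) \<in> borel_H \<Omega>" "near_form (\<lambda>x. \<bar>u x\<bar>) (\<lambda>x. \<bar>u x\<bar>) \<le> near_form u u"
proof -
  have [measurable]: "u \<in> borel_measurable borel" using u by (simp add: borel_H_def)
  have i: "integrable lborel2 (\<lambda>(x, y). near (x - y) * (u x - u y)\<^sup>2)" using u by (simp add: borel_H_def)
  have le: "near (x - y) * (\<bar>u x\<bar> - \<bar>u y\<bar>)\<^sup>2 \<le> near (x - y) * (u x - u y)\<^sup>2" for x y
    by (intro mult_left_mono abs_diff_abs_square_le) simp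
  have ia: "integrable lborel2 (\<lambda>(x, y). near (x - y) * (\<bar>u x\<bar> - \<bar>u y\<bar>)\<^sup>2)"
  proof (rule Bochner_Integration.integrable_bound[OF i])
    show "AE p in lborel2. norm (case p of (x, y) \<Rightarrow> near (x - y) * (\<bar>u x\<bar> - \<bar>u y\<bar>)\<^sup>2)
        \<le> norm (case p of (x, y) \<Rightarrow> near (x - y) * (u x - u y)\<^sup>2)"
      by (intro AE_I2) (use le in \<open>auto split: prod.splits\<close>)
  qed measurable
  then show "(\<lambda>x. \<bar>u x\<bar>) \<in> borel_H \<Omega>" using u by (simp add: borel_H_def)
  show "near_form (\<lambda>x. \<bar>u x\<bar>) (\<lambda>x. \<bar>u x\<bar>) \<le> near_form u u"
    unfolding near_form_def power2_eq_square[symmetric] using le by (intro integral_mono i ia) auto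
qed

lemma borel_H_pos_part:
  assumes u: "u \<in> borel_H \<Omega>"
  shows "(\<lambda>x. max 0 (u x)) \<in> borel_H \<Omega>"
proof -
  have "(1/2) *\<^sub>R (u + (\<lambda>x. \<bar>u x\<bar>)) \<in> borel_H \<Omega>"
    by (intro subspace_scale[OF subspace_borel_H] subspace_add[OF subspace_borel_H] u borel_H_abs(1))
  also have "(1/2) *\<^sub>R (u + (\<lambda>x. \<bar>u x\<bar>)) = (\<lambda>x. max 0 (u x))"
    by (auto simp: fun_eq_iff max_def)
  finally show ?thesis .
qed

text \<open>The near part decreases because the absolute value is 1-Lipschitz; the far part
  increases but enters with a negative sign; the \<open>L^2\<close> part is unchanged.\<close>

lemma energy_form_abs_le:
  fixes u :: "'a::euclidean_space \<Rightarrow> real"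
  assumes u: "u \<in> borel_H \<Omega>" and bd: "bounded \<Omega>"
  shows "energy_form (\<lambda>x. \<bar>u x\<bar>) (\<lambda>x. \<bar>u x\<bar>) \<le> energy_form u u"
proof -
  have uL: "u \<in> borel_L2 \<Omega>" and aL: "(\<lambda>x. \<bar>u x\<bar>) \<in> borel_L2 \<Omega>"
    using u borel_H_abs(1)[OF u] borel_H_subset_borel_L2[OF bd] by auto
  have "far_form u u \<le> far_form (\<lambda>x. \<bar>u x\<bar>) (\<lambda>x. \<bar>u x\<bar>)"
    unfolding far_form_def
  proof (rule integral_mono[OF far_form_integrable[OF uL uL bd] far_form_integrable[OF aL aL bd]])
    show "(case p of (x, y) \<Rightarrow> far (x - y) * (u x * u y)) \<le> (case p of (x, y) \<Rightarrow> far (x - y) * (\<bar>u x\<bar> * \<bar>u y\<bar>))" for p :: "'a \<times> 'a"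
      by (cases p) (auto intro!: mult_left_mono simp flip: abs_mult)
  qed
  then have "log_const DIM('a) * far_form u u \<le> log_const DIM('a) * far_form (\<lambda>x. \<bar>u x\<bar>) (\<lambda>x. \<bar>u x\<bar>)"
    using log_const_pos[where 'a='a] by (intro mult_left_mono) auto
  moreover have "log_const DIM('a) / 2 * near_form (\<lambda>x. \<bar>u x\<bar>) (\<lambda>x. \<bar>u x\<bar>) \<le> log_const DIM('a) / 2 * near_form u u"
    using log_const_pos[where 'a='a] borel_H_abs(2)[OF u] by (intro mult_left_mono) auto
  moreover have "mass_form (\<lambda>x. \<bar>u x\<bar>) (\<lambda>x. \<bar>u x\<bar>) = mass_form u u" by (simp add: mass_form_def)
  ultimately show ?thesis unfolding energy_form_def by simp
qed

text \<open>The bound is free of \<open>n\<close>: for \<open>b \<le> a\<close> the penalty at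
  \<open>a\<close> is the larger one, so the difference of positive parts is at most |c - d|. This
  gives an integrable upper bound for all test functions at once.\<close>

lemma pos_part_product_le:
  fixes a b c d n :: real
  assumes n: "n \<ge> 0"
  shows "(a - b) * (max 0 (c - n * a) - max 0 (d - n * b)) \<le> \<bar>a - b\<bar> * \<bar>c - d\<bar>"
proof -
  have *: "(a - b) * (max 0 (c - n * a) - max 0 (d - n * b)) \<le> \<bar>a - b\<bar> * \<bar>c - d\<bar>" if "b \<le> a" for a b c d :: real
  proof -
    have "n * b \<le> n * a" using that n by (intro mult_left_mono)
    then have "max 0 (c - n * a) - max 0 (d - n * b) \<le> \<bar>c - d\<bar>" by (simp add: max_def abs_if)
    then have "(a - b) * (max 0 (c - n * a) - max 0 (d - n * b)) \<le> (a - b) * \<bar>c - d\<bar>"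
      using that by (intro mult_left_mono) auto
    then show ?thesis using that by simp
  qed
  show ?thesis
  proof (cases "b \<le> a")
    case False
    then show ?thesis using *[of a b d c] by (simp add: abs_minus_commute algebra_simps)
  qed (rule *)
qed

text \<open>The test functions tend to \<open>h\<close>, which is \<open>f\<close> on the zero set
  of \<open>v\<close> and 0 elsewhere; the \<open>L^2\<close> terms disappear because
  \<open>v * h\<close> is 0. What remains bounds a nonnegative far interaction by a nonpositive near
  interaction, so both are zero. Then almost no pair has \<open>v x > 0\<close> and
  \<open>v y = 0\<close> with \<open>y\<close> in \<Omega>, and a null rectangle has a null
  side.\<close>

theorem eigenfunction_pos:
  fixes v :: "'a::euclidean_space \<Rightarrow> real"
  assumes op: "open \<Omega>" and bd: "bounded \<Omega>" and v: "v \<in> borel_H \<Omega>" and nn: "\<And>x. 0 \<le> v x"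
    and eq: "\<And>\<phi>. \<phi> \<in> borel_H \<Omega> \<Longrightarrow> energy_form v \<phi> = \<mu> * mass_form v \<phi>"
  shows "(AE x in lborel. v x = 0) \<or> (AE x in lborel. x \<in> \<Omega> \<longrightarrow> v x > 0)"
proof -
  interpret G: psd_form_on "borel_H \<Omega>" near_form by (rule psd_near_form)
  note HL = borel_H_subset_borel_L2[OF bd, THEN subsetD]
  define c where "c = log_const DIM('a)"
  have c: "c > 0" unfolding c_def by (rule log_const_pos)
  \<comment> \<open>The distance to the complement is Lipschitz, hence of finite energy, and
    positive exactly in the open set \<Omega>.\<close>
  define f where "f x = infdist x (- \<Omega>)" for x
  have f_nn: "0 \<le> f x" for x by (simp add: f_def infdist_nonneg)
  have f_pos: "0 < f x" if "x \<in> \<Omega>" for x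
    unfolding f_def using that op compl_bounded_nonempty[OF bd] by (intro infdist_pos_not_in_closed) auto
  have f_off: "f x = 0" if "x \<notin> \<Omega>" for x using that by (simp add: f_def)
  have f: "f \<in> borel_H \<Omega>"
    by (rule Lipschitz_borel_H[OF bd f_off, of _ 1]) (auto simp: f_def infdist_triangle_abs simp flip: dist_norm)
  define g where "g n x = max 0 (f x - real n * v x)" for n x
  have g: "g n \<in> borel_H \<Omega>" for n
  proof -
    have "f - real n *\<^sub>R v \<in> borel_H \<Omega>" by (intro G.mem_simps f v)
    note borel_H_pos_part[OF this]
    moreover have "(\<lambda>x. max 0 ((f - real n *\<^sub>R v) x)) = g n" by (simp add: fun_eq_iff g_def)
    ultimately show ?thesis by simp
  qed
  have [measurable]: "v \<in> borel_measurable borel" "f \<in> borel_measurable borel" "g n \<in> borel_measurable borel" for n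
    using v f g[of n] by (auto simp: borel_H_def)
  have [measurable]: "\<Omega> \<in> sets borel" using op by simp
  have g_nn: "0 \<le> g n x" and g_le: "g n x \<le> f x" for n x
    using nn[of x] f_nn[of x] by (auto simp: g_def)
  define h where "h x = (if v x = 0 then f x else 0)" for x
  have [measurable]: "h \<in> borel_measurable borel" unfolding h_def by measurable
  have h_nn: "0 \<le> h x" for x using f_nn by (simp add: h_def)
  have gh: "(\<lambda>n. g n x) \<longlonglongrightarrow> h x" for x
  proof (cases "v x = 0")
    case True
    then show ?thesis using f_nn by (simp add: g_def h_def)
  next
    case False
    then have pos: "v x > 0" using nn[of x] by simp
    obtain M :: nat where M: "f x / v x < M" using reals_Archimedean2 by blast
    have "g n x = 0" if "n \<ge> M" for n
    proof -
      have "f x / v x < n" using M that by simp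
      then show ?thesis using pos by (simp add: g_def field_simps)
    qed
    then have "eventually (\<lambda>n. g n x = 0) sequentially" by (auto simp: eventually_sequentially)
    then show ?thesis using False by (simp add: h_def tendsto_eventually)
  qed
  have vf: "integrable lborel (\<lambda>x. v x * f x)" by (rule borel_L2_cross[OF HL[OF v] HL[OF f]])
  have Ilim: "(\<lambda>n. mass_form v (g n)) \<longlonglongrightarrow> 0"
  proof -
    have "(\<lambda>n. \<integral>x. v x * g n x \<partial>lborel) \<longlonglongrightarrow> (\<integral>x. v x * h x \<partial>lborel)"
    proof (rule integral_dominated_convergence[where w = "\<lambda>x. v x * f x"])
      show "AE x in lborel. (\<lambda>n. v x * g n x) \<longlonglongrightarrow> v x * h x"
        by (intro AE_I2 tendsto_mult tendsto_const gh)
      show "AE x in lborel. norm (v x * g n x) \<le> v x * f x" for n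
        by (intro AE_I2) (auto simp: abs_mult nn g_nn g_le intro!: mult_left_mono)
    qed (use vf in auto)
    moreover have "(\<lambda>x. v x * h x) = (\<lambda>x. 0)" by (auto simp: fun_eq_iff h_def)
    ultimately show ?thesis by (simp add: mass_form_def)
  qed
  have vf2: "integrable lborel2 (\<lambda>(x, y). v x * f y)"
    by (intro integrable_lborel2_product borel_L2_integrable[OF _ bd] HL v f)
  have fv2: "integrable lborel2 (\<lambda>(x, y). f x * v y)"
    by (intro integrable_lborel2_product borel_L2_integrable[OF _ bd] HL v f)
  define Fl where "Fl = (\<integral>(x, y). far (x - y) * (v x * h y) \<partial>lborel2)"
  have iF: "integrable lborel2 (\<lambda>(x, y). far (x - y) * (v x * h y))"
  proof (rule Bochner_Integration.integrable_bound[OF vf2])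
    have "far (x - y) * (v x * h y) \<le> v x * f y" for x y
    proof -
      have "far (x - y) * (v x * h y) \<le> 1 * (v x * f y)"
        using far_le_1[of "x - y"] nn[of x] f_nn[of y] by (intro mult_mono) (auto simp: h_def)
      then show ?thesis by simp
    qed
    then show "AE p in lborel2. norm (case p of (x, y) \<Rightarrow> far (x - y) * (v x * h y)) \<le> norm (case p of (x, y) \<Rightarrow> v x * f y)"
      by (intro AE_I2) (use nn h_nn f_nn in \<open>auto split: prod.splits\<close>)
  qed measurable
  have Flim: "(\<lambda>n. far_form v (g n)) \<longlonglongrightarrow> Fl"
    unfolding far_form_def Fl_def
  proof (rule integral_dominated_convergence[where w = "\<lambda>(x, y). v x * f y"])
    show "AE p in lborel2. (\<lambda>n. case p of (x, y) \<Rightarrow> far (x - y) * (v x * g n y)) \<longlonglongrightarrow> (case p of (x, y) \<Rightarrow> far (x - y) * (v x * h y))"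
      by (intro AE_I2) (auto intro!: tendsto_mult tendsto_const gh split: prod.splits)
    have "far (x - y) * (v x * g n y) \<le> v x * f y" for x y n
    proof -
      have "far (x - y) * (v x * g n y) \<le> 1 * (v x * f y)"
        using far_le_1[of "x - y"] nn[of x] f_nn[of y] g_le[of n y] g_nn[of n y] by (intro mult_mono) auto
      then show ?thesis by simp
    qed
    then show "AE p in lborel2. norm (case p of (x, y) \<Rightarrow> far (x - y) * (v x * g n y)) \<le> (case p of (x, y) \<Rightarrow> v x * f y)" for n
      by (intro AE_I2) (use nn g_nn in \<open>auto split: prod.splits\<close>)
  qed (use vf2 in auto)
  \<comment> \<open>The first summand bounds every \<open>p n\<close> from above. The second makes
    \<open>B\<close> positive at close pairs with \<open>v x > 0\<close> and \<open>v y = 0\<close>,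
    even when \<open>f x = f y\<close>, so that truncation at \<open>- B\<close> cannot erase the
    negative limit.\<close>
  define B where "B = (\<lambda>(x, y). near (x - y) * (\<bar>v x - v y\<bar> * \<bar>f x - f y\<bar>) +
      indicator {z. norm z \<le> 1} (x - y) * (v x * f y + f x * v y))"
  have [measurable]: "{z::'a. norm z \<le> 1} \<in> sets borel" by measurable
  have iB: "integrable lborel2 B"
  proof -
    have 1: "integrable lborel2 (\<lambda>p. near (fst p - snd p) * (\<bar>v (fst p) - v (snd p)\<bar> * \<bar>f (fst p) - f (snd p)\<bar>))"
      using integrable_abs[OF borel_H_cross[OF v f]]
      by (simp add: case_prod_unfold abs_mult)
    have 2: "integrable lborel2 (\<lambda>p. indicator {z. norm z \<le> 1} (fst p - snd p) * (v (fst p) * f (snd p) + f (fst p) * v (snd p)))"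
    proof (rule Bochner_Integration.integrable_bound)
      show "integrable lborel2 (\<lambda>p. v (fst p) * f (snd p) + f (fst p) * v (snd p))"
        using vf2 fv2 by (simp add: case_prod_unfold)
    qed (auto simp: indicator_def)
    show ?thesis using Bochner_Integration.integrable_add[OF 1 2] by (simp add: B_def case_prod_unfold)
  qed
  have B_nn: "0 \<le> B p" for p
    by (auto simp: B_def case_prod_unfold nn f_nn intro!: add_nonneg_nonneg mult_nonneg_nonneg)
  define p where "p n = (\<lambda>(x, y). near (x - y) * ((v x - v y) * (g n x - g n y)))" for n
  define pl where "pl = (\<lambda>(x, y). near (x - y) * ((v x - v y) * (h x - h y)))"
  have [measurable]: "p n \<in> borel_measurable lborel2" "pl \<in> borel_measurable lborel2" "B \<in> borel_measurable lborel2" for n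
    unfolding p_def pl_def B_def by measurable
  have pB: "p n q \<le> B q" for n q
  proof -
    obtain x y where q: "q = (x, y)" by (cases q)
    have "p n q \<le> near (x - y) * (\<bar>v x - v y\<bar> * \<bar>f x - f y\<bar>)"
      unfolding p_def q g_def using pos_part_product_le[of "real n" "v x" "v y" "f x" "f y"]
      by (auto intro!: mult_left_mono)
    also have "\<dots> \<le> B q"
      unfolding B_def q using nn f_nn by (auto intro!: mult_nonneg_nonneg add_nonneg_nonneg)
    finally show ?thesis .
  qed
  \<comment> \<open>\<open>h\<close> lives on the zero set of the nonnegative \<open>v\<close>, so
    the two differences never have the same strict sign.\<close>
  have pl0: "pl q \<le> 0" for q
  proof -
    obtain x y where q: "q = (x, y)" by (cases q)
    have "(v x - v y) * (h x - h y) \<le> 0"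
      using nn[of x] nn[of y] f_nn[of x] f_nn[of y] by (auto simp: h_def mult_nonneg_nonpos mult_nonpos_nonneg)
    then show ?thesis by (simp add: pl_def q mult_nonneg_nonpos)
  qed
  \<comment> \<open>Only the upper bound \<open>p n \<le> B\<close> is available; truncating from below at \<open>- B\<close> makes dominated
    convergence applicable and keeps the limit strictly negative where \<open>v x > 0\<close> and \<open>v y = 0\<close>.\<close>
  define q where "q n z = max (p n z) (- B z)" for n z
  define ql where "ql z = max (pl z) (- B z)" for z
  have iq: "integrable lborel2 ql"
  proof (rule Bochner_Integration.integrable_bound[OF iB])
    show "ql \<in> borel_measurable lborel2" unfolding ql_def by measurable
    have "\<bar>ql z\<bar> \<le> \<bar>B z\<bar>" for z using pl0[of z] B_nn[of z] by (auto simp: ql_def max_def)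
    then show "AE z in lborel2. norm (ql z) \<le> norm (B z)" by simp
  qed
  have qlim: "(\<lambda>n. integral\<^sup>L lborel2 (q n)) \<longlonglongrightarrow> integral\<^sup>L lborel2 ql"
  proof (rule integral_dominated_convergence[where w = B])
    show "AE z in lborel2. (\<lambda>n. q n z) \<longlonglongrightarrow> ql z"
      by (intro AE_I2) (auto simp: q_def ql_def p_def pl_def case_prod_unfold intro!: tendsto_intros gh)
    have "\<bar>q n z\<bar> \<le> B z" for n z using pB[of n z] B_nn[of z] by (auto simp: q_def max_def)
    then show "AE z in lborel2. norm (q n z) \<le> B z" for n by simp
    show "q n \<in> borel_measurable lborel2" for n unfolding q_def by measurable
    show "ql \<in> borel_measurable lborel2" unfolding ql_def by measurable
  qed (fact iB)
  have Gq: "near_form v (g n) \<le> integral\<^sup>L lborel2 (q n)" for n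
  proof -
    have ip: "integrable lborel2 (p n)" unfolding p_def by (rule borel_H_cross[OF v g])
    have "integrable lborel2 (q n)"
    proof (rule Bochner_Integration.integrable_bound[OF iB])
      show "q n \<in> borel_measurable lborel2" unfolding q_def by measurable
      have "\<bar>q n z\<bar> \<le> \<bar>B z\<bar>" for z using pB[of n z] B_nn[of z] by (auto simp: q_def max_def)
      then show "AE z in lborel2. norm (q n z) \<le> norm (B z)" by simp
    qed
    then show ?thesis unfolding near_form_def p_def[symmetric] by (intro integral_mono ip) (simp_all add: q_def)
  qed
  \<comment> \<open>The eigenvalue equation tested with \<open>g n\<close>, solved for the near
    form.\<close>
  have Geq: "near_form v (g n) = 2 / c * ((\<mu> - log_rho DIM('a)) * mass_form v (g n)) + 2 * far_form v (g n)" for n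
    using eq[OF g, of n] c unfolding energy_form_def c_def[symmetric] by (simp add: field_simps)
  have "(\<lambda>n. 2 / c * ((\<mu> - log_rho DIM('a)) * mass_form v (g n)) + 2 * far_form v (g n)) \<longlonglongrightarrow> 2 / c * ((\<mu> - log_rho DIM('a)) * 0) + 2 * Fl"
    by (intro tendsto_intros Ilim Flim)
  then have "(\<lambda>n. near_form v (g n)) \<longlonglongrightarrow> 2 * Fl" by (simp add: Geq)
  from LIMSEQ_le[OF this qlim] have le: "2 * Fl \<le> integral\<^sup>L lborel2 ql" using Gq by auto
  have Fl0: "0 \<le> Fl" unfolding Fl_def by (intro integral_nonneg_AE AE_I2) (auto simp: nn h_nn)
  have ql0: "ql z \<le> 0" for z using pl0[of z] B_nn[of z] by (simp add: ql_def)
  have "integral\<^sup>L lborel2 (\<lambda>z. - ql z) \<ge> 0" using ql0 by (intro integral_nonneg_AE) auto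
  then have qi: "integral\<^sup>L lborel2 (\<lambda>z. - ql z) = 0" and Fi: "Fl = 0" using le Fl0 by auto
  have AEq: "AE z in lborel2. - ql z = 0"
    using qi iq ql0 by (subst (asm) integral_nonneg_eq_0_iff_AE) auto
  have AEF: "AE z in lborel2. (case z of (x, y) \<Rightarrow> far (x - y) * (v x * h y)) = 0"
    using Fi iF nn h_nn unfolding Fl_def by (subst (asm) integral_nonneg_eq_0_iff_AE) (auto split: prod.splits)
  define P where "P = {x. v x > 0}"
  define Z where "Z = {x \<in> \<Omega>. v x = 0}"
  have [measurable]: "P \<in> sets borel" "Z \<in> sets borel" unfolding P_def Z_def by measurable
  have "AE z in lborel2. z \<notin> P \<times> Z"
    using AEq AEF
  proof eventually_elim
    case (elim z)
    obtain x y where z: "z = (x, y)" by (cases z)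
    show ?case
    proof
      assume "z \<in> P \<times> Z"
      then have x: "v x > 0" and y: "v y = 0" "y \<in> \<Omega>" by (auto simp: z P_def Z_def)
      then have fy: "f y > 0" using f_pos by auto
      have xy: "x - y \<noteq> 0" using x y by auto
      show False
      proof (cases "norm (x - y) \<le> 1")
        case True
        then have k: "near (x - y) > 0" using near_ge_1[OF xy True] by linarith
        have "pl z = - (near (x - y) * (v x * f y))" using x y by (simp add: pl_def z h_def)
        moreover have "near (x - y) * (v x * f y) > 0" using k x fy by simp
        moreover have "B z \<ge> v x * f y"
          unfolding B_def z using True nn f_nn by (auto intro!: add_increasing mult_nonneg_nonneg)
        moreover have "v x * f y > 0" using x fy by simp
        ultimately show False using elim(1) by (simp add: ql_def max_def split: if_splits)
      next
        case False
        then have "far (x - y) > 0" using xy by (auto simp: far_def intro!: divide_pos_pos zero_less_power)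
        then have "far (x - y) * (v x * f y) > 0" using x fy by (intro mult_pos_pos)
        moreover have "far (x - y) * (v x * h y) = 0" using elim(2) by (simp only: z prod.case)
        moreover have "h y = f y" using y by (simp add: h_def)
        ultimately show False by (metis less_irrefl)
      qed
    qed
  qed
  then have "P \<times> Z \<in> null_sets lborel2"
    by (subst (asm) AE_iff_null_sets[symmetric]) auto
  then have "emeasure lborel P * emeasure lborel Z = 0"
    by (auto simp: null_sets_def lborel.emeasure_pair_measure_Times)
  then have "P \<in> null_sets lborel \<or> Z \<in> null_sets lborel" by (auto simp: null_sets_def)
  then show ?thesis
  proof
    assume "P \<in> null_sets lborel"
    then have "AE x in lborel. x \<notin> P" by (rule AE_not_in)
    then have "AE x in lborel. v x = 0"
    proof eventually_elim
      case (elim x)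
      then show ?case using nn[of x] by (auto simp: P_def)
    qed
    then show ?thesis ..
  next
    assume "Z \<in> null_sets lborel"
    then have "AE x in lborel. x \<notin> Z" by (rule AE_not_in)
    then have "AE x in lborel. x \<in> \<Omega> \<longrightarrow> v x > 0"
    proof eventually_elim
      case (elim x)
      then show ?case using nn[of x] by (auto simp: Z_def)
    qed
    then show ?thesis ..
  qed
qed

section \<open>From Lebesgue to Borel measurable functions\<close>

text \<open>Integrals ignore null sets, and for a Borel function completing the measure changes
  neither integrability nor the integral.\<close>

lemma lebesgue_transfer:
  fixes f g :: "'c::euclidean_space \<Rightarrow> real"
  assumes g: "g \<in> borel_measurable borel" and ae: "AE x in lborel. f x = g x"
  shows "f \<in> borel_measurable lebesgue" "integral\<^sup>L lebesgue f = integral\<^sup>L lborel g"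
    "integrable lebesgue f \<longleftrightarrow> integrable lborel g"
proof -
  have gl: "g \<in> borel_measurable lebesgue" using g by (simp add: measurable_completion)
  have ae': "AE x in lebesgue. f x = g x" using ae by (simp add: AE_completion_iff)
  have "AE x in lebesgue. g x = f x" using ae' by eventually_elim simp
  then show f: "f \<in> borel_measurable lebesgue" by (rule borel_measurable_AE[OF gl])
  show "integral\<^sup>L lebesgue f = integral\<^sup>L lborel g"
    using integral_cong_AE[OF f gl ae'] integral_completion[of g lborel] g by simp
  show "integrable lebesgue f \<longleftrightarrow> integrable lborel g"
    using integrable_cong_AE[OF f gl ae'] integrable_completion[of g lborel] g by simp
qed

text \<open>On pairs, \<open>lebesgue\<close> completes \<open>lborel\<close> of the product type,
  which is the product measure \<open>lborel2\<close>.\<close>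

lemma lebesgue2_transfer:
  fixes f :: "'a::euclidean_space \<times> 'a \<Rightarrow> real"
  assumes "g \<in> borel_measurable lborel2" and "AE x in lborel2. f x = g x"
  shows "integral\<^sup>L lebesgue f = integral\<^sup>L lborel2 g" "integrable lebesgue f \<longleftrightarrow> integrable lborel2 g"
proof -
  have g: "g \<in> borel_measurable borel" using assms(1) by (simp add: lborel_prod)
  have ae: "AE x in lborel. f x = g x" using assms(2) unfolding lborel_prod .
  show "integral\<^sup>L lebesgue f = integral\<^sup>L lborel2 g" "integrable lebesgue f \<longleftrightarrow> integrable lborel2 g"
    unfolding lborel_prod by (rule lebesgue_transfer[OF g ae])+
qed

text \<open>Multiplying a Borel version by the indicator of the open set \<Omega> upgrades vanishing
  outside \<Omega> from almost everywhere to everywhere.\<close>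

lemma borel_representative:
  fixes u :: "'a::euclidean_space \<Rightarrow> real"
  assumes op: "open \<Omega>" and u: "u \<in> borel_measurable lebesgue" and off: "AE x in lebesgue. x \<notin> \<Omega> \<longrightarrow> u x = 0"
  obtains u' where "u' \<in> borel_measurable borel" "\<And>x. x \<notin> \<Omega> \<Longrightarrow> u' x = 0" "AE x in lborel. u x = u' x"
proof -
  obtain g where g: "g \<in> borel_measurable lborel" and ae: "AE x in lborel. u x = g x"
    using completion_ex_borel_measurable_real[OF u] by blast
  have [measurable]: "g \<in> borel_measurable borel" "\<Omega> \<in> sets borel" using g op by auto
  have "AE x in lborel. x \<notin> \<Omega> \<longrightarrow> u x = 0" using off by (simp add: AE_completion_iff)
  with ae have "AE x in lborel. u x = indicator \<Omega> x * g x"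
    by eventually_elim (auto simp: indicator_def)
  then show thesis by (intro that[of "\<lambda>x. indicator \<Omega> x * g x"]) auto
qed

context
  fixes u w u' w' :: "'a::euclidean_space \<Rightarrow> real"
  assumes u': "u' \<in> borel_measurable borel" and w': "w' \<in> borel_measurable borel"
    and u: "AE x in lborel. u x = u' x" and w: "AE x in lborel. w x = w' x"
begin

lemma log_form_eq_energy_form: "log_form u w = energy_form u' w'"
proof -
  note [measurable] = u' w'
  note ae = AE_lborel2_both[OF u] AE_lborel2_both[OF w]
  have "log_inner u w = log_const DIM('a) / 2 * near_form u' w'"
  proof -
    have "AE p in lborel2. indicator {(x, y). norm (x - y) \<le> 1} p *\<^sub>R
        (case p of (x, y) \<Rightarrow> (u x - u y) * (w x - w y) / norm (x - y) ^ DIM('a))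
      = (case p of (x, y) \<Rightarrow> near (x - y) * ((u' x - u' y) * (w' x - w' y)))"
      using ae by eventually_elim (auto simp: near_def indicator_def case_prod_unfold)
    from lebesgue2_transfer(1)[OF _ this] show ?thesis
      by (simp add: log_inner_def set_lebesgue_integral_def near_form_def)
  qed
  moreover have "(LINT (x, y):{(x, y). norm (x - y) \<ge> 1}|lebesgue. u x * w y / norm (x - y) ^ DIM('a)) = far_form u' w'"
  proof -
    have "AE p in lborel2. indicator {(x, y). norm (x - y) \<ge> 1} p *\<^sub>R
        (case p of (x, y) \<Rightarrow> u x * w y / norm (x - y) ^ DIM('a))
      = (case p of (x, y) \<Rightarrow> far (x - y) * (u' x * w' y))"
      using ae by eventually_elim (auto simp: far_def indicator_def case_prod_unfold)
    from lebesgue2_transfer(1)[OF _ this] show ?thesis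
      by (simp add: set_lebesgue_integral_def far_form_def)
  qed
  moreover have "(LINT x|lebesgue. u x * w x) = mass_form u' w'"
  proof -
    have "AE x in lborel. u x * w x = u' x * w' x" using u w by eventually_elim simp
    from lebesgue_transfer(2)[OF _ this] show ?thesis by (simp add: mass_form_def)
  qed
  ultimately show ?thesis by (simp add: log_form_def energy_form_def)
qed

lemma L2_inner_eq_mass_form:
  assumes "\<And>x. x \<notin> \<Omega> \<Longrightarrow> u' x = 0"
  shows "L2_inner \<Omega> u w = mass_form u' w'"
proof -
  note [measurable] = u' w'
  have "AE x in lborel. indicator \<Omega> x *\<^sub>R (u x * w x) = u' x * w' x"
    using u w by eventually_elim (use assms in \<open>auto simp: indicator_def\<close>)
  from lebesgue_transfer(2)[OF _ this] show ?thesis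
    by (simp add: L2_inner_def set_lebesgue_integral_def mass_form_def)
qed

end

lemma log_space_integrable_iff:
  fixes u u' :: "'a::euclidean_space \<Rightarrow> real"
  assumes u': "u' \<in> borel_measurable borel" and u: "AE x in lborel. u x = u' x"
  shows "set_integrable lebesgue {(x, y). norm (x - y) \<le> 1} (\<lambda>(x, y). (u x - u y)\<^sup>2 / norm (x - y) ^ DIM('a))
    \<longleftrightarrow> integrable lborel2 (\<lambda>(x, y). near (x - y) * (u' x - u' y)\<^sup>2)"
proof -
  note [measurable] = u'
  have "AE p in lborel2. indicator {(x, y). norm (x - y) \<le> 1} p *\<^sub>R
      (case p of (x, y) \<Rightarrow> (u x - u y)\<^sup>2 / norm (x - y) ^ DIM('a))
    = (case p of (x, y) \<Rightarrow> near (x - y) * (u' x - u' y)\<^sup>2)"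
    using AE_lborel2_both[OF u] by eventually_elim (auto simp: near_def indicator_def case_prod_unfold)
  from lebesgue2_transfer(2)[OF _ this] show ?thesis by (simp add: set_integrable_def)
qed

lemma borel_H_subset_log_space: "u \<in> borel_H \<Omega> \<Longrightarrow> u \<in> log_space \<Omega>"
  using log_space_integrable_iff[of u u]
  by (auto simp: borel_H_def log_space_def measurable_completion)

lemma log_space_representative:
  fixes u :: "'a::euclidean_space \<Rightarrow> real"
  assumes op: "open \<Omega>" and u: "u \<in> log_space \<Omega>"
  obtains u' where "u' \<in> borel_H \<Omega>" "AE x in lborel. u x = u' x"
proof -
  obtain u' where u': "u' \<in> borel_measurable borel" "\<And>x. x \<notin> \<Omega> \<Longrightarrow> u' x = 0" "AE x in lborel. u x = u' x"
    using borel_representative[OF op, of u] u by (auto simp: log_space_def)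
  then have "u' \<in> borel_H \<Omega>" using log_space_integrable_iff[OF u'(1,3)] u by (simp add: borel_H_def log_space_def)
  then show thesis by (rule that[OF _ u'(3)])
qed

lemma borel_L2_subset_L2_space:
  assumes u: "u \<in> borel_L2 \<Omega>"
  shows "u \<in> L2_space \<Omega>"
proof -
  have [measurable]: "u \<in> borel_measurable borel" using u by (simp add: borel_L2_def)
  have "integrable lebesgue (\<lambda>x. (u x)\<^sup>2)"
    using u by (subst integrable_completion) (simp_all add: borel_L2_def)
  then show ?thesis using u by (simp add: borel_L2_def L2_space_def measurable_completion)
qed

lemma L2_space_representative:
  fixes u :: "'a::euclidean_space \<Rightarrow> real"
  assumes op: "open \<Omega>" and u: "u \<in> L2_space \<Omega>"
  obtains u' where "u' \<in> borel_L2 \<Omega>" "AE x in lborel. u x = u' x"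
proof -
  obtain u' where u': "u' \<in> borel_measurable borel" "\<And>x. x \<notin> \<Omega> \<Longrightarrow> u' x = 0" and ae: "AE x in lborel. u x = u' x"
    using borel_representative[OF op, of u] u by (auto simp: L2_space_def)
  have "AE x in lborel. (u x)\<^sup>2 = (u' x)\<^sup>2" using ae by eventually_elim simp
  from lebesgue_transfer(3)[OF _ this] have "u' \<in> borel_L2 \<Omega>" using u u' by (simp add: borel_L2_def L2_space_def)
  then show thesis by (rule that[OF _ ae])
qed

lemma mass_form_null_AE:
  assumes w: "w \<in> borel_L2 \<Omega>" and "mass_form w w = 0"
  shows "AE x in lborel. w x = 0"
proof -
  have "(\<integral>x. (w x)\<^sup>2 \<partial>lborel) = 0" using assms by (simp add: mass_form_def power2_eq_square)
  then have "AE x in lborel. (w x)\<^sup>2 = 0"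
    using w by (subst (asm) integral_nonneg_eq_0_iff_AE) (auto simp: borel_L2_def)
  then show ?thesis by eventually_elim simp
qed

text \<open>The product \<open>w * v\<close> is nonnegative almost everywhere with integral 0, hence
  null; division by \<open>v > 0\<close> inside \<Omega> leaves \<open>w = 0\<close>.\<close>

lemma signed_orthogonal_to_pos:
  fixes w v :: "'a::euclidean_space \<Rightarrow> real"
  assumes w: "w \<in> borel_L2 \<Omega>" and v: "v \<in> borel_L2 \<Omega>" and pos: "AE x in lborel. x \<in> \<Omega> \<longrightarrow> v x > 0"
    and nn: "AE x in lborel. 0 \<le> w x" and I: "mass_form w v = 0"
  shows "AE x in lborel. w x = 0"
proof -
  have "AE x in lborel. 0 \<le> w x * v x"
    using pos nn by eventually_elim (use w in \<open>auto simp: borel_L2_def zero_le_mult_iff less_imp_le\<close>)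
  then have "AE x in lborel. w x * v x = 0"
    using I integral_nonneg_eq_0_iff_AE[OF borel_L2_cross[OF w v]] by (simp add: mass_form_def)
  with pos show ?thesis by eventually_elim (use w in \<open>auto simp: borel_L2_def\<close>)
qed

section \<open>The eigenvalue sequence for Lebesgue measurable functions\<close>

theorem theorem1p4:
  fixes \<Omega> :: "'a::euclidean_space set"
  assumes "open \<Omega>" and "connected \<Omega>" and "\<Omega> \<noteq> {}" and "bounded \<Omega>"
  shows "\<exists>(eig :: nat \<Rightarrow> real) (\<xi> :: nat \<Rightarrow> 'a \<Rightarrow> real).
    eig 1 < eig 2 \<and> (\<forall>k\<ge>2. eig k \<le> eig (k + 1)) \<and>
    (\<forall>k\<ge>1. eigenfunction \<Omega> (eig k) (\<xi> k)) \<and>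
    (\<forall>k\<ge>1. is_minimum (eig k)
       {log_form u u | u. u \<in> constrained_space \<Omega> \<xi> k \<and> L2_norm \<Omega> u = 1}) \<and>
    orthonormal_basis_L2 \<Omega> \<xi> \<and>
    (AE x in lebesgue. x \<in> \<Omega> \<longrightarrow> \<xi> 1 x > 0) \<and>
    (\<forall>u. weak_solution \<Omega> (eig 1) u \<longrightarrow> (\<exists>t. AE x in lebesgue. u x = t * \<xi> 1 x)) \<and>
    filterlim eig at_top sequentially"
proof -
  note op = \<open>open \<Omega>\<close> and bd = \<open>bounded \<Omega>\<close>
  obtain C where "spectral_problem (borel_L2 \<Omega>) (borel_H \<Omega>) mass_form energy_form C"
    using log_spectral_problem[OF op \<open>\<Omega> \<noteq> {}\<close> bd] by blast
  then interpret S: spectral_problem "borel_L2 \<Omega>" "borel_H \<Omega>" mass_form energy_form C .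
  have abs_min: "S.minimizer (borel_H \<Omega>) (\<lambda>x. \<bar>v x\<bar>)" if v: "S.minimizer (borel_H \<Omega>) v" for v
  proof -
    have vH: "v \<in> borel_H \<Omega>" "mass_form v v = 1" using v by (auto simp: S.minimizer_def)
    have "mass_form (\<lambda>x. \<bar>v x\<bar>) (\<lambda>x. \<bar>v x\<bar>) = 1" using vH(2) by (simp add: mass_form_def)
    moreover have "energy_form (\<lambda>x. \<bar>v x\<bar>) (\<lambda>x. \<bar>v x\<bar>) \<le> energy_form w w" if "w \<in> borel_H \<Omega>" "mass_form w w = 1" for w
    proof -
      have "energy_form v v \<le> energy_form w w" using v that by (simp add: S.minimizer_def)
      then show ?thesis using energy_form_abs_le[OF vH(1) bd] by linarith
    qed
    ultimately show ?thesis using borel_H_abs(1)[OF vH(1)] by (simp add: S.minimizer_def)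
  qed
  obtain v0 where v0: "S.minimizer (borel_H \<Omega>) v0" using S.first_minimizer_exists by blast
  define v where "v x = \<bar>v0 x\<bar>" for x
  have vmin: "S.minimizer (borel_H \<Omega>) v" using abs_min[OF v0] by (simp add: v_def[abs_def])
  show ?thesis
  proof (rule S.spectral_sequence[OF vmin])
    fix \<xi> :: "nat \<Rightarrow> 'a \<Rightarrow> real" and eig :: "nat \<Rightarrow> real"
    assume x1: "\<xi> 1 = v" and xH: "\<And>k. k \<ge> 1 \<Longrightarrow> \<xi> k \<in> borel_H \<Omega>"
      and ek: "\<And>k. k \<ge> 1 \<Longrightarrow> eig k = energy_form (\<xi> k) (\<xi> k)"
      and on: "\<And>j k. j \<ge> 1 \<Longrightarrow> k \<ge> 1 \<Longrightarrow> mass_form (\<xi> j) (\<xi> k) = (if j = k then 1 else 0)"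
      and min: "\<And>k. k \<ge> 1 \<Longrightarrow> S.minimizer (S.orth_compl \<xi> k) (\<xi> k)"
      and eqn: "\<And>k \<phi>. k \<ge> 1 \<Longrightarrow> \<phi> \<in> borel_H \<Omega> \<Longrightarrow> energy_form (\<xi> k) \<phi> = eig k * mass_form (\<xi> k) \<phi>"
      and mono: "\<And>j k. 1 \<le> j \<Longrightarrow> j \<le> k \<Longrightarrow> eig j \<le> eig k"
      and lim: "filterlim eig at_top sequentially"
      and basis: "\<And>f. f \<in> borel_L2 \<Omega> \<Longrightarrow> (\<lambda>n. mass_form (f - (\<Sum>k=1..n. mass_form f (\<xi> k) *\<^sub>R \<xi> k)) (f - (\<Sum>k=1..n. mass_form f (\<xi> k) *\<^sub>R \<xi> k))) \<longlonglongrightarrow> 0"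
    have vH: "v \<in> borel_H \<Omega>" using xH[of 1] x1 by simp
    have v_nn: "0 \<le> v x" for x by (simp add: v_def)
    have vv: "mass_form v v = 1" using on[of 1 1] x1 by simp
    have e1: "eig 1 = energy_form v v" using ek[of 1] x1 by simp
    have not_null: "\<not> (AE x in lborel. w x = 0)" if "mass_form w w = 1" for w :: "'a \<Rightarrow> real"
    proof
      assume "AE x in lborel. w x = 0"
      then have "AE x in lborel. w x * w x = 0" by eventually_elim simp
      then have "mass_form w w = 0" unfolding mass_form_def by (rule integral_eq_zero_AE)
      then show False using that by simp
    qed
    have v_pos: "AE x in lborel. x \<in> \<Omega> \<longrightarrow> v x > 0"
      using eigenfunction_pos[OF op bd vH v_nn, of "eig 1"] eqn[of 1] x1 not_null[OF vv] by auto
    have simple: "\<exists>t. AE x in lborel. u x = t * v x"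
      if u: "u \<in> borel_H \<Omega>" and ueq: "\<And>\<phi>. \<phi> \<in> borel_H \<Omega> \<Longrightarrow> energy_form u \<phi> = eig 1 * mass_form u \<phi>" for u
    proof -
      \<comment> \<open>It suffices that the component of \<open>u\<close> orthogonal to
        \<open>v\<close> is null. Otherwise its normalisation \<open>z\<close> would be a first
        eigenfunction of constant sign, incompatible with orthogonality to the positive
        \<open>v\<close>.\<close>
      define w where "w = u - mass_form u v *\<^sub>R v"
      have wH: "w \<in> borel_H \<Omega>" unfolding w_def by (intro S.Q.mem_simps u vH)
      have wL: "w \<in> borel_L2 \<Omega>" using wH by auto
      have wv: "mass_form w v = 0"
        unfolding w_def using u vH vv by (subst S.I.diff_left) (auto simp: S.I.scale_left)
      have weq: "energy_form w \<phi> = eig 1 * mass_form w \<phi>" if \<phi>: "\<phi> \<in> borel_H \<Omega>" for \<phi>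
      proof -
        have "energy_form w \<phi> = energy_form u \<phi> - mass_form u v * energy_form v \<phi>"
          unfolding w_def using u vH \<phi> by (subst S.Q.diff_left) (auto simp: S.Q.scale_left)
        also have "\<dots> = eig 1 * (mass_form u \<phi> - mass_form u v * mass_form v \<phi>)"
          using ueq[OF \<phi>] eqn[of 1, OF _ \<phi>] x1 by (simp add: algebra_simps)
        also have "mass_form u \<phi> - mass_form u v * mass_form v \<phi> = mass_form w \<phi>"
          unfolding w_def using u vH \<phi> by (subst S.I.diff_left) (auto simp: S.I.scale_left)
        finally show ?thesis .
      qed
      have "mass_form w w = 0"
      proof (rule ccontr)
        assume "mass_form w w \<noteq> 0"
        then have pos: "mass_form w w > 0" using S.I.nonneg[OF wL] by simp
        define z where "z = (1 / sqrt (mass_form w w)) *\<^sub>R w"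
        have zH: "z \<in> borel_H \<Omega>" unfolding z_def by (intro S.Q.mem_simps wH)
        have zL: "z \<in> borel_L2 \<Omega>" using zH by auto
        have zeq: "energy_form z \<phi> = eig 1 * mass_form z \<phi>" if "\<phi> \<in> borel_H \<Omega>" for \<phi>
          unfolding z_def using wH weq[OF that] that by (simp add: S.Q.scale_left S.I.scale_left)
        have zz: "mass_form z z = 1" unfolding z_def using pos wL by (simp add: S.I.square_scale power_divide)
        have zv: "mass_form z v = 0" unfolding z_def using wv wL vH by (simp add: S.I.scale_left)
        \<comment> \<open>Testing the equation of \<open>z\<close> with \<open>z\<close> itself
          shows that its energy is \<open>eig 1\<close>, the minimal value.\<close>
        have "S.minimizer (borel_H \<Omega>) z"
          using vmin zH zz zeq[OF zH] e1 by (simp add: S.minimizer_def)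
        from abs_min[OF this] have amin: "S.minimizer (borel_H \<Omega>) (\<lambda>x. \<bar>z x\<bar>)" .
        let ?a = "\<lambda>x. \<bar>z x\<bar>"
        have aH: "?a \<in> borel_H \<Omega>" by (rule borel_H_abs(1)[OF zH])
        have "energy_form ?a ?a \<le> energy_form v v"
          using amin vH vv unfolding S.minimizer_def by simp
        moreover have "energy_form v v \<le> energy_form ?a ?a"
          using amin vmin unfolding S.minimizer_def by simp
        ultimately have "energy_form ?a ?a = energy_form v v" by simp
        then have aeq: "energy_form ?a \<phi> = eig 1 * mass_form ?a \<phi>" if "\<phi> \<in> borel_H \<Omega>" for \<phi>
          using S.Euler_Lagrange[OF amin S.Q.subspace order_refl that] e1 by simp
        \<comment> \<open>\<open>p\<close> is twice the positive part of \<open>z\<close> and again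
          solves the equation, so it is null or positive almost everywhere in \<Omega>; accordingly
          \<open>z\<close> is nonpositive or positive there.\<close>
        define p where "p = ?a + z"
        have pH: "p \<in> borel_H \<Omega>" unfolding p_def by (intro S.Q.mem_simps aH zH)
        have "energy_form p \<phi> = eig 1 * mass_form p \<phi>" if "\<phi> \<in> borel_H \<Omega>" for \<phi>
          unfolding p_def using aH zH that
          by (simp add: S.Q.add_left S.I.add_left aeq zeq algebra_simps)
        moreover have "0 \<le> p x" for x by (simp add: p_def)
        ultimately have "(AE x in lborel. p x = 0) \<or> (AE x in lborel. x \<in> \<Omega> \<longrightarrow> p x > 0)"
          using eigenfunction_pos[OF op bd pH] by blast
        then have "AE x in lborel. z x = 0"
        proof
          assume "AE x in lborel. p x = 0"
          then have "AE x in lborel. 0 \<le> ((-1) *\<^sub>R z) x" by eventually_elim (simp add: p_def)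
          moreover have "(-1) *\<^sub>R z \<in> borel_L2 \<Omega>" "mass_form ((-1) *\<^sub>R z) v = 0"
            using zL zv vH S.I.scale_left[OF zL, of v "-1"] S.I.mem_simps(4)[OF zL, of "-1"] by auto
          ultimately have "AE x in lborel. ((-1) *\<^sub>R z) x = 0"
            using signed_orthogonal_to_pos[OF _ _ v_pos] vH by blast
          then show ?thesis by eventually_elim simp
        next
          assume "AE x in lborel. x \<in> \<Omega> \<longrightarrow> p x > 0"
          then have "AE x in lborel. 0 \<le> z x"
            by eventually_elim (use zL in \<open>auto simp: p_def borel_L2_def\<close>)
          then show ?thesis using signed_orthogonal_to_pos[OF zL _ v_pos _ zv] vH by blast
        qed
        then show False using not_null[OF zz] by simp
      qed
      then have "AE x in lborel. w x = 0" by (rule mass_form_null_AE[OF wL])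
      then have "AE x in lborel. u x = mass_form u v * v x" by eventually_elim (simp add: w_def)
      then show ?thesis by blast
    qed
    have meas: "\<xi> k \<in> borel_measurable borel" "\<And>x. x \<notin> \<Omega> \<Longrightarrow> \<xi> k x = 0" if "k \<ge> 1" for k
      using xH[OF that] by (auto simp: borel_H_def)
    have refl: "AE x in lborel. f x = f x" for f :: "'a \<Rightarrow> real" by simp
    \<comment> \<open>A double first eigenvalue would make \<open>\<xi> 2\<close> a multiple of
      \<open>\<xi> 1\<close>; being orthogonal to it, \<open>\<xi> 2\<close> would be null.\<close>
    have strict: "eig 1 < eig 2"
    proof (rule ccontr)
      assume "\<not> ?thesis"
      then have e12: "eig 2 = eig 1" using mono[of 1 2] by simp
      obtain t where t: "AE x in lborel. \<xi> 2 x = t * v x"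
        using simple[of "\<xi> 2"] xH[of 2] eqn[of 2] e12 by auto
      have "mass_form (\<xi> 2) v = mass_form (t *\<^sub>R v) v"
        unfolding mass_form_def
      proof (rule integral_cong_AE)
        show "AE x in lborel. \<xi> 2 x * v x = (t *\<^sub>R v) x * v x" using t by eventually_elim simp
        have [measurable]: "v \<in> borel_measurable borel" "\<xi> 2 \<in> borel_measurable borel"
          using vH meas(1)[of 2] by (auto simp: borel_H_def)
        show "(\<lambda>x. \<xi> 2 x * v x) \<in> borel_measurable lborel" by measurable
        show "(\<lambda>x. (t *\<^sub>R v) x * v x) \<in> borel_measurable lborel" by simp
      qed
      then have "t = 0" using on[of 2 1] x1 vv vH S.I.scale_left[of v v t] by auto
      then show False using t not_null[of "\<xi> 2"] on[of 2 2] by simp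
    qed
    have weak: "weak_solution \<Omega> (eig k) (\<xi> k)" if k: "k \<ge> 1" for k
      unfolding weak_solution_def
    proof (intro conjI ballI)
      show "\<xi> k \<in> log_space \<Omega>" by (rule borel_H_subset_log_space[OF xH[OF k]])
      fix \<phi> assume "\<phi> \<in> log_space \<Omega>"
      then obtain \<phi>' where \<phi>': "\<phi>' \<in> borel_H \<Omega>" "AE x in lborel. \<phi> x = \<phi>' x"
        using log_space_representative[OF op] by blast
      show "log_form (\<xi> k) \<phi> = eig k * L2_inner \<Omega> (\<xi> k) \<phi>"
        using log_form_eq_energy_form[OF meas(1)[OF k] measurable_borel_H[OF \<phi>'(1)] refl \<phi>'(2)]
          L2_inner_eq_mass_form[OF meas(1)[OF k] measurable_borel_H[OF \<phi>'(1)] refl \<phi>'(2) meas(2)[OF k]]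
          eqn[OF k \<phi>'(1)] by simp
    qed
    have eigf: "eigenfunction \<Omega> (eig k) (\<xi> k)" if k: "k \<ge> 1" for k
      using weak[OF k] not_null[of "\<xi> k"] on[OF k k] by (simp add: eigenfunction_def AE_completion_iff)
    have L2n: "L2_norm \<Omega> u = 1 \<longleftrightarrow> mass_form u' u' = 1" if "u' \<in> borel_H \<Omega>" "AE x in lborel. u x = u' x" for u u'
      using L2_inner_eq_mass_form[OF measurable_borel_H[OF that(1)] measurable_borel_H[OF that(1)] that(2,2), of \<Omega>] that(1)
      by (auto simp: L2_norm_def borel_H_def)
    have minim: "is_minimum (eig k) {log_form u u | u. u \<in> constrained_space \<Omega> \<xi> k \<and> L2_norm \<Omega> u = 1}" if k: "k \<ge> 1" for k
      unfolding is_minimum_def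
    proof (intro conjI ballI)
      have "\<xi> k \<in> constrained_space \<Omega> \<xi> k"
        using borel_H_subset_log_space[OF xH[OF k]] on k
          L2_inner_eq_mass_form[OF meas(1)[OF k] meas(1) refl refl meas(2)[OF k]]
        by (auto simp: constrained_space_def)
      moreover have "L2_norm \<Omega> (\<xi> k) = 1" using L2n[OF xH[OF k] refl] on[OF k k] by simp
      moreover have "eig k = log_form (\<xi> k) (\<xi> k)"
        using log_form_eq_energy_form[OF meas(1)[OF k] meas(1)[OF k] refl refl] ek[OF k] by simp
      ultimately show "eig k \<in> {log_form u u | u. u \<in> constrained_space \<Omega> \<xi> k \<and> L2_norm \<Omega> u = 1}" by blast
    next
      fix s assume "s \<in> {log_form u u | u. u \<in> constrained_space \<Omega> \<xi> k \<and> L2_norm \<Omega> u = 1}"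
      then obtain u where u: "s = log_form u u" "u \<in> constrained_space \<Omega> \<xi> k" "L2_norm \<Omega> u = 1" by blast
      then obtain u' where u': "u' \<in> borel_H \<Omega>" "AE x in lborel. u x = u' x"
        using log_space_representative[OF op, of u] by (auto simp: constrained_space_def)
      have off: "\<And>x. x \<notin> \<Omega> \<Longrightarrow> u' x = 0" using u'(1) by (simp add: borel_H_def)
      \<comment> \<open>The constraints see only the almost everywhere class, so the Borel
        representative inherits them and competes in the abstract minimisation.\<close>
      have "mass_form u' (\<xi> i) = 0" if "i \<in> {1..<k}" for i
      proof -
        have "L2_inner \<Omega> u (\<xi> i) = mass_form u' (\<xi> i)"
          using that by (intro L2_inner_eq_mass_form measurable_borel_H[OF u'(1)] meas(1) u'(2) refl off) auto
        then show ?thesis using u(2) that by (simp add: constrained_space_def)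
      qed
      then have "u' \<in> S.orth_compl \<xi> k" using u'(1) by (simp add: S.orth_compl_def)
      moreover have "mass_form u' u' = 1" using L2n[OF u'] u(3) by simp
      ultimately have "eig k \<le> energy_form u' u'" using min[OF k] ek[OF k] by (simp add: S.minimizer_def)
      also have "\<dots> = s"
        using log_form_eq_energy_form[OF measurable_borel_H[OF u'(1)] measurable_borel_H[OF u'(1)] u'(2,2)] u(1) by simp
      finally show "eig k \<le> s" .
    qed
    have onb: "orthonormal_basis_L2 \<Omega> \<xi>"
      unfolding orthonormal_basis_L2_def
    proof (intro conjI allI impI ballI)
      show "\<xi> k \<in> L2_space \<Omega>" if "k \<ge> 1" for k
        by (rule borel_L2_subset_L2_space[OF S.H_L[OF xH[OF that]]])
      show "L2_inner \<Omega> (\<xi> j) (\<xi> k) = (if j = k then 1 else 0)" if "j \<ge> 1" "k \<ge> 1" for j k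
        using L2_inner_eq_mass_form[OF meas(1)[OF that(1)] meas(1)[OF that(2)] refl refl meas(2)[OF that(1)]] on[OF that] by simp
      fix f assume "f \<in> L2_space \<Omega>"
      then obtain f' where f': "f' \<in> borel_L2 \<Omega>" "AE x in lborel. f x = f' x"
        using L2_space_representative[OF op] by blast
      have coef: "L2_inner \<Omega> f (\<xi> k) = mass_form f' (\<xi> k)" if "k \<ge> 1" for k
        by (rule L2_inner_eq_mass_form[OF measurable_borel_L2[OF f'(1)] meas(1)[OF that] f'(2) refl])
           (use f'(1) in \<open>simp add: borel_L2_def\<close>)
      define s where "s n = f' - (\<Sum>k=1..n. mass_form f' (\<xi> k) *\<^sub>R \<xi> k)" for n
      have sL: "s n \<in> borel_L2 \<Omega>" for n
        unfolding s_def by (intro S.I.mem_simps(3) S.I.mem_lincomb f'(1)) (use xH in auto)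
      have "L2_norm \<Omega> (\<lambda>x. f x - (\<Sum>k=1..n. L2_inner \<Omega> f (\<xi> k) * \<xi> k x)) = sqrt (mass_form (s n) (s n))" for n
      proof -
        \<comment> \<open>The Fourier coefficients of \<open>f\<close> and \<open>f'\<close>
          coincide, so \<open>s n\<close> is a Borel representative of the remainder of
          \<open>f\<close>.\<close>
        have "AE x in lborel. f x - (\<Sum>k=1..n. L2_inner \<Omega> f (\<xi> k) * \<xi> k x) = s n x"
          using f'(2) by eventually_elim (simp add: s_def sum_fun_apply coef)
        from L2_inner_eq_mass_form[OF measurable_borel_L2[OF sL] measurable_borel_L2[OF sL] this this, of \<Omega>]
        show ?thesis using sL[of n] by (simp add: L2_norm_def borel_L2_def)
      qed
      moreover have "(\<lambda>n. sqrt (mass_form (s n) (s n))) \<longlonglongrightarrow> sqrt 0"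
        unfolding s_def by (intro tendsto_real_sqrt basis f'(1))
      ultimately show "(\<lambda>n. L2_norm \<Omega> (\<lambda>x. f x - (\<Sum>k=1..n. L2_inner \<Omega> f (\<xi> k) * \<xi> k x))) \<longlonglongrightarrow> 0"
        by simp
    qed
    have unique: "\<exists>t. AE x in lebesgue. u x = t * \<xi> 1 x" if u: "weak_solution \<Omega> (eig 1) u" for u
    proof -
      obtain u' where u': "u' \<in> borel_H \<Omega>" "AE x in lborel. u x = u' x"
        using log_space_representative[OF op, of u] u by (auto simp: weak_solution_def)
      have off: "\<And>x. x \<notin> \<Omega> \<Longrightarrow> u' x = 0" using u'(1) by (simp add: borel_H_def)
      have "energy_form u' \<phi> = eig 1 * mass_form u' \<phi>" if \<phi>: "\<phi> \<in> borel_H \<Omega>" for \<phi>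
        using u borel_H_subset_log_space[OF \<phi>]
          log_form_eq_energy_form[OF measurable_borel_H[OF u'(1)] measurable_borel_H[OF \<phi>] u'(2) refl]
          L2_inner_eq_mass_form[OF measurable_borel_H[OF u'(1)] measurable_borel_H[OF \<phi>] u'(2) refl off]
        by (simp add: weak_solution_def)
      then obtain t where "AE x in lborel. u' x = t * v x" using simple[OF u'(1)] by blast
      with u'(2) have "AE x in lborel. u x = t * v x" by eventually_elim simp
      then show ?thesis unfolding x1 AE_completion_iff by blast
    qed
    have pos: "AE x in lebesgue. x \<in> \<Omega> \<longrightarrow> \<xi> 1 x > 0" 
      unfolding x1 AE_completion_iff by (rule v_pos)
    show ?thesis
      by (intro exI[of _ eig] exI[of _ \<xi>] conjI allI impI strict eigf minim onb pos unique lim mono) auto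
  qed
qed

end
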